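(* Let $f(z)=\prod_{1\le\delta\mid24}\eta^{r_\delta}(\delta z)\in E_2(\Gamma_0(24),\chi_{24})$ be any of the 8 eta quotients whose exponents $(r_1,r_2,r_3,r_4,r_6,r_8,r_{12},r_{24})$ are listed in the left part of the table below. Then $$f(z)=b_1E_{24,1}(z)+b_2E_{1,24}(z)+b_3E_{-8,-3}(z)+b_4E_{-3,-8}(z),$$ where the coefficients are given in the right part of the same row: $$\begin{array}{rrrrrrrr|rrrr} r_1&r_2&r_3&r_4&r_6&r_8&r_{12}&r_{24}&b_1&b_2&b_3&b_4\\ \hline 0&-2&-2&5&1&-2&8&-4&-1/3&2/3&1/3&-2/3\\ -1&-1&1&6&-2&-3&5&-1&0&2/3&1/3&0\\ -2&1&0&8&-2&-4&5&-2&-1/3&2&1&-2/3\\ -2&5&-4&-2&8&0&1&-2&-1/3&4/3&-1/3&4/3\\ -3&6&-1&-1&5&-1&-2&1&0&4/3&-1/3&0\\ -4&8&-2&1&5&-2&-2&0&-1/3&4&-1&4/3\\ 1&-2&-1&5&-1&-1&6&-3&-1/3&0&0&-2/3\\ -1&5&-3&-2&6&1&-1&-1&-1/3&0&0&4/3 \end{array}$$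
   Context: Here $z\in\mathbb{H}$ (upper half plane) and $q=e^{2\pi i z}$. The Dedekind eta function is $\eta(z)=e^{\pi i z/12}\prod_{n=1}^\infty(1-e^{2\pi i n z})$. For $t\in\{-8,-3,1,24\}$, $\chi_t(m)=\left(\frac{t}{m}\right)$ (Kronecker symbol); $\chi_1$ is trivial. $E_2(\Gamma_0(24),\chi_{24})$ denotes the Eisenstein subspace of the space $M_2(\Gamma_0(24),\chi_{24})$ of weight 2 modular forms for $\Gamma_0(24)$ with multiplier system $\chi_{24}$. For Dirichlet characters $\chi,\psi$ and $n\in\mathbb{N}$, $\sigma_{(\chi,\psi)}(n)=\sum_{1\le m\mid n}\chi(m)\psi(n/m)\,m$. Define $$E_{t_1,t_2}(z)=C_{t_1,t_2}+\sum_{n=1}^\infty\sigma_{(\chi_{t_1},\chi_{t_2})}(n)q^n,$$ with $C_{24,1}=-3$ and $C_{1,24}=C_{-8,-3}=C_{-3,-8}=0$. *)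

theory Defs
  imports "HOL-Analysis.Analysis" "HOL-Number_Theory.Number_Theory"
begin

definition dedekind_eta :: "complex \<Rightarrow> complex" where
  "dedekind_eta z = exp (of_real pi * \<i> * z / 12) *
     (\<Prod>n. 1 - exp (2 * of_real pi * \<i> * of_nat (Suc n) * z))"

definition eta_quotient :: "nat \<Rightarrow> (nat \<Rightarrow> int) \<Rightarrow> complex \<Rightarrow> complex" where
  "eta_quotient N r z = (\<Prod>\<delta> | \<delta> dvd N. dedekind_eta (of_nat \<delta> * z) powi r \<delta>)"

definition kronecker_prime :: "int \<Rightarrow> nat \<Rightarrow> int" where
  "kronecker_prime a p =
     (if p = 2 then (if even a then 0 else if a mod 8 \<in> {1, 7} then 1 else -1)
      else Legendre a (int p))"

text \<open>The Kronecker symbol, restricted to a non-negative lower argument, so that no factor for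
  the unit $-1$ occurs.\<close>

definition kronecker :: "int \<Rightarrow> nat \<Rightarrow> int" where
  "kronecker a n =
     (if n = 0 then (if \<bar>a\<bar> = 1 then 1 else 0)
      else (\<Prod>p\<in>prime_factors n. kronecker_prime a p ^ multiplicity p n))"

definition chi :: "int \<Rightarrow> nat \<Rightarrow> complex" where
  "chi t m = of_int (kronecker t m)"

text \<open>Intended for \<open>n \<ge> 1\<close>; the characters are evaluated at positive integers only.\<close>

definition sigma_chars :: "(nat \<Rightarrow> complex) \<Rightarrow> (nat \<Rightarrow> complex) \<Rightarrow> nat \<Rightarrow> complex" where
  "sigma_chars \<phi> \<psi> n = (\<Sum>m | m dvd n. \<phi> m * \<psi> (n div m) * of_nat m)"

text \<open>Only the pairs $(24,1)$, $(1,24)$, $(-8,-3)$ and $(-3,-8)$ are meaningful; the value at any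
  other pair is arbitrary.\<close>

definition eis_const :: "int \<Rightarrow> int \<Rightarrow> complex" where
  "eis_const t1 t2 = (if t1 = 24 \<and> t2 = 1 then -3 else 0)"

definition Eis :: "int \<Rightarrow> int \<Rightarrow> complex \<Rightarrow> complex" where
  "Eis t1 t2 z = eis_const t1 t2 +
     (\<Sum>n. sigma_chars (chi t1) (chi t2) (Suc n) * exp (2 * of_real pi * \<i> * z) ^ Suc n)"

text \<open>Each row consists of the exponents $[r_1, r_2, r_3, r_4, r_6, r_8, r_{12}, r_{24}]$ and the
  coefficients $[b_1, b_2, b_3, b_4]$. The eight eta quotients are known to lie in the Eisenstein
  subspace of $M_2(\Gamma_0(24), \chi_{24})$; the expansion below is stated without assuming
  this.\<close>

definition eis_table :: "(int list \<times> complex list) set" where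
  "eis_table =
    {([ 0, -2, -2,  5,  1, -2,  8, -4], [-1/3, 2/3,  1/3, -2/3]),
     ([-1, -1,  1,  6, -2, -3,  5, -1], [   0, 2/3,  1/3,    0]),
     ([-2,  1,  0,  8, -2, -4,  5, -2], [-1/3,   2,    1, -2/3]),
     ([-2,  5, -4, -2,  8,  0,  1, -2], [-1/3, 4/3, -1/3,  4/3]),
     ([-3,  6, -1, -1,  5, -1, -2,  1], [   0, 4/3, -1/3,    0]),
     ([-4,  8, -2,  1,  5, -2, -2,  0], [-1/3,   4,   -1,  4/3]),
     ([ 1, -2, -1,  5, -1, -1,  6, -3], [-1/3,   0,    0, -2/3]),
     ([-1,  5, -3, -2,  6,  1, -1, -1], [-1/3,   0,    0,  4/3])}"

end

theory Submission
  imports Defs "HOL-Complex_Analysis.Complex_Analysis"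
begin

text \<open>
  Put \<open>q = exp (2 \<pi> \<i> z)\<close> and let
  \<open>wp x p = (\<Sum>n\<in>\<int>. p\<^sup>n x / (1 - p\<^sup>n x)\<^sup>2)\<close>, which is the Weierstrass function of
  the curve \<open>\<complex>\<^sup>* / p\<^sup>\<int>\<close> up to an additive and a multiplicative constant.

  Every one of the four Eisenstein series is a combination of values of \<^term>\<open>wp\<close> at torsion points.
  For \<open>(M, L)\<close> one of \<open>(24, 1)\<close>, \<open>(1, 24)\<close>, \<open>(3, 8)\<close>, \<open>(8, 3)\<close> the point
  \<open>T = exp (2 \<pi> \<i> / L) q\<close> has order 24 on the curve of nome \<open>q\<^sup>M\<close>.  Expanding the double series
  by rows and replacing the character on the weighted divisor by its Gauss sum shows that
  \<open>wp T + wp T\<^sup>5 - wp T\<^sup>7 - wp T\<^sup>1\<^sup>1\<close> is the corresponding Eisenstein series times that Gauss sum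
  (lemma \<open>Eis_as_wp\<close>).

  On the other hand a difference of two values of \<^term>\<open>wp\<close> is a product of theta functions
  (\<open>wp_diff_theta\<close>): the quotient of the two sides is a nome-periodic holomorphic function, hence
  constant.  As the differences of three values add up to zero, the Klein forms \<open>s\<^sub>k\<close> at the points
  \<open>k T\<close> form a symmetric elliptic sequence of period 24, and pure algebra
  (\<open>elliptic_sequence_24_identity\<close>) turns the combination above into a sum of two monomials in
  the \<open>s\<^sub>k\<close>.  The primitive points of each order in the cyclic group generated by \<open>T\<close> enter with
  equal exponents, so both monomials are eta quotients.  Writing \<open>f\<^sub>j\<close> for the eta quotient in row
  \<open>j\<close> of the table, this gives (\<open>Eis_quotients\<close>)
  \<open>E\<^sub>1\<^sub>,\<^sub>2\<^sub>4 = (f\<^sub>2 + f\<^sub>5) / 2\<close>, \<open>E\<^sub>-\<^sub>8\<^sub>,\<^sub>-\<^sub>3 = 2 f\<^sub>2 - f\<^sub>5\<close>,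
  \<open>E\<^sub>2\<^sub>4\<^sub>,\<^sub>1 = - (f\<^sub>8 + 2 f\<^sub>7)\<close>, \<open>E\<^sub>-\<^sub>3\<^sub>,\<^sub>-\<^sub>8 = (f\<^sub>8 - f\<^sub>7) / 2\<close>, and solving for the \<open>f\<^sub>j\<close>
  proves rows 2, 5, 7 and 8.

  The remaining rows follow from \<open>t = f\<^sub>2 / f\<^sub>7 = f\<^sub>5 / f\<^sub>8\<close>: both \<open>1 + t\<close> and \<open>1 + 3 t\<close> are eta
  quotients (\<open>eta_relations\<close>), and \<open>f\<^sub>1 = f\<^sub>7 (1 + t)\<close>, \<open>f\<^sub>3 = f\<^sub>7 (1 + 3 t)\<close>, \<open>f\<^sub>4 = f\<^sub>8 (1 + t)\<close>,
  \<open>f\<^sub>6 = f\<^sub>8 (1 + 3 t)\<close>.  These two relations are again instances of the three-term relation of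
  theta functions, at torsion points that do not lie in one cyclic subgroup.
\<close>

section \<open>The q-Pochhammer symbol\<close>

definition qpoch :: "complex \<Rightarrow> complex \<Rightarrow> complex" where
  "qpoch a p = (\<Prod>n. 1 - a * p ^ n)"

lemma convergent_prod_qpoch:
  fixes a p :: complex
  assumes "norm p < 1"
  shows "convergent_prod (\<lambda>n. 1 - a * p ^ n)"
proof -
  have "summable (\<lambda>n. norm (a * p ^ n))"
    unfolding norm_mult norm_power using assms
    by (intro summable_mult summable_geometric) simp
  hence "abs_convergent_prod (\<lambda>n. 1 - a * p ^ n)"
    unfolding abs_convergent_prod_conv_summable by (simp add: norm_minus_commute)
  thus ?thesis by (rule abs_convergent_prod_imp_convergent_prod)
qed

lemma qpoch_LIMSEQ:
  assumes "norm p < 1"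
  shows "(\<lambda>N. \<Prod>n<N. 1 - a * p ^ n) \<longlonglongrightarrow> qpoch a p"
  using convergent_prod_LIMSEQ[OF convergent_prod_qpoch[OF assms, of a]]
  unfolding qpoch_def LIMSEQ_lessThan_iff_atMost .

lemma qpoch_unfold:
  assumes "norm p < 1"
  shows "qpoch a p = (1 - a) * qpoch (a * p) p"
proof (rule LIMSEQ_unique)
  show "(\<lambda>N. \<Prod>n<Suc N. 1 - a * p ^ n) \<longlonglongrightarrow> qpoch a p"
    using qpoch_LIMSEQ[OF assms] by (rule LIMSEQ_Suc)
  have "(\<lambda>N. (1 - a) * (\<Prod>n<N. 1 - (a * p) * p ^ n)) \<longlonglongrightarrow> (1 - a) * qpoch (a * p) p"
    by (intro tendsto_mult tendsto_const qpoch_LIMSEQ assms)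
  thus "(\<lambda>N. \<Prod>n<Suc N. 1 - a * p ^ n) \<longlonglongrightarrow> (1 - a) * qpoch (a * p) p"
    by (simp only: prod.lessThan_Suc_shift) (simp add: mult_ac)
qed

text \<open>A convergent infinite product vanishes only if one of its factors does.\<close>

lemma qpoch_eq_0_iff:
  assumes "norm p < 1"
  shows "qpoch a p = 0 \<longleftrightarrow> (\<exists>n. a * p ^ n = 1)"
proof -
  have "(\<lambda>n. 1 - a * p ^ n) has_prod qpoch a p"
    using convergent_prod_qpoch[OF assms] unfolding qpoch_def by blast
  from has_prod_eq_0_iff[OF this] show ?thesis by auto
qed

lemma qpoch_nome_nonzero:
  assumes "norm p < 1"
  shows "qpoch p p \<noteq> 0"
proof
  assume "qpoch p p = 0"
  then obtain n where "p * p ^ n = 1" using qpoch_eq_0_iff[OF assms] by blast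
  hence "norm p * norm p ^ n = 1" by (metis norm_mult norm_one norm_power)
  moreover have "norm p * norm p ^ n \<le> norm p"
    using assms by (intro mult_left_le) (auto simp: power_le_one)
  ultimately show False using assms by simp
qed

text \<open>Sorting the factors by the residue of their index modulo \<open>k\<close>.\<close>

lemma qpoch_dissect:
  assumes "norm p < 1" "k > 0"
  shows "(\<Prod>j<k. qpoch (a * p ^ j) (p ^ k)) = qpoch a p"
proof (rule LIMSEQ_unique)
  have pk: "norm (p ^ k) < 1" using assms by (simp add: norm_power power_less_one_iff)
  show "(\<lambda>N. \<Prod>j<k. \<Prod>n<N. 1 - a * p ^ j * (p ^ k) ^ n) \<longlonglongrightarrow> (\<Prod>j<k. qpoch (a * p ^ j) (p ^ k))"
    by (intro tendsto_prod qpoch_LIMSEQ pk)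
  have "(\<Prod>j<k. \<Prod>n<N. 1 - a * p ^ j * (p ^ k) ^ n) = (\<Prod>n<N * k. 1 - a * p ^ n)" for N
  proof -
    have "(\<Prod>n<N * k. 1 - a * p ^ n) = (\<Prod>n<N. \<Prod>i\<in>{n * k..<n * k + k}. 1 - a * p ^ i)"
      by (rule prod.nat_group[symmetric])
    also have "\<dots> = (\<Prod>n<N. \<Prod>j<k. 1 - a * p ^ j * (p ^ k) ^ n)"
    proof (rule prod.cong[OF refl])
      fix n
      have "(\<Prod>i\<in>{n * k..<n * k + k}. 1 - a * p ^ i) = (\<Prod>j\<in>{0..<k}. 1 - a * p ^ (j + n * k))"
        using prod.shift_bounds_nat_ivl[of "\<lambda>i. 1 - a * p ^ i" 0 "n * k" k] by (simp add: add.commute)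
      thus "(\<Prod>i\<in>{n * k..<n * k + k}. 1 - a * p ^ i) = (\<Prod>j<k. 1 - a * p ^ j * (p ^ k) ^ n)"
        by (simp add: power_add power_mult[symmetric] mult_ac lessThan_atLeast0)
    qed
    finally show ?thesis by (simp add: prod.swap[of _ "{..<N}"])
  qed
  moreover have "filterlim (\<lambda>N. N * k) sequentially sequentially"
    using assms(2) by (intro filterlim_subseq) (auto simp: strict_mono_def)
  ultimately show "(\<lambda>N. \<Prod>j<k. \<Prod>n<N. 1 - a * p ^ j * (p ^ k) ^ n) \<longlonglongrightarrow> qpoch a p"
    using filterlim_compose[OF qpoch_LIMSEQ[OF assms(1), of a]] by simp
qed

text \<open>Both sides are polynomials of degree at most \<open>n\<close> in \<open>x\<close> that agree at 0 and at the \<open>n\<close> roots of unity.\<close>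

lemma prod_one_minus_root_unity:
  fixes x :: complex
  assumes "n > 0"
  shows "(\<Prod>j<n. 1 - cis (2 * pi * real j / real n) * x) = 1 - x ^ n"
proof -
  define w where "w = (\<lambda>j. cis (2 * pi * real j / real n))"
  define P where "P = (\<Prod>j<n. [:1, - w j:])"
  define Q where "Q = 1 - Polynomial.monom (1 :: complex) n"
  have bij: "bij_betw w {..<n} {z. z ^ n = 1}"
    unfolding w_def by (rule Complex.bij_betw_roots_unity[OF assms])
  have fin: "finite {z :: complex. z ^ n = 1}"
    using bij by (metis bij_betw_finite finite_lessThan)
  have "P = Q"
  proof (rule poly_eqI_degree)
    fix z assume z: "z \<in> insert 0 {z :: complex. z ^ n = 1}"
    show "poly P z = poly Q z"
    proof (cases "z = 0")
      case True
      thus ?thesis using assms by (simp add: P_def Q_def poly_prod Polynomial.poly_monom)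
    next
      case False
      with z have z1: "z ^ n = 1" by simp
      hence "inverse z \<in> w ` {..<n}"
        using bij by (simp add: bij_betw_def power_inverse)
      then obtain j where "j < n" "w j = inverse z" by auto
      hence "(\<Prod>j<n. 1 - w j * z) = 0"
        using False by (intro prod_zero) (auto intro!: bexI[of _ j])
      thus ?thesis using z1 by (simp add: P_def Q_def poly_prod Polynomial.poly_monom algebra_simps)
    qed
  next
    have c: "card (insert 0 {z :: complex. z ^ n = 1}) = Suc n"
      using assms fin bij_betw_same_card[OF bij] by (simp add: power_0_left)
    have "degree P \<le> (\<Sum>j<n. degree [:1, - w j:])"
      unfolding P_def using degree_prod_sum_le[of "{..<n}" "\<lambda>j. [:1, - w j:]"] by (simp add: o_def)
    also have "\<dots> \<le> (\<Sum>j<n. 1)" by (intro sum_mono) simp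
    finally show "degree P < card (insert 0 {z :: complex. z ^ n = 1})" using c by simp
    have "degree Q \<le> n" unfolding Q_def by (intro degree_diff_le) (simp_all add: degree_monom_le)
    thus "degree Q < card (insert 0 {z :: complex. z ^ n = 1})" using c by simp
  qed
  hence "poly P x = poly Q x" by simp
  thus ?thesis by (simp add: P_def Q_def w_def poly_prod Polynomial.poly_monom algebra_simps)
qed

lemma qpoch_root_unity:
  assumes "norm p < 1" "n > 0"
  shows "(\<Prod>j<n. qpoch (cis (2 * pi * real j / real n) * a) p) = qpoch (a ^ n) (p ^ n)"
proof (rule LIMSEQ_unique)
  have pk: "norm (p ^ n) < 1" using assms by (simp add: norm_power power_less_one_iff)
  show "(\<lambda>N. \<Prod>j<n. \<Prod>k<N. 1 - cis (2 * pi * real j / real n) * a * p ^ k) \<longlonglongrightarrow>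
         (\<Prod>j<n. qpoch (cis (2 * pi * real j / real n) * a) p)"
    by (intro tendsto_prod qpoch_LIMSEQ assms)
  have "(\<Prod>j<n. \<Prod>k<N. 1 - cis (2 * pi * real j / real n) * a * p ^ k) = 
        (\<Prod>k<N. 1 - a ^ n * (p ^ n) ^ k)" for N
  proof -
    have "(\<Prod>j<n. \<Prod>k<N. 1 - cis (2 * pi * real j / real n) * a * p ^ k) =
          (\<Prod>k<N. \<Prod>j<n. 1 - cis (2 * pi * real j / real n) * (a * p ^ k))"
      by (subst prod.swap) (simp add: mult_ac)
    also have "\<dots> = (\<Prod>k<N. 1 - a ^ n * (p ^ n) ^ k)"
      by (subst prod_one_minus_root_unity[OF assms(2)])
         (simp add: power_mult_distrib power_mult[symmetric] mult.commute)
    finally show ?thesis .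
  qed
  thus "(\<lambda>N. \<Prod>j<n. \<Prod>k<N. 1 - cis (2 * pi * real j / real n) * a * p ^ k) \<longlonglongrightarrow> qpoch (a ^ n) (p ^ n)"
    using qpoch_LIMSEQ[OF pk, of "a ^ n"] by simp
qed

lemma holomorphic_qpoch:
  assumes "norm p < 1"
  shows "(\<lambda>a. qpoch a p) holomorphic_on UNIV"
proof (rule holomorphic_uniform_sequence[of _ "\<lambda>N a. \<Prod>n<N. 1 - a * p ^ n"])
  fix x :: complex
  have "uniformly_convergent_on (cball x 1) (\<lambda>N a. \<Prod>n<N. 1 - a * p ^ n)"
  proof (rule uniformly_convergent_on_prod')
    show "uniformly_convergent_on (cball x 1) (\<lambda>N a. \<Sum>n<N. norm (1 - a * p ^ n - 1))"
    proof (rule Weierstrass_m_test')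
      fix n a assume a: "a \<in> cball x (1::real)"
      have "norm a \<le> norm x + 1"
        using a norm_triangle_sub[of a x] by (simp add: dist_norm norm_minus_commute)
      thus "norm (norm (1 - a * p ^ n - 1)) \<le> (norm x + 1) * norm p ^ n"
        by (simp add: norm_mult norm_power mult_right_mono)
    next
      show "summable (\<lambda>n. (norm x + 1) * norm p ^ n)"
        using assms by (simp add: summable_mult summable_geometric)
    qed
  qed (auto intro!: continuous_intros)
  then obtain g where g: "uniform_limit (cball x 1) (\<lambda>N a. \<Prod>n<N. 1 - a * p ^ n) g sequentially"
    by (auto simp: uniformly_convergent_on_def)
  have "g a = qpoch a p" if "a \<in> cball x 1" for a
    using tendsto_uniform_limitI[OF g that] qpoch_LIMSEQ[OF assms, of a] by (rule LIMSEQ_unique)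
  hence "uniform_limit (cball x 1) (\<lambda>N a. \<Prod>n<N. 1 - a * p ^ n) (\<lambda>a. qpoch a p) sequentially"
    using g by (subst uniform_limit_cong') (auto)
  thus "\<exists>d>0. cball x d \<subseteq> UNIV \<and>
         uniform_limit (cball x d) (\<lambda>N a. \<Prod>n<N. 1 - a * p ^ n) (\<lambda>a. qpoch a p) sequentially"
    by (intro exI[of _ 1]) auto
qed (auto intro!: holomorphic_intros)

definition epoch :: "complex \<Rightarrow> nat \<Rightarrow> complex" where
  "epoch q d = qpoch (q ^ d) (q ^ d)"

lemma epoch_nonzero: "norm q < 1 \<Longrightarrow> d > 0 \<Longrightarrow> epoch q d \<noteq> 0"
  unfolding epoch_def by (intro qpoch_nome_nonzero) (simp add: norm_power power_less_one_iff)

section \<open>Theta functions and the Weierstrass function\<close>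

definition theta :: "complex \<Rightarrow> complex \<Rightarrow> complex" where
  "theta x p = qpoch x p * qpoch (p / x) p"

text \<open>The sum \<open>\<Sum>m\<ge>1. m y\<^sup>m\<close>, \<open>norm y < 1\<close>, in closed form, the building block of all weight 2 Lambert series below.\<close>

definition koebe :: "complex \<Rightarrow> complex" where
  "koebe y = y / (1 - y) ^ 2"

text \<open>The bilateral sum of \<open>koebe (p\<^sup>n x)\<close>; the terms with negative \<open>n\<close> are rewritten by the symmetry
  \<open>koebe (1 / y) = koebe y\<close>, so that both series converge for \<open>norm p < 1\<close>.\<close>

definition wp :: "complex \<Rightarrow> complex \<Rightarrow> complex" where
  "wp x p = (\<Sum>n. koebe (x * p ^ n)) + (\<Sum>n. koebe (p ^ Suc n / x))"

lemma koebe_inverse: "koebe (1 / y) = koebe y"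
proof (cases "y = 0 \<or> y = 1")
  case False
  hence "(1 - 1 / y) ^ 2 = (1 - y) ^ 2 / y ^ 2" by (simp add: field_simps power2_eq_square)
  thus ?thesis using False by (simp add: koebe_def power2_eq_square field_simps)
qed (auto simp: koebe_def)

lemma theta_inverse:
  assumes "norm p < 1" "x \<noteq> 0"
  shows "theta (1 / x) p = - theta x p / x"
proof -
  have "theta x p = (1 - x) * qpoch (x * p) p * qpoch (p / x) p"
    unfolding theta_def qpoch_unfold[OF assms(1), of x] ..
  moreover have "theta (1 / x) p = (1 - 1 / x) * qpoch (p / x) p * qpoch (x * p) p"
    unfolding theta_def qpoch_unfold[OF assms(1), of "1 / x"] using assms by (simp add: mult_ac)
  moreover have "1 - 1 / x = - ((1 - x) / x)" using assms(2) by (simp add: field_simps)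
  ultimately show ?thesis by simp
qed

lemma theta_mult_nome:
  assumes "norm p < 1" "x \<noteq> 0" "p \<noteq> 0"
  shows "theta (p * x) p = - theta x p / x"
  using theta_inverse[OF assms(1,2)] assms(2,3) by (simp add: theta_def mult_ac)

lemma theta_one: "norm p < 1 \<Longrightarrow> theta 1 p = 0"
  by (simp add: theta_def qpoch_unfold[of p 1])

lemma theta_reflect: "p \<noteq> 0 \<Longrightarrow> theta (p / x) p = theta x p"
  by (simp add: theta_def mult.commute)

lemma summable_koebe_powers:
  assumes "norm p < 1"
  shows "summable (\<lambda>n. koebe (a * p ^ n))"
proof (rule summable_comparison_test_ev)
  have "(\<lambda>n. a * p ^ n) \<longlonglongrightarrow> a * 0"
    by (intro tendsto_mult tendsto_const LIMSEQ_power_zero assms)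
  hence "eventually (\<lambda>n. norm (a * p ^ n) < 1 / 2) sequentially"
    by (auto simp: tendsto_iff dist_norm dest!: spec[of _ "1 / 2"])
  thus "eventually (\<lambda>n. norm (koebe (a * p ^ n)) \<le> 4 * norm a * norm p ^ n) sequentially"
  proof eventually_elim
    case (elim n)
    have "1 / 2 \<le> norm (1 - a * p ^ n)"
      using norm_triangle_ineq2[of 1 "a * p ^ n"] elim by simp
    hence "(1 / 2) ^ 2 \<le> norm (1 - a * p ^ n) ^ 2" by (intro power_mono) auto
    hence "norm (a * p ^ n) / norm (1 - a * p ^ n) ^ 2 \<le> norm (a * p ^ n) / (1 / 2) ^ 2"
      by (intro divide_left_mono mult_pos_pos) (auto intro: less_le_trans[rotated])
    thus ?case by (simp add: koebe_def norm_divide norm_power norm_mult power2_eq_square mult_ac)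
  qed
next
  show "summable (\<lambda>n. 4 * norm a * norm p ^ n)"
    using assms by (intro summable_mult summable_geometric) simp
qed

lemma summable_koebe_powers_Suc:
  assumes "norm p < 1"
  shows "summable (\<lambda>n. koebe (a * p ^ Suc n))" "summable (\<lambda>n. koebe (p ^ Suc n / a))"
  using summable_koebe_powers[OF assms, of "a * p"] summable_koebe_powers[OF assms, of "p / a"]
  by (simp_all add: mult_ac)

text \<open>The part of \<^term>\<open>wp\<close> that is regular at \<open>1\<close>.\<close>

definition wp_reg :: "complex \<Rightarrow> complex \<Rightarrow> complex" where
  "wp_reg x p = (\<Sum>n. koebe (x * p ^ Suc n)) + (\<Sum>n. koebe (p ^ Suc n / x))"

lemma wp_eq_koebe_plus_reg:
  assumes "norm p < 1"
  shows "wp x p = koebe x + wp_reg x p"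
  using suminf_split_head[OF summable_koebe_powers[OF assms, of x]]
  by (simp add: wp_def wp_reg_def)

lemma wp_reg_inverse: "wp_reg (1 / x) p = wp_reg x p"
proof -
  have "koebe (p ^ Suc n / (1 / x)) = koebe (x * p ^ Suc n)" for n by (simp add: mult_ac)
  moreover have "koebe (1 / x * p ^ Suc n) = koebe (p ^ Suc n / x)" for n by simp
  ultimately show ?thesis unfolding wp_reg_def by (simp only: add.commute)
qed

lemma wp_mult_nome:
  assumes "norm p < 1" "p \<noteq> 0" "x \<noteq> 0"
  shows "wp (p * x) p = wp x p"
proof -
  have eq: "koebe (p * x * p ^ n) = koebe (x * p ^ Suc n)" 
    "koebe (p ^ Suc n / (p * x)) = koebe ((1 / x) * p ^ n)" for n
    using assms by (simp_all add: mult_ac)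
  have "(\<Sum>n. koebe ((1 / x) * p ^ n)) = koebe (1 / x) + (\<Sum>n. koebe ((1 / x) * p ^ Suc n))"
    using suminf_split_head[OF summable_koebe_powers[OF assms(1), of "1 / x"]] by simp
  thus ?thesis
    unfolding wp_eq_koebe_plus_reg[OF assms(1), of x] unfolding wp_def eq wp_reg_def koebe_inverse
    by (simp add: mult_ac)
qed

text \<open>On a smaller disc of radius \<open>\<rho>\<close> the series is dominated by a geometric one, because
  \<open>norm (x p\<^sup>n\<^sup>+\<^sup>1) \<le> \<rho> norm p < 1\<close> keeps the denominators away from zero.\<close>

lemma holomorphic_koebe_sum:
  assumes "norm p < 1" "p \<noteq> 0"
  shows "(\<lambda>x. \<Sum>n. koebe (x * p ^ Suc n)) holomorphic_on ball 0 (1 / norm p)"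
proof (rule holomorphic_uniform_sequence[of _ "\<lambda>N x. \<Sum>n<N. koebe (x * p ^ Suc n)"])
  have small: "norm (x * p ^ Suc n) \<le> norm x * norm p * norm p ^ n" for x :: complex and n
    by (simp add: norm_mult norm_power)
  fix N
  show "(\<lambda>x. \<Sum>n<N. koebe (x * p ^ Suc n)) holomorphic_on ball 0 (1 / norm p)"
    unfolding koebe_def
  proof (intro holomorphic_intros)
    fix x :: complex and n assume "x \<in> ball 0 (1 / norm p)"
    hence "norm x * norm p < 1" using assms by (simp add: field_simps)
    moreover have "norm p ^ n \<le> 1" using assms by (simp add: power_le_one)
    ultimately have "norm x * norm p * norm p ^ n < 1"
      by (metis le_less_trans mult.right_neutral mult_left_le mult_nonneg_nonneg norm_ge_zero)
    hence "norm (x * p ^ Suc n) < 1" using small[of x n] by linarith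
    thus "(1 - x * p ^ Suc n)\<^sup>2 \<noteq> 0" by auto
  qed
next
  fix x :: complex assume x: "x \<in> ball 0 (1 / norm p)"
  define \<rho> where "\<rho> = (norm x + 1 / norm p) / 2"
  have x': "norm x < 1 / norm p" using x by simp
  have \<rho>: "norm x < \<rho>" "\<rho> < 1 / norm p" unfolding \<rho>_def using x' by (simp_all add: field_simps)
  have \<rho>0: "\<rho> > 0" using \<rho>(1) norm_ge_zero[of x] by linarith
  define c where "c = \<rho> * norm p"
  have c: "c < 1" "c \<ge> 0" unfolding c_def using \<rho> \<rho>0 assms by (simp_all add: field_simps)
  have sub: "norm a \<le> \<rho>" if "a \<in> cball x (\<rho> - norm x)" for a
    using that norm_triangle_sub[of a x] by (simp add: dist_norm norm_minus_commute)
  have "uniform_limit (cball x (\<rho> - norm x)) (\<lambda>N x. \<Sum>n<N. koebe (x * p ^ Suc n)) 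
          (\<lambda>x. \<Sum>n. koebe (x * p ^ Suc n)) sequentially"
  proof (rule Weierstrass_m_test)
    fix n a assume a: "a \<in> cball x (\<rho> - norm x)"
    have "norm (a * p ^ Suc n) = norm a * norm p * norm p ^ n"
      by (simp add: norm_mult norm_power)
    also have "\<dots> \<le> c * norm p ^ n"
      unfolding c_def using sub[OF a] by (intro mult_right_mono) auto
    finally have le: "norm (a * p ^ Suc n) \<le> c * norm p ^ n" .
    moreover have "c * norm p ^ n \<le> c" using c(2) assms by (simp add: mult_left_le power_le_one)
    ultimately have "1 - c \<le> norm (1 - a * p ^ Suc n)"
      using norm_triangle_ineq2[of 1 "a * p ^ Suc n"] by simp
    hence "(1 - c) ^ 2 \<le> norm (1 - a * p ^ Suc n) ^ 2" using c by (intro power_mono) auto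
    hence "norm (a * p ^ Suc n) / norm (1 - a * p ^ Suc n) ^ 2 \<le> c * norm p ^ n / (1 - c) ^ 2"
      using le c by (intro frac_le) auto
    thus "norm (koebe (a * p ^ Suc n)) \<le> c / (1 - c) ^ 2 * norm p ^ n"
      by (simp add: koebe_def norm_divide norm_power)
  next
    show "summable (\<lambda>n. c / (1 - c) ^ 2 * norm p ^ n)"
      using assms by (intro summable_mult summable_geometric) simp
  qed
  moreover have "cball x (\<rho> - norm x) \<subseteq> ball 0 (1 / norm p)"
    using sub \<rho>(2) by (force simp del: mem_cball)
  ultimately show "\<exists>d>0. cball x d \<subseteq> ball 0 (1 / norm p) \<and>
      uniform_limit (cball x d) (\<lambda>N x. \<Sum>n<N. koebe (x * p ^ Suc n)) 
          (\<lambda>x. \<Sum>n. koebe (x * p ^ Suc n)) sequentially"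
    using \<rho>(1) by (intro exI[of _ "\<rho> - norm x"]) auto
qed auto

text \<open>The annulus \<open>norm p < norm x \<le> 1\<close> is a fundamental domain of multiplication by \<open>p\<close>.\<close>

lemma nome_orbit_representative:
  fixes f :: "complex \<Rightarrow> 'a"
  assumes "norm p < 1" "p \<noteq> 0" "x \<noteq> 0" and inv: "\<And>u. u \<noteq> 0 \<Longrightarrow> f (p * u) = f u"
  obtains x' where "norm p < norm x'" "norm x' \<le> 1" "f x' = f x"
proof -
  define t where "t = log (norm p) (norm x)"
  have nx: "norm x = norm p powr t"
    unfolding t_def using assms by (subst powr_log_cancel) auto
  have pow: "f (p powi n * x) = f x" for n :: int
  proof (induction n rule: int_induct[where k = 0])
    case (step1 i)
    have "p powi (i + 1) * x = p * (p powi i * x)" using assms by (simp add: power_int_add)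
    thus ?case using step1 inv[of "p powi i * x"] assms by (simp add: mult.assoc)
  next
    case (step2 i)
    have nz: "p powi (i - 1) * x \<noteq> 0" using assms by simp
    have "p * (p powi (i - 1) * x) = p powi i * x" using assms by (simp add: power_int_diff)
    thus ?case using step2 inv[OF nz] by metis
  qed auto
  define x' where "x' = p powi (- floor t) * x"
  have "norm x' = norm p powr (t - floor t)"
    unfolding x'_def norm_mult norm_power_int nx using assms
    by (simp add: powr_diff powr_real_of_int' power_int_minus field_simps)
  moreover have "norm p powr 1 < norm p powr (t - floor t)"
    using assms by (intro powr_less_mono') (simp_all, linarith)
  moreover have "norm p powr (t - floor t) \<le> norm p powr 0"
    using assms by (intro powr_mono') simp_all
  ultimately show ?thesis using pow[of "- floor t"] assms that[of x'] by (simp add: x'_def)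
qed

section \<open>The product formula for differences of Weierstrass values\<close>

text \<open>The symmetry is that of \<open>(1 - x)\<^sup>2\<close>.  At a zero at the fixed point \<open>1\<close>, differentiating it
  gives \<open>N' 1 = - N' 1\<close>, so the zero is at least double.\<close>

lemma holomorphic_double_zero:
  assumes N: "N holomorphic_on S" and S: "open S" "1 \<in> S"
    and inv: "\<And>x. x \<in> S \<Longrightarrow> 1 / x \<in> S" "0 \<notin> S"
    and sym: "\<And>x. x \<in> S \<Longrightarrow> N (1 / x) = N x / x ^ 2" and N1: "N 1 = 0"
  obtains M :: "complex \<Rightarrow> complex" 
    where "M holomorphic_on S" "\<And>x. x \<in> S \<Longrightarrow> N x = (1 - x) ^ 2 * M x"
proof -
  define L where "L = (\<lambda>z. if z = 1 then deriv N 1 else (N z - N 1) / (z - 1))"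
  have L: "L holomorphic_on S" unfolding L_def by (rule pole_lemma_open[OF N S(1)])
  define M where "M = (\<lambda>z. if z = 1 then deriv L 1 else (L z - L 1) / (z - 1))"
  have M: "M holomorphic_on S" unfolding M_def by (rule pole_lemma_open[OF L S(1)])
  have dN: "(N has_field_derivative deriv N 1) (at 1)"
    using N S by (rule holomorphic_derivI)
  have "((\<lambda>x. x ^ 2 * N (1 / x)) has_field_derivative - deriv N 1) (at 1)"
    using N1 dN by (auto intro!: derivative_eq_intros DERIV_chain2[of N])
  moreover have "((\<lambda>x. x ^ 2 * N (1 / x)) has_field_derivative deriv N 1) (at 1)"
  proof (rule has_field_derivative_transform_within_open[OF dN S])
    fix x assume "x \<in> S"
    thus "N x = x ^ 2 * N (1 / x)" using sym[of x] inv(2) by (cases "x = 0") auto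
  qed
  ultimately have "deriv N 1 = - deriv N 1" by (rule DERIV_unique[rotated])
  hence L1: "L 1 = 0" by (simp add: L_def eq_neg_iff_add_eq_0 flip: mult_2)
  have "N x = (1 - x) ^ 2 * M x" for x
  proof (cases "x = 1")
    case False
    hence "(1 - x) ^ 2 * M x = (1 - x) ^ 2 * (L x / (x - 1))" using L1 by (simp add: M_def)
    also have "\<dots> = N x"
    proof -
      have "(1 - x) ^ 2 = (x - 1) * (x - 1)" by (simp add: power2_eq_square algebra_simps)
      thus ?thesis using False N1 by (simp add: L_def)
    qed
    finally show ?thesis ..
  qed (simp add: N1)
  thus ?thesis using that M by blast
qed

text \<open>Let \<open>K x\<close> be the difference of the two sides.  It is invariant under \<open>x \<mapsto> p x\<close> and under
  \<open>x \<mapsto> 1 / x\<close>, and its only possible singularities are double poles at the powers of \<open>p\<close>.  The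
  leading coefficients at \<open>1\<close> cancel, and evenness removes the simple pole that could remain.  Hence
  \<open>K\<close> is holomorphic on an annulus containing a compact fundamental domain in its interior, attains
  its maximum modulus there and is constant; its value at \<open>x = y\<close> is zero.\<close>

lemma wp_diff_theta:
  assumes p: "norm p < 1" "p \<noteq> 0" and x: "x \<noteq> 0" "theta x p \<noteq> 0" and y: "y \<noteq> 0" "theta y p \<noteq> 0"
  shows "wp x p - wp y p = - y * qpoch p p ^ 4 * theta (x * y) p * theta (x / y) p
           / (theta x p ^ 2 * theta y p ^ 2)"
proof -
  define W where "W = wp y p"
  define C where "C = y * qpoch p p ^ 4 / theta y p ^ 2"
  define K where "K = (\<lambda>x. wp x p - W + C * theta (x * y) p * theta (x / y) p / theta x p ^ 2)"
  \<comment> \<open>the cofactors of the zero of theta and of the pole of \<open>K\<close> at 1\<close>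
  define t1 where "t1 = (\<lambda>x. qpoch (x * p) p * qpoch (p / x) p)"
  define A where "A = {x :: complex. norm p < norm (x - 0) \<and> norm (x - 0) < 1 / norm p}"
  define N where "N = (\<lambda>x. x * t1 x ^ 2 + (wp_reg x p - W) * (1 - x) ^ 2 * t1 x ^ 2
                         + C * theta (x * y) p * theta (x / y) p)"
  have "open A" unfolding A_def by (intro open_Collect_conj open_Collect_less continuous_intros)
  have "connected A" unfolding A_def using connected_annulus(1)[of "norm p" "0 :: complex" "1 / norm p"] by (simp add: norm_minus_commute)
  have inA: "x \<in> A \<longleftrightarrow> norm p < norm x \<and> norm x < 1 / norm p" for x by (simp add: A_def)
  have oneA: "1 \<in> A" using p by (simp add: inA)
  have zeroA: "0 \<notin> A" by (simp add: inA)
  have invA: "1 / x \<in> A" if "x \<in> A" for x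
  proof -
    have "norm x > 0" using that p zeroA by auto
    thus ?thesis using that p by (auto simp: inA norm_divide field_simps)
  qed
  have theta_t1: "theta x p = (1 - x) * t1 x" for x
    unfolding theta_def t1_def qpoch_unfold[OF p(1), of x] by simp
  have t1_nz: "t1 x \<noteq> 0" if "x \<in> A" for x
  proof -
    have *: "qpoch (a * p) p \<noteq> 0" if "norm a * norm p < 1" for a
    proof
      assume "qpoch (a * p) p = 0"
      then obtain n where "a * p * p ^ n = 1" using qpoch_eq_0_iff[OF p(1)] by blast
      hence "norm a * norm p * norm p ^ n = 1" by (metis norm_mult norm_one norm_power)
      moreover have "norm a * norm p * norm p ^ n \<le> norm a * norm p"
        using p by (intro mult_left_le) (auto simp: power_le_one)
      ultimately show False using that by linarith
    qed
    have "norm x * norm p < 1" "norm (1 / x) * norm p < 1"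
      using that invA[OF that] p by (auto simp: inA norm_divide field_simps)
    from *[OF this(1)] *[OF this(2)] show ?thesis by (simp add: t1_def)
  qed
  have q_hol: "(\<lambda>x. qpoch (f x) p) holomorphic_on A" if "f holomorphic_on A" for f
    using holomorphic_on_compose[OF that holomorphic_on_subset[OF holomorphic_qpoch[OF p(1)]]]
    by (auto simp: o_def)
  have nz: "x \<noteq> 0" if "x \<in> A" for x using that zeroA by auto
  have reg_hol: "(\<lambda>x. wp_reg x p) holomorphic_on A"
  proof -
    let ?h = "\<lambda>x. \<Sum>n. koebe (x * p ^ Suc n)"
    have h: "?h holomorphic_on A"
      by (rule holomorphic_on_subset[OF holomorphic_koebe_sum[OF p]]) (auto simp: inA)
    moreover have "(?h \<circ> (\<lambda>x. 1 / x)) holomorphic_on A"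
    proof (rule holomorphic_on_compose)
      show "(\<lambda>x. 1 / x) holomorphic_on A" using nz by (intro holomorphic_intros) auto
      show "?h holomorphic_on (\<lambda>x. 1 / x) ` A"
        by (rule holomorphic_on_subset[OF h]) (use invA in auto)
    qed
    ultimately have "(\<lambda>x. ?h x + (?h \<circ> (\<lambda>x. 1 / x)) x) holomorphic_on A"
      by (rule holomorphic_on_add)
    moreover have "wp_reg x p = ?h x + (?h \<circ> (\<lambda>x. 1 / x)) x" for x
      by (simp add: wp_reg_def)
    ultimately show ?thesis by simp
  qed
  have t1_hol: "t1 holomorphic_on A"
    unfolding t1_def using nz by (intro holomorphic_intros q_hol) auto
  have N_hol: "N holomorphic_on A"
    unfolding N_def theta_def using nz y by (intro holomorphic_intros q_hol reg_hol t1_hol) auto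
  have t1_inv: "t1 (1 / x) = t1 x" for x by (simp add: t1_def mult_ac)
  have sym_theta: "theta (1 / x * y) p * theta (1 / x / y) p = theta (x * y) p * theta (x / y) p / x ^ 2"
    if "x \<noteq> 0" for x
    using theta_inverse[OF p(1), of "x * y"] theta_inverse[OF p(1), of "x / y"] that y
    by (simp add: power2_eq_square)
  have N_sym: "N (1 / x) = N x / x ^ 2" if "x \<in> A" for x
  proof -
    have "x \<noteq> 0" using nz that .
    have 1: "(1 - 1 / x) ^ 2 = (1 - x) ^ 2 / x ^ 2"
      using \<open>x \<noteq> 0\<close> by (simp add: field_simps power2_eq_square)
    have "N (1 / x) = 1 / x * t1 x ^ 2 + (wp_reg x p - W) * (1 - 1 / x) ^ 2 * t1 x ^ 2
                         + C * (theta (1 / x * y) p * theta (1 / x / y) p)"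
      unfolding N_def wp_reg_inverse t1_inv by (simp only: mult.assoc)
    also have "\<dots> = N x / x ^ 2"
      unfolding 1 sym_theta[OF \<open>x \<noteq> 0\<close>] N_def using \<open>x \<noteq> 0\<close>
      by (simp add: field_simps power2_eq_square)
    finally show ?thesis .
  qed
  have N1: "N 1 = 0"
    using theta_inverse[OF p(1), of y] y by (simp add: N_def C_def t1_def power2_eq_square power4_eq_xxxx)
  obtain M where M: "M holomorphic_on A" "\<And>x. x \<in> A \<Longrightarrow> N x = (1 - x) ^ 2 * M x"
    using holomorphic_double_zero[OF N_hol \<open>open A\<close> oneA invA zeroA N_sym N1] by blast
  define k where "k = (\<lambda>x. M x / t1 x ^ 2)"
  have k_hol: "k holomorphic_on A" unfolding k_def using t1_nz by (intro holomorphic_intros M t1_hol) auto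
  have kK: "k x = K x" if "x \<in> A" "x \<noteq> 1" for x
  proof -
    have "1 - x \<noteq> 0" using that by simp
    have "K x = N x / ((1 - x) ^ 2 * t1 x ^ 2)"
    proof -
      have "x / a ^ 2 + R - W + E / (a * t) ^ 2 = (x * t ^ 2 + (R - W) * a ^ 2 * t ^ 2 + E) / (a ^ 2 * t ^ 2)"
        if "a \<noteq> 0" "t \<noteq> 0" for a t R E :: complex
        using that by (simp add: field_simps power_mult_distrib)
      from this[OF \<open>1 - x \<noteq> 0\<close> t1_nz[OF that(1)]] show ?thesis
        unfolding K_def N_def theta_t1[of x] wp_eq_koebe_plus_reg[OF p(1), of x] koebe_def .
    qed
    thus ?thesis using \<open>1 - x \<noteq> 0\<close> by (simp add: M(2)[OF that(1)] k_def)
  qed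
  have K_p: "K (p * u) = K u" if "u \<noteq> 0" for u
  proof -
    have t: "theta (p * u * y) p * theta (p * u / y) p = theta (u * y) p * theta (u / y) p / u ^ 2"
      using theta_mult_nome[OF p(1) _ p(2), of "u * y"] theta_mult_nome[OF p(1) _ p(2), of "u / y"]
        that y by (simp add: power2_eq_square mult_ac)
    have "K (p * u) = wp u p - W + C * (theta (p * u * y) p * theta (p * u / y) p) / (- theta u p / u) ^ 2"
      unfolding K_def wp_mult_nome[OF p that] theta_mult_nome[OF p(1) that p(2)] by (simp only: mult.assoc)
    thus ?thesis unfolding t using that by (simp add: K_def power2_eq_square)
  qed
  \<comment> \<open>a closed fundamental annulus in the interior of \<open>A\<close>\<close>
  define r where "r = sqrt (norm p)"
  have r: "0 < r" "r < 1" "norm p < r" "r * r = norm p"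
  proof -
    show "0 < r" "r < 1" "r * r = norm p" using p by (auto simp: r_def)
    thus "norm p < r" by (metis mult.right_neutral mult_strict_left_mono)
  qed
  have r': "1 / r < 1 / norm p" using r p by (simp add: field_simps)
  define B where "B = cball 0 (1 / r) - ball (0 :: complex) r"
  have inB: "x \<in> B \<longleftrightarrow> r \<le> norm x \<and> norm x \<le> 1 / r" for x by (auto simp: B_def)
  have "compact B" unfolding B_def by (intro compact_diff) auto
  moreover have BA: "B \<subseteq> A" using r r' by (auto simp: inA inB)
  moreover have "1 \<in> B" using r by (simp add: inB)
  ultimately obtain \<xi> where \<xi>: "\<xi> \<in> B" "\<And>x. x \<in> B \<Longrightarrow> norm (k x) \<le> norm (k \<xi>)"
    using continuous_attains_sup[of B "\<lambda>x. norm (k x)"] holomorphic_on_imp_continuous_on[OF k_hol]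
    by (metis continuous_on_norm continuous_on_subset empty_iff)
  have max: "norm (k x) \<le> norm (k \<xi>)" if "x \<in> A" for x
  proof -
    consider "x \<in> B" | "norm x < r" | "norm x > 1 / r" by (force simp: inB)
    thus ?thesis
    proof cases
      case 2
      have x0: "x \<noteq> 0" "x \<noteq> 1" using nz[OF that] 2 r by auto
      have ge: "norm (x / p) > 1" using that p by (simp add: inA norm_divide field_simps)
      hence ne: "x / p \<noteq> 1" by auto
      have "norm x * r \<le> r * r" using 2 r(1) by (intro mult_right_mono) auto
      hence "norm (x / p) \<le> 1 / r" using p r by (simp add: norm_divide field_simps)
      hence "x / p \<in> B" using ge r(2) unfolding inB by linarith
      moreover have "k x = k (x / p)"
        using kK[OF that x0(2)] kK[of "x / p"] K_p[of "x / p"] \<open>x / p \<in> B\<close> BA ne p x0 by auto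
      ultimately show ?thesis using \<xi>(2) by simp
    next
      case 3
      have x0: "x \<noteq> 0" "x \<noteq> 1" using nz[OF that] 3 r by (auto simp: field_simps)
      have le: "norm (p * x) < 1" using that p by (simp add: inA norm_mult field_simps)
      hence ne: "p * x \<noteq> 1" by auto
      have "r \<le> norm (p * x)" using 3 r(1) by (simp add: norm_mult r(4)[symmetric] field_simps)
      moreover have "1 \<le> 1 / r" using r by simp
      ultimately have "p * x \<in> B" using le unfolding inB by linarith
      moreover have "k x = k (p * x)"
        using kK[OF that x0(2)] kK[of "p * x"] K_p[of x] \<open>p * x \<in> B\<close> BA ne p x0 by auto
      ultimately show ?thesis using \<xi>(2) by simp
    qed (use \<xi> in auto)
  qed
  have "k constant_on A"
    using maximum_modulus_principle[OF k_hol \<open>open A\<close> \<open>connected A\<close> \<open>open A\<close> subset_refl] \<xi>(1) BA max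
    by blast
  then obtain c where c: "\<And>x. x \<in> A \<Longrightarrow> k x = c" by (auto simp: constant_on_def)
  have Kc: "K x = c" if x: "x \<noteq> 0" "theta x p \<noteq> 0" for x
  proof -
    define g where "g = (\<lambda>u. (K u, theta u p = 0, u = 0))"
    have "g (p * u) = g u" if "u \<noteq> 0" for u
      using K_p[OF that] theta_mult_nome[OF p(1) that p(2)] that p by (simp add: g_def)
    then obtain x' where "norm p < norm x'" "norm x' \<le> 1" "g x' = g x"
      using nome_orbit_representative[OF p x(1), of g] by blast
    hence x': "norm p < norm x'" "norm x' \<le> 1"
      "(K x', theta x' p = 0, x' = 0) = (K x, theta x p = 0, x = 0)"
      by (simp_all add: g_def)
    have "1 < 1 / norm p" using p by simp
    hence "norm x' < 1 / norm p" using x'(2) by linarith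
    hence "x' \<in> A" using x'(1) by (simp add: inA)
    moreover have "x' \<noteq> 1" using x'(3) x theta_one[OF p(1)] by auto
    ultimately show ?thesis using kK[of x'] c x'(3) by auto
  qed
  have "K y = 0" using y theta_one[OF p(1)] by (simp add: K_def W_def)
  hence "c = 0" using Kc[OF y] by simp
  hence "K x = 0" using Kc[OF x] by simp
  thus ?thesis by (simp add: K_def C_def W_def) (simp add: algebra_simps eq_neg_iff_add_eq_0)
qed

section \<open>An identity for elliptic sequences of period 24\<close>

text \<open>The three-term relations at suitable triples of indices express everything through
  \<open>A = s\<^sub>4\<^sup>2\<close>, \<open>B = s\<^sub>8\<^sup>2\<close> (the 6-torsion), \<open>s\<^sub>3\<^sup>2\<close>, \<open>s\<^sub>9\<^sup>2\<close> (the 8-torsion), \<open>s\<^sub>6\<close> and \<open>w = s\<^sub>1\<^sub>2\<close>: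
  the products \<open>s\<^sub>2 s\<^sub>1\<^sub>0\<close>, \<open>s\<^sub>3 s\<^sub>9\<close>, \<open>s\<^sub>1 s\<^sub>7\<close> and \<open>s\<^sub>5 s\<^sub>1\<^sub>1\<close> become polynomials in these divided by
  \<open>w\<^sup>2\<close>.  The 6- and the 8-torsion are linked only through \<open>n = s\<^sub>6\<^sup>4 / w\<^sup>4\<close>, and the claim reduces to
  a polynomial identity modulo \<open>A\<^sup>3 B = n\<^sup>2 (B - A)\<^sup>3 (B + 3 A)\<close>.\<close>

lemma elliptic_sequence_24_identity:
  fixes s :: "int \<Rightarrow> complex"
  assumes odd: "\<And>k. s (- k) = - s k" and refl: "\<And>k. s (24 - k) = s k"
    and nz: "\<And>k. 1 \<le> k \<Longrightarrow> k \<le> 12 \<Longrightarrow> s k \<noteq> 0"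
    and rel: "\<And>i j k. 1 \<le> i \<Longrightarrow> i \<le> 12 \<Longrightarrow> 1 \<le> j \<Longrightarrow> j \<le> 12 \<Longrightarrow> 1 \<le> k \<Longrightarrow> k \<le> 12 \<Longrightarrow> s (i + j) * s (i - j) * s k ^ 2 + s (j + k) * s (j - k) * s i ^ 2
                       + s (k + i) * s (k - i) * s j ^ 2 = 0"
  shows "2 * s 6 * s 8 * (1 / (s 1 * s 7) ^ 2 + 1 / (s 5 * s 11) ^ 2) =
     s 4 ^ 4 * s 8 * s 12 ^ 4 / (s 1 * s 5 * s 7 * s 11 * (s 2 * s 10) ^ 2 * s 6 ^ 3)
     + (s 2 * s 10) ^ 3 * s 4 ^ 2 * s 6 ^ 7 * s 8 * s 12 ^ 2 
       / ((s 1 * s 5 * s 7 * s 11) ^ 3 * (s 3 * s 9) ^ 4)"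
proof -
  have big: "s 13 = s 11" "s 14 = s 10" "s 15 = s 9" "s 16 = s 8" "s 17 = s 7" "s 18 = s 6" "s 20 = s 4"
    "s 19 = s 5" "s 21 = s 3" "s 22 = s 2" "s 23 = s 1"
    using refl[of 11] refl[of 10] refl[of 9] refl[of 8] refl[of 7] refl[of 6] refl[of 5] refl[of 4]
      refl[of 3] refl[of 2] refl[of 1] by simp_all
  have neg: "s (- 1) = - s 1" "s (- numeral n) = - s (numeral n)" for n by (rule odd)+
  define u v b c where "u = s 5 * s 11" and "v = s 1 * s 7" and "b = s 2 * s 10" and "c = s 3 * s 9"
  define w where "w = s 12"
  define A B where "A = s 4 ^ 2" and "B = s 8 ^ 2"
  define C3 C9 where "C3 = s 3 ^ 2" and "C9 = s 9 ^ 2"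
  note nz' = nz[of 1] nz[of 2] nz[of 3] nz[of 4] nz[of 5] nz[of 6] nz[of 7] nz[of 8] nz[of 9] nz[of 10]
     nz[of 11] nz[of 12]
  have e1: "B ^ 2 - A ^ 2 = w ^ 3 * s 4"
    using rel[of 12 8 4] unfolding A_def B_def w_def by (simp add: big neg) Groebner_Basis.algebra
  have e2: "b * w ^ 2 = s 6 ^ 2 * (B - A)"
    using rel[of 6 4 12] unfolding A_def B_def w_def b_def by (simp add: big neg) Groebner_Basis.algebra
  have e3: "c * w ^ 2 = s 6 ^ 2 * (C9 - C3)"
    using rel[of 12 3 6] unfolding C9_def C3_def w_def c_def using nz' by (simp add: big neg) Groebner_Basis.algebra
  have e4: "c * (C3 + C9) = w * s 6 ^ 3"
    using rel[of 9 6 3] unfolding C9_def C3_def w_def c_def by (simp add: big neg) Groebner_Basis.algebra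
  have e5: "v * s 6 ^ 2 = c * A - b * C3"
    using rel[of 6 3 4] unfolding A_def C3_def b_def c_def v_def by (simp add: big neg) Groebner_Basis.algebra
  have e6: "u * s 6 ^ 2 = c * B + b * C3"
    using rel[of 6 3 8] unfolding B_def C3_def b_def c_def u_def by (simp add: big neg) Groebner_Basis.algebra
  have e7: "s 4 * (s 2 ^ 2 + s 10 ^ 2) = w * s 6 ^ 2"
  proof -
    have "s 8 * (s 4 * (s 2 ^ 2 + s 10 ^ 2) - w * s 6 ^ 2) = 0"
      using rel[of 6 2 10] unfolding w_def by (simp add: big neg) Groebner_Basis.algebra
    thus ?thesis using nz' by simp
  qed
  have e8: "s 6 ^ 2 * (s 10 ^ 2 - s 2 ^ 2) = s 8 * s 4 * w ^ 2"
    using rel[of 6 2 12] unfolding w_def by (simp add: big neg) Groebner_Basis.algebra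
  have e9: "c ^ 2 = C3 * C9" by (simp add: c_def C3_def C9_def power_mult_distrib)
  have nzs: "w \<noteq> 0" "s 6 \<noteq> 0" "s 4 \<noteq> 0" "s 8 \<noteq> 0" "A \<noteq> 0" "B \<noteq> 0" "u \<noteq> 0" "v \<noteq> 0" "b \<noteq> 0" "c \<noteq> 0"
    using nz' by (simp_all add: w_def A_def B_def u_def v_def b_def c_def)
  have v: "v * w ^ 2 = C9 * A - B * C3"
  proof -
    have "s 6 ^ 2 * (v * w ^ 2 - (C9 * A - B * C3)) = 0"
      using e5 e2 e3 by Groebner_Basis.algebra
    thus ?thesis using nzs by simp
  qed
  have u: "u * w ^ 2 = C9 * B - A * C3"
  proof -
    have "s 6 ^ 2 * (u * w ^ 2 - (C9 * B - A * C3)) = 0"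
      using e6 e2 e3 by Groebner_Basis.algebra
    thus ?thesis using nzs by simp
  qed
  have BA: "B - A \<noteq> 0" using e2 nzs by auto
  \<comment> \<open>eliminating \<open>s 2\<close> and \<open>s 10\<close>, whose product, sum of squares and difference of squares are known\<close>
  have link0: "A * (B * w ^ 8) = w ^ 2 * s 6 ^ 8 * w ^ 4 / A - 4 * s 6 ^ 8 * (B - A) ^ 2" 
  proof -
    have "A * (s 2 ^ 2 + s 10 ^ 2) ^ 2 = w ^ 2 * s 6 ^ 4"
      using e7 unfolding A_def by Groebner_Basis.algebra
    hence h1: "(s 2 ^ 2 + s 10 ^ 2) ^ 2 = w ^ 2 * s 6 ^ 4 / A" using nzs by (simp add: field_simps)
    have h2: "s 6 ^ 4 * (s 10 ^ 2 - s 2 ^ 2) ^ 2 = A * B * w ^ 4"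
      using e8 unfolding A_def B_def by Groebner_Basis.algebra
    have h3: "b ^ 2 * w ^ 4 = s 6 ^ 4 * (B - A) ^ 2" using e2 by Groebner_Basis.algebra
    have h4: "(s 10 ^ 2 - s 2 ^ 2) ^ 2 = (s 2 ^ 2 + s 10 ^ 2) ^ 2 - 4 * b ^ 2" unfolding b_def by Groebner_Basis.algebra
    have "A * B * w ^ 8 = w ^ 4 * s 6 ^ 4 * (w ^ 2 * s 6 ^ 4 / A) - 4 * s 6 ^ 4 * (b ^ 2 * w ^ 4)"
      using h2 unfolding h4 h1 by Groebner_Basis.algebra
    also have "\<dots> = w ^ 2 * s 6 ^ 8 * w ^ 4 / A - 4 * s 6 ^ 8 * (B - A) ^ 2"
      unfolding h3 using nzs by (simp add: field_simps)
    finally show ?thesis by (simp only: mult.assoc)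
  qed
  have hom: "(B - A) ^ 2 * (B + A) ^ 2 = w ^ 6 * A"
    using e1 unfolding A_def by Groebner_Basis.algebra
  have link: "A ^ 3 * B * w ^ 8 = s 6 ^ 8 * (B - A) ^ 3 * (B + 3 * A)"
  proof -
    have "A ^ 2 * (A * B * w ^ 8) = A * (w ^ 6 * A) * s 6 ^ 8 / A - 4 * A ^ 2 * s 6 ^ 8 * (B - A) ^ 2"
      unfolding mult.assoc link0 by Groebner_Basis.algebra
    also have "\<dots> = (w ^ 6 * A) * s 6 ^ 8 - 4 * A ^ 2 * s 6 ^ 8 * (B - A) ^ 2"
      using nzs by simp
    finally show ?thesis unfolding hom[symmetric] by Groebner_Basis.algebra
  qed
  define D where "D = C9 - C3"
  define d where "d = B - A"
  define n where "n = s 6 ^ 4 / w ^ 4"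
  \<comment> \<open>the 8-torsion enters through \<open>C3 * C9\<close> and \<open>(C3 + C9)\<^sup>2\<close>, both multiples of \<open>D\<^sup>2\<close>\<close>
  have C_prod: "C3 * C9 = n * D ^ 2"
  proof -
    have "w ^ 4 * (C3 * C9) = s 6 ^ 4 * D ^ 2" using e3 e9 unfolding D_def by Groebner_Basis.algebra
    thus ?thesis using nzs by (simp add: n_def field_simps)
  qed
  have D4: "D ^ 4 * (1 + 4 * n) = w ^ 6 * s 6 ^ 2"
  proof -
    have "D * (C3 + C9) = w ^ 3 * s 6"
    proof -
      have "s 6 ^ 2 * (D * (C3 + C9) - w ^ 3 * s 6) = 0" using e3 e4 unfolding D_def by Groebner_Basis.algebra
      thus ?thesis using nzs by simp
    qed
    moreover have "(C3 + C9) ^ 2 = D ^ 2 + 4 * (n * D ^ 2)"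
      using C_prod unfolding D_def by Groebner_Basis.algebra
    ultimately show ?thesis by Groebner_Basis.algebra
  qed
  have Dnz: "D \<noteq> 0" using e3 nzs unfolding D_def by auto
  define X Y where "X = A * B - n * d ^ 2" and "Y = A ^ 2 + B ^ 2 + 2 * n * d ^ 2"
  have uv: "u * v * w ^ 4 = D ^ 2 * X"
  proof -
    have "u * v * w ^ 4 = A * B * (D ^ 2 + 2 * (C3 * C9)) - (A ^ 2 + B ^ 2) * (C3 * C9)"
      using u v unfolding D_def by Groebner_Basis.algebra
    thus ?thesis unfolding C_prod X_def d_def by Groebner_Basis.algebra
  qed
  have uu: "(u ^ 2 + v ^ 2) * w ^ 4 = D ^ 2 * Y"
  proof -
    have "(u ^ 2 + v ^ 2) * w ^ 4 = (A ^ 2 + B ^ 2) * (D ^ 2 + 2 * (C3 * C9)) - 4 * A * B * (C3 * C9)"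
      using u v unfolding D_def by Groebner_Basis.algebra
    thus ?thesis unfolding C_prod Y_def d_def by Groebner_Basis.algebra
  qed
  have linkn: "A ^ 3 * B = n ^ 2 * d ^ 3 * (B + 3 * A)"
    using link nzs by (simp add: n_def d_def field_simps power2_eq_square)
  \<comment> \<open>the coefficients of \<open>n\<close> to odd and to even powers are multiples of the relation \<open>linkn\<close>\<close>
  have key: "2 * n ^ 2 * d ^ 2 * X * Y = X ^ 2 * A ^ 2 + d ^ 5 * A * n ^ 2 * (1 + 4 * n) ^ 2"
    using linkn unfolding X_def Y_def d_def by Groebner_Basis.algebra
  have d: "d \<noteq> 0" using BA by (simp add: d_def)
  have uv': "u * v = D ^ 2 * X / w ^ 4" and uu': "u ^ 2 + v ^ 2 = D ^ 2 * Y / w ^ 4"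
    using uv uu nzs by (simp_all add: field_simps)
  have b': "b = s 6 ^ 2 * d / w ^ 2" and c': "c = s 6 ^ 2 * D / w ^ 2"
    using e2 e3 nzs by (simp_all add: field_simps d_def D_def)
  have t1: "2 * s 6 * (u * v) * (u ^ 2 + v ^ 2) = D ^ 4 / (s 6 ^ 7 * d ^ 2) * (2 * n ^ 2 * d ^ 2 * X * Y)"
    unfolding uv' uu' n_def using nzs d by (simp add: field_simps flip: power_add power_Suc)
  have t2: "(u * v) ^ 2 * A ^ 2 * w ^ 4 / (b ^ 2 * s 6 ^ 3) = D ^ 4 / (s 6 ^ 7 * d ^ 2) * (X ^ 2 * A ^ 2)"
    unfolding uv' b' using nzs d by (simp add: field_simps flip: power_add power_Suc)
  have "(1 + 4 * n) ^ 2 = (w ^ 6 * s 6 ^ 2 / D ^ 4) ^ 2"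
  proof -
    have "1 + 4 * n = w ^ 6 * s 6 ^ 2 / D ^ 4" using D4 Dnz by (simp add: eq_divide_eq mult.commute)
    thus ?thesis by (rule arg_cong)
  qed
  note n4 = this
  have t3: "b ^ 3 * A * s 6 ^ 7 * w ^ 2 / c ^ 4 
         = D ^ 4 / (s 6 ^ 7 * d ^ 2) * (d ^ 5 * A * n ^ 2 * (1 + 4 * n) ^ 2)"
    unfolding n4 unfolding b' c' n_def using nzs d Dnz by (simp add: field_simps flip: power_add power_Suc)
  have "2 * s 6 * (u * v) * (u ^ 2 + v ^ 2) = 
    (u * v) ^ 2 * A ^ 2 * w ^ 4 / (b ^ 2 * s 6 ^ 3) + b ^ 3 * A * s 6 ^ 7 * w ^ 2 / c ^ 4"
    unfolding t1 t2 t3 key by (simp only: distrib_left)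
  hence "s 8 / (u * v) ^ 3 * (2 * s 6 * (u * v) * (u ^ 2 + v ^ 2)) = s 8 / (u * v) ^ 3 *
    ((u * v) ^ 2 * A ^ 2 * w ^ 4 / (b ^ 2 * s 6 ^ 3) + b ^ 3 * A * s 6 ^ 7 * w ^ 2 / c ^ 4)"
    by (rule arg_cong)
  also have "s 8 / (u * v) ^ 3 * (2 * s 6 * (u * v) * (u ^ 2 + v ^ 2)) 
             = 2 * s 6 * s 8 * (1 / v ^ 2 + 1 / u ^ 2)"
    using nzs by (simp add: field_simps eval_nat_numeral)
  also have "s 8 / (u * v) ^ 3 *
    ((u * v) ^ 2 * A ^ 2 * w ^ 4 / (b ^ 2 * s 6 ^ 3) + b ^ 3 * A * s 6 ^ 7 * w ^ 2 / c ^ 4) =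
    s 4 ^ 4 * s 8 * w ^ 4 / (u * v * b ^ 2 * s 6 ^ 3) 
     + b ^ 3 * s 4 ^ 2 * s 6 ^ 7 * s 8 * w ^ 2 / ((u * v) ^ 3 * c ^ 4)"
    unfolding A_def using nzs by (simp add: field_simps eval_nat_numeral)
  finally show ?thesis unfolding u_def v_def w_def b_def c_def by (simp only: mult_ac)
qed

section \<open>Klein forms and points of order 24\<close>

lemma theta_eq_0_iff:
  assumes "Im \<tau> > 0"
  shows "theta (exp (2 * pi * \<i> * w)) (exp (2 * pi * \<i> * \<tau>)) = 0 \<longleftrightarrow> (\<exists>m n :: int. w = of_int m * \<tau> + of_int n)"
proof -
  define p where "p = exp (2 * pi * \<i> * \<tau>)"
  define x where "x = exp (2 * pi * \<i> * w)"
  have p: "norm p < 1" using assms by (simp add: p_def)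
  have eq1: "exp (2 * pi * \<i> * v) = 1 \<longleftrightarrow> (\<exists>n :: int. v = of_int n)" for v
  proof -
    have "exp (2 * pi * \<i> * v) = 1 \<longleftrightarrow> (\<exists>n :: int. 2 * pi * \<i> * v = of_int (2 * n) * pi * \<i>)"
      using exp_eq_1[of "2 * pi * \<i> * v"] by (auto simp: complex_eq_iff)
    also have "\<dots> \<longleftrightarrow> (\<exists>n :: int. v = of_int n)"
      by (intro iff_exI) (auto simp: field_simps)
    finally show ?thesis .
  qed
  have 1: "x * p ^ n = exp (2 * pi * \<i> * (w + of_nat n * \<tau>))" for n
    by (simp add: x_def p_def exp_of_nat_mult[symmetric] exp_add[symmetric] algebra_simps)
  have 2: "p / x * p ^ n = exp (2 * pi * \<i> * (of_nat (Suc n) * \<tau> - w))" for n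
    by (simp add: x_def p_def exp_of_nat_mult[symmetric] exp_add[symmetric] exp_diff[symmetric] algebra_simps)
  have "theta x p = 0 \<longleftrightarrow> (\<exists>n. x * p ^ n = 1) \<or> (\<exists>n. p / x * p ^ n = 1)"
    by (simp add: theta_def qpoch_eq_0_iff[OF p])
  also have "\<dots> \<longleftrightarrow> (\<exists>m n :: int. w = of_int m * \<tau> + of_int n)"
    unfolding 1 2 eq1
  proof safe
    fix n k assume "w + of_nat n * \<tau> = of_int k"
    hence "w = of_int (- int n) * \<tau> + of_int k" by (simp add: algebra_simps)
    thus "\<exists>m n :: int. w = of_int m * \<tau> + of_int n" by blast
  next
    fix n k assume "of_nat (Suc n) * \<tau> - w = of_int k"
    hence "w = of_int (int (Suc n)) * \<tau> + of_int (- k)" by (simp add: algebra_simps)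
    thus "\<exists>m n :: int. w = of_int m * \<tau> + of_int n" by blast
  next
    fix m k
    assume *: "\<nexists>n :: nat. \<exists>na. of_nat (Suc n) * \<tau> - (of_int m * \<tau> + of_int k) = of_int na"
    show "\<exists>n :: nat. \<exists>na. of_int m * \<tau> + of_int k + of_nat n * \<tau> = of_int na"
    proof (cases "m \<le> 0")
      case True
      thus ?thesis by (intro exI[of _ "nat (- m)"] exI[of _ k]) (simp add: algebra_simps)
    next
      case False
      hence "of_nat (Suc (nat (m - 1))) = (of_int m :: complex)" by (simp add: of_nat_nat)
      hence "of_nat (Suc (nat (m - 1))) * \<tau> - (of_int m * \<tau> + of_int k) = of_int (- k)" by simp
      with * show ?thesis by blast
    qed
  qed
  finally show ?thesis unfolding x_def p_def .
qed

text \<open>The theta function at \<open>u \<tau> + v\<close>, multiplied by the exponential factor that makes it odd in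
  \<open>(u, v)\<close> and periodic up to factors of modulus 1.\<close>

definition klein :: "complex \<Rightarrow> real \<Rightarrow> real \<Rightarrow> complex" where
  "klein \<tau> u v = exp (pi * \<i> * (u - 1) * (u * \<tau> + v)) *
     theta (exp (2 * pi * \<i> * (u * \<tau> + v))) (exp (2 * pi * \<i> * \<tau>))"

lemma klein_minus:
  assumes "Im \<tau> > 0"
  shows "klein \<tau> (- u) (- v) = - klein \<tau> u v"
proof -
  define w where "w = of_real u * \<tau> + of_real v"
  define x where "x = exp (2 * pi * \<i> * w)"
  have p: "norm (exp (2 * pi * \<i> * \<tau>)) < 1" using assms by simp
  have w': "of_real (- u) * \<tau> + of_real (- v) = - w" by (simp add: w_def)
  have "exp (2 * pi * \<i> * - w) = 1 / x" by (simp add: x_def exp_minus field_simps)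
  moreover have "exp (pi * \<i> * (of_real (- u) - 1) * (- w)) = exp (pi * \<i> * (of_real u - 1) * w) * x"
    by (simp add: x_def exp_add[symmetric] algebra_simps)
  moreover have "x \<noteq> 0" by (simp add: x_def)
  ultimately show ?thesis
    unfolding klein_def w' w_def[symmetric] x_def[symmetric] using theta_inverse[OF p, of x] by simp
qed

lemma klein_add_nome:
  assumes "Im \<tau> > 0"
  shows "klein \<tau> (u + 1) v = - exp (- (pi * \<i> * v)) * klein \<tau> u v"
proof -
  define w where "w = of_real u * \<tau> + of_real v"
  define x where "x = exp (2 * pi * \<i> * w)"
  define p where "p = exp (2 * pi * \<i> * \<tau>)"
  have p: "norm p < 1" "p \<noteq> 0" using assms by (simp_all add: p_def)
  have w': "of_real (u + 1) * \<tau> + of_real v = w + \<tau>" by (simp add: w_def algebra_simps)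
  have x: "x \<noteq> 0" by (simp add: x_def)
  have "exp (2 * pi * \<i> * (w + \<tau>)) = p * x" by (simp add: x_def p_def exp_add[symmetric] algebra_simps)
  moreover have "exp (pi * \<i> * (of_real (u + 1) - 1) * (w + \<tau>)) 
      = exp (- (pi * \<i> * v)) * exp (pi * \<i> * (of_real u - 1) * w) * x"
    by (simp add: x_def exp_add[symmetric] w_def algebra_simps)
  ultimately show ?thesis
    unfolding klein_def w' w_def[symmetric] p_def[symmetric] x_def[symmetric]
    using theta_mult_nome[OF p(1) x p(2)] x by simp
qed

lemma klein_add_one: "klein \<tau> u (v + 1) = - exp (pi * \<i> * u) * klein \<tau> u v"
proof -
  have "exp (2 * pi * \<i> * (of_real u * \<tau> + of_real (v + 1))) = exp (2 * pi * \<i> * (of_real u * \<tau> + of_real v))"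
    using exp_plus_2pin[of "2 * pi * \<i> * (of_real u * \<tau> + of_real v)" 1] by (simp add: algebra_simps)
  moreover have "exp (pi * \<i> * (of_real u - 1) * (of_real u * \<tau> + of_real (v + 1))) = 
     - exp (pi * \<i> * u) * exp (pi * \<i> * (of_real u - 1) * (of_real u * \<tau> + of_real v))"
  proof -
    have "pi * \<i> * (of_real u - 1) * (of_real u * \<tau> + of_real (v + 1)) =
      pi * \<i> * u + pi * \<i> * (of_real u - 1) * (of_real u * \<tau> + of_real v) - \<i> * pi"
      by (simp add: algebra_simps)
    thus ?thesis by (simp add: exp_diff exp_add)
  qed
  ultimately show ?thesis by (simp add: klein_def)
qed

lemma klein_add_lattice:
  assumes "Im \<tau> > 0"
  shows "klein \<tau> (u + real m) (v + real l) = (-1) ^ (m + l + m * l) * exp (pi * \<i> * of_real (real l * u - real m * v)) * klein \<tau> u v"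
proof -
  have 1: "klein \<tau> u (v + real l) = (-1) ^ l * exp (pi * \<i> * (l * u)) * klein \<tau> u v" for v
  proof (induction l)
    case (Suc l)
    have "klein \<tau> u (v + real (Suc l)) = klein \<tau> u ((v + real l) + 1)" by (simp add: algebra_simps)
    thus ?case unfolding klein_add_one Suc by (simp add: exp_add algebra_simps)
  qed auto
  have 2: "klein \<tau> (u + real m) v = (-1) ^ m * exp (- (pi * \<i> * (m * v))) * klein \<tau> u v" for v :: real
  proof (induction m)
    case (Suc m)
    have "klein \<tau> (u + real (Suc m)) v = klein \<tau> ((u + real m) + 1) v" by (simp add: algebra_simps)
    thus ?case unfolding klein_add_nome[OF assms] Suc
      by (simp add: exp_add exp_diff exp_minus field_simps)
  qed auto
  have a1: "exp (- (pi * \<i> * (m * (v + real l)))) = (-1) ^ (m * l) * exp (- (pi * \<i> * (m * v)))"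
  proof -
    have "- (pi * \<i> * (m * (v + real l))) = of_nat (m * l) * (- (\<i> * pi)) + - (pi * \<i> * (m * v))"
      by (simp add: algebra_simps)
    hence "exp (- (pi * \<i> * (m * (v + real l)))) = exp (- (\<i> * pi)) ^ (m * l) * exp (- (pi * \<i> * (m * v)))"
      by (simp only: exp_add exp_of_nat_mult)
    moreover have "exp (- (\<i> * pi)) = -1" by (simp add: exp_minus)
    ultimately show ?thesis by simp
  qed
  have a2: "exp (pi * \<i> * of_real (real l * u - real m * v)) = exp (pi * \<i> * (l * u)) * exp (- (pi * \<i> * (m * v)))"
    by (simp add: exp_add[symmetric] algebra_simps)
  show ?thesis using 2[of "v + real l"] unfolding 1[of v] a1 a2 by (simp only: power_add mult_ac)
qed

text \<open>The zeros of the theta function are exactly the lattice points.\<close>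

lemma klein_nonzero:
  assumes "Im \<tau> > 0" "\<not> (u \<in> \<int> \<and> v \<in> \<int>)"
  shows "klein \<tau> u v \<noteq> 0"
proof
  assume "klein \<tau> u v = 0"
  then obtain m n :: int where "of_real u * \<tau> + of_real v = of_int m * \<tau> + of_int n"
    using theta_eq_0_iff[OF assms(1), of "of_real u * \<tau> + of_real v"] by (auto simp: klein_def)
  moreover from this have "u = of_int m" using assms(1) by (simp add: complex_eq_iff)
  ultimately show False using assms(2) by (simp add: complex_eq_iff)
qed

text \<open>The normalisation of the Klein form absorbs the factor \<open>y\<close> of the product formula.\<close>

lemma wp_diff_klein:
  assumes "Im \<tau> > 0" and ne: "\<not> (u \<in> \<int> \<and> v \<in> \<int>)" "\<not> (u' \<in> \<int> \<and> v' \<in> \<int>)"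
  defines "p \<equiv> exp (2 * pi * \<i> * \<tau>)"
  shows "wp (exp (2 * pi * \<i> * (u * \<tau> + v))) p - wp (exp (2 * pi * \<i> * (u' * \<tau> + v'))) p =
    - (qpoch p p ^ 4 * (klein \<tau> (u + u') (v + v') * klein \<tau> (u - u') (v - v') 
         / (klein \<tau> u v * klein \<tau> u' v') ^ 2))"
proof -
  define w where "w = of_real u * \<tau> + of_real v"
  define w' where "w' = of_real u' * \<tau> + of_real v'"
  define x y where "x = exp (2 * pi * \<i> * w)" and "y = exp (2 * pi * \<i> * w')"
  have p: "norm p < 1" "p \<noteq> 0" using assms(1) by (simp_all add: p_def)
  have xy: "x \<noteq> 0" "y \<noteq> 0" by (simp_all add: x_def y_def)
  have nz: "theta x p \<noteq> 0" "theta y p \<noteq> 0"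
    using klein_nonzero[OF assms(1) ne(1)] klein_nonzero[OF assms(1) ne(2)]
    by (auto simp: klein_def w_def w'_def x_def y_def p_def)
  have w: "of_real (u + u') * \<tau> + of_real (v + v') = w + w'" "of_real (u - u') * \<tau> + of_real (v - v') = w - w'"
    by (simp_all add: w_def w'_def algebra_simps)
  define a b c d where "a = exp (pi * \<i> * (of_real u - 1) * w)" and "b = exp (pi * \<i> * (of_real u' - 1) * w')"
    and "c = exp (pi * \<i> * (of_real (u + u') - 1) * (w + w'))"
    and "d = exp (pi * \<i> * (of_real (u - u') - 1) * (w - w'))"
  have abcd: "c * d = y * (a * b) ^ 2"
    by (simp add: a_def b_def c_def d_def y_def exp_add[symmetric] power2_eq_square algebra_simps)
  have ab: "a \<noteq> 0" "b \<noteq> 0" by (simp_all add: a_def b_def)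
  have k: "klein \<tau> u v = a * theta x p" "klein \<tau> u' v' = b * theta y p"
    "klein \<tau> (u + u') (v + v') = c * theta (x * y) p" "klein \<tau> (u - u') (v - v') = d * theta (x / y) p"
    by (simp_all only: klein_def w w_def[symmetric] w'_def[symmetric] p_def[symmetric] x_def y_def a_def b_def
         c_def d_def distrib_left right_diff_distrib exp_add exp_diff)
  have "klein \<tau> (u + u') (v + v') * klein \<tau> (u - u') (v - v') / (klein \<tau> u v * klein \<tau> u' v') ^ 2
       = (c * d) * (theta (x * y) p * theta (x / y) p) / ((a * b) ^ 2 * (theta x p * theta y p) ^ 2)"
    unfolding k by (simp add: power_mult_distrib mult_ac)
  also have "\<dots> = y * (theta (x * y) p * theta (x / y) p) / (theta x p * theta y p) ^ 2"
    unfolding abcd using ab by simp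
  finally have "klein \<tau> (u + u') (v + v') * klein \<tau> (u - u') (v - v') / (klein \<tau> u v * klein \<tau> u' v') ^ 2 =
     y * (theta (x * y) p * theta (x / y) p) / (theta x p * theta y p) ^ 2" .
  thus ?thesis
    using wp_diff_theta[OF p xy(1) nz(1) xy(2) nz(2)]
    unfolding w_def[symmetric] w'_def[symmetric] x_def[symmetric] y_def[symmetric]
    by (simp add: power_mult_distrib mult_ac)
qed

lemma torsion_not_integral:
  fixes M L :: nat and k :: int
  assumes LM: "M * L = 24" "coprime M L" and that: "1 \<le> k" "k \<le> 12"
  shows "\<not> (of_int k / real M \<in> \<int> \<and> of_int k / real L \<in> \<int>)"
proof
  have LMpos: "M > 0" "L > 0" using LM by (auto intro: Nat.gr0I)
  assume *: "of_int k / real M \<in> \<int> \<and> of_int k / real L \<in> \<int>"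
  have dvd: "int n dvd k" if "n > 0" "of_int k / real n \<in> \<int>" for n
  proof -
    obtain j :: int where "of_int k / real n = of_int j" using \<open>_ \<in> \<int>\<close> by (elim Ints_cases)
    hence "real_of_int k = real_of_int (j * int n)" using \<open>n > 0\<close> by (simp add: field_simps)
    hence "k = j * int n" by (simp only: of_int_eq_iff)
    thus ?thesis by simp
  qed
  have "int M dvd k" "int L dvd k" using * LMpos by (simp_all add: dvd)
  hence "int M * int L dvd k" using LM(2) by (intro divides_mult) auto
  moreover have "int M * int L = 24" using LM(1) by (simp flip: of_nat_mult)
  ultimately have "24 dvd k" by simp
  thus False using that by (auto dest: zdvd_imp_le)
qed

text \<open>Here \<open>s k\<close> is the Klein form at \<open>k\<close> times the point with coordinates \<open>(1 / M, 1 / L)\<close>, which has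
  exact order 24 as \<open>M\<close> and \<open>L\<close> are coprime.  Since one of \<open>M\<close>, \<open>L\<close> is odd, translation by the
  lattice point \<open>(L, M)\<close> multiplies the Klein form at these points by \<open>-1\<close>, so that oddness gives \<open>s (24 - k) = s k\<close>;
  the three-term relation is the vanishing of \<open>(wp i - wp j) + (wp j - wp k) + (wp k - wp i)\<close>.\<close>

lemma wp_24_torsion_identity:
  fixes M L :: nat and \<tau> :: complex
  assumes \<tau>: "Im \<tau> > 0" and LM: "M * L = 24" "coprime M L"
  defines "p \<equiv> exp (2 * pi * \<i> * \<tau>)"
  defines "X \<equiv> \<lambda>k. wp (exp (2 * pi * \<i> * (real k / real M * \<tau> + real k / real L))) p"
  defines "s \<equiv> \<lambda>k :: nat. klein \<tau> (real k / real M) (real k / real L)"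
  shows "2 * (X 1 + X 5 - X 7 - X 11) = qpoch p p ^ 4 * 
     (s 4 ^ 4 * s 8 * s 12 ^ 4 / (s 1 * s 5 * s 7 * s 11 * (s 2 * s 10) ^ 2 * s 6 ^ 3)
     + (s 2 * s 10) ^ 3 * s 4 ^ 2 * s 6 ^ 7 * s 8 * s 12 ^ 2 
       / ((s 1 * s 5 * s 7 * s 11) ^ 3 * (s 3 * s 9) ^ 4))"
proof -
  define S where "S = (\<lambda>k :: int. klein \<tau> (of_int k / real M) (of_int k / real L))"
  define e where "e = qpoch p p"
  have sS: "s k = S (int k)" for k by (simp add: s_def S_def)
  have LMpos: "M > 0" "L > 0" using LM by (auto intro: Nat.gr0I)
  have e_nz: "e \<noteq> 0"
    unfolding e_def by (rule qpoch_nome_nonzero) (use \<tau> in \<open>simp add: p_def\<close>)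
  have odd: "S (- k) = - S k" for k
    using klein_minus[OF \<tau>, of "of_int k / real M" "of_int k / real L"] by (simp add: S_def)
  have refl: "S (24 - k) = S k" for k
  proof -
    have 24: "24 / real M = real L" "24 / real L = real M"
      using LM LMpos by (simp_all add: field_simps flip: of_nat_mult)
    have eq: "of_int (24 - k) / real M = of_int (- k) / real M + real L"
      "of_int (24 - k) / real L = of_int (- k) / real L + real M"
      by (simp_all add: diff_divide_distrib 24)
    have "odd (L + M + L * M)" using LM(2) coprime_common_divisor_nat[of M L 2] by auto
    moreover have "real M * (of_int (- k) / real M) - real L * (of_int (- k) / real L) = 0"
      using LMpos by simp
    moreover have "S (24 - k) = klein \<tau> (of_int (- k) / real M + real L) (of_int (- k) / real L + real M)"
      unfolding S_def eq ..
    ultimately have "S (24 - k) = - klein \<tau> (of_int (- k) / real M) (of_int (- k) / real L)"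
      unfolding klein_add_lattice[OF \<tau>] by (simp del: of_int_minus)
    thus ?thesis using odd[of k] by (simp add: S_def)
  qed
  note nint = torsion_not_integral[OF LM]
  have nz: "S k \<noteq> 0" if "1 \<le> k" "k \<le> 12" for k
    unfolding S_def by (rule klein_nonzero[OF \<tau> nint[OF that]])
  define Y where "Y = (\<lambda>k :: int. wp (exp (2 * pi * \<i> * (of_real (of_int k / real M) * \<tau> + of_real (of_int k / real L)))) p)"
  have XY: "X k = Y (int k)" for k by (simp add: X_def Y_def)
  have diff: "Y i - Y j = - (e ^ 4) * (S (i + j) * S (i - j) / (S i * S j) ^ 2)"
    if "1 \<le> i" "i \<le> 12" "1 \<le> j" "j \<le> 12" for i j
    using wp_diff_klein[OF \<tau> nint[OF that(1,2)] nint[OF that(3,4)]]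
    by (simp add: Y_def S_def e_def p_def add_divide_distrib diff_divide_distrib)
  have rel: "S (i + j) * S (i - j) * S k ^ 2 + S (j + k) * S (j - k) * S i ^ 2
                       + S (k + i) * S (k - i) * S j ^ 2 = 0"
    if "1 \<le> i" "i \<le> 12" "1 \<le> j" "j \<le> 12" "1 \<le> k" "k \<le> 12" for i j k
  proof -
    have "- (e ^ 4) * (S (i + j) * S (i - j) / (S i * S j) ^ 2 + S (j + k) * S (j - k) / (S j * S k) ^ 2
            + S (k + i) * S (k - i) / (S k * S i) ^ 2) = (Y i - Y j) + (Y j - Y k) + (Y k - Y i)"
      unfolding diff[OF that(1-4)] diff[OF that(3-6)] diff[OF that(5,6,1,2)] by (simp only: distrib_left)
    also have "\<dots> = 0" by simp
    finally have "S (i + j) * S (i - j) / (S i * S j) ^ 2 + S (j + k) * S (j - k) / (S j * S k) ^ 2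
            + S (k + i) * S (k - i) / (S k * S i) ^ 2 = 0" using e_nz by simp
    hence "(S (i + j) * S (i - j) / (S i * S j) ^ 2 + S (j + k) * S (j - k) / (S j * S k) ^ 2
            + S (k + i) * S (k - i) / (S k * S i) ^ 2) * (S i * S j * S k) ^ 2 = 0" by simp
    also have "(S (i + j) * S (i - j) / (S i * S j) ^ 2 + S (j + k) * S (j - k) / (S j * S k) ^ 2
            + S (k + i) * S (k - i) / (S k * S i) ^ 2) * (S i * S j * S k) ^ 2 = 
          S (i + j) * S (i - j) * S k ^ 2 + S (j + k) * S (j - k) * S i ^ 2
                       + S (k + i) * S (k - i) * S j ^ 2"
      using nz[OF that(1,2)] nz[OF that(3,4)] nz[OF that(5,6)]
      by (simp add: distrib_right power_mult_distrib)
    finally show ?thesis .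
  qed
  have neg6: "S (- 6) = - S 6" by (rule odd)
  have 16: "S 16 = S 8" using refl[of 8] by simp
  have "X 1 + X 5 - X 7 - X 11 = (Y 1 - Y 7) + (Y 5 - Y 11)" by (simp add: XY)
  also have "\<dots> = e ^ 4 * (S 6 * S 8 * (1 / (S 1 * S 7) ^ 2 + 1 / (S 5 * S 11) ^ 2))"
    using diff[of 1 7] diff[of 5 11] by (simp add: neg6 16 distrib_left mult.commute)
  finally have "2 * (X 1 + X 5 - X 7 - X 11) = e ^ 4 * (2 * S 6 * S 8 * (1 / (S 1 * S 7) ^ 2 + 1 / (S 5 * S 11) ^ 2))"
    by (simp only: mult_ac)
  also note elliptic_sequence_24_identity[of S, OF odd refl nz rel]
  finally show ?thesis by (simp add: sS e_def)
qed

section \<open>Products over torsion subgroups\<close>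

text \<open>The inner product runs over roots of unity and replaces \<open>q\<close> by \<open>q\<^sup>n\<close>; the outer one joins the residue
  classes modulo \<open>m\<close>.\<close>

lemma qpoch_torsion_grid:
  assumes "norm q < 1" "m > 0" "n > 0" "k > 0" "l > 0"
  shows "(\<Prod>j<m. \<Prod>i<n. qpoch (cis (2 * pi * real (i * l) / real (n * l)) * q ^ ((j + 1) * k)) (q ^ (m * k)))
           = qpoch (q ^ (n * k)) (q ^ (n * k))"
proof -
  have nq: "norm (q ^ d) < 1" if "d > 0" for d
    using assms that by (simp add: norm_power power_less_one_iff)
  have "(\<Prod>i<n. qpoch (cis (2 * pi * real (i * l) / real (n * l)) * q ^ ((j + 1) * k)) (q ^ (m * k)))
        = qpoch (q ^ (n * k) * (q ^ (n * k)) ^ j) ((q ^ (n * k)) ^ m)" for j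
  proof -
    have "real (i * l) / real (n * l) = real i / real n" for i using assms by simp
    hence "cis (2 * pi * real (i * l) / real (n * l)) = cis (2 * pi * real i / real n)" for i
      by (metis times_divide_eq_right)
    moreover have "(q ^ ((j + 1) * k)) ^ n = q ^ (n * k) * (q ^ (n * k)) ^ j"
      "(q ^ (m * k)) ^ n = (q ^ (n * k)) ^ m"
      by (simp_all add: power_add[symmetric] power_mult[symmetric] algebra_simps)
    ultimately show ?thesis
      using qpoch_root_unity[OF nq[of "m * k"], of n "q ^ ((j + 1) * k)"] assms by simp
  qed
  thus ?thesis using qpoch_dissect[OF nq[of "n * k"], of m "q ^ (n * k)"] assms by simp
qed

text \<open>One of the two \<^term>\<open>qpoch\<close> factors of the theta function at \<open>k\<close> times the torsion point, with the argument reduced modulo the nome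
  to an exponent in \<open>1, \<dots>, M\<close>.  Taking \<open>M\<close> instead of \<open>0\<close> leaves out the factor
  \<open>1 - exp (2 \<pi> \<i> k / L)\<close>, which is a constant and vanishes for \<open>k = 0\<close>.\<close>

definition torsion_poch :: "complex \<Rightarrow> nat \<Rightarrow> nat \<Rightarrow> nat \<Rightarrow> complex" where
  "torsion_poch q M L k = qpoch (cis (2 * pi * real (k mod L) / real L) * 
        q ^ (if k mod M = 0 then M else k mod M)) (q ^ M)"

abbreviation subgroup_prod :: "(nat \<Rightarrow> complex) \<Rightarrow> nat \<Rightarrow> complex" where
  "subgroup_prod F n \<equiv> \<Prod>j<n. F (24 div n * j)"

text \<open>A cyclic subgroup of order \<open>n\<close> splits into its parts of orders \<open>gcd n L\<close> (roots of unity) and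
  \<open>gcd n M\<close> (powers of \<open>q\<close>), which makes it a grid as in \<open>qpoch_torsion_grid\<close>.\<close>

lemma torsion_poch_subgroup:
  assumes "norm q < 1" "LM = (24, 1) \<or> LM = (1, 24) \<or> LM = (3, 8) \<or> LM = (8, 3)"
  shows "\<forall>n\<in>{1, 2, 3, 4, 6, 8, 12, 24}. subgroup_prod (torsion_poch q (fst LM) (snd LM)) n 
           = epoch q (gcd n (snd LM) * (fst LM div gcd n (fst LM)))"
proof -
  have *: "epoch q (n * k) = (\<Prod>j<m. \<Prod>i<n. qpoch (cis (2 * pi * real (i * l) / real (n * l)) * q ^ ((j + 1) * k)) (q ^ (m * k)))"
    if "m > 0" "n > 0" "k > 0" "l > 0" for m n k l
    unfolding epoch_def by (rule qpoch_torsion_grid[OF assms(1) that, symmetric])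
  show ?thesis
    using assms(2)
  proof (elim disjE)
    assume LM: "LM = (24, 1)"
    show ?thesis unfolding LM
      using *[of 1 1 24 1] *[of 2 1 12 1] *[of 3 1 8 1] *[of 4 1 6 1] *[of 6 1 4 1] *[of 8 1 3 1]
         *[of 12 1 2 1] *[of 24 1 1 1]
      by (simp add: lessThan_nat_numeral lessThan_Suc torsion_poch_def mult_ac numeral_2_eq_2[symmetric] gcd_non_0_nat
           del: power_Suc)
  next
    assume LM: "LM = (1, 24)"
    show ?thesis unfolding LM
      using *[of 1 1 1 24] *[of 1 2 1 12] *[of 1 3 1 8] *[of 1 4 1 6] *[of 1 6 1 4] *[of 1 8 1 3]
         *[of 1 12 1 2] *[of 1 24 1 1]
      by (simp add: lessThan_nat_numeral lessThan_Suc torsion_poch_def mult_ac numeral_2_eq_2[symmetric] gcd_non_0_nat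
           del: power_Suc)
  next
    assume LM: "LM = (3, 8)"
    show ?thesis unfolding LM
      using *[of 1 1 3 8] *[of 1 2 3 4] *[of 3 1 1 8] *[of 1 4 3 2] *[of 3 2 1 4] *[of 1 8 3 1]
         *[of 3 4 1 2] *[of 3 8 1 1]
      by (simp add: lessThan_nat_numeral lessThan_Suc torsion_poch_def mult_ac numeral_2_eq_2[symmetric] gcd_non_0_nat
           del: power_Suc)
  next
    assume LM: "LM = (8, 3)"
    show ?thesis unfolding LM
      using *[of 1 1 8 3] *[of 2 1 4 3] *[of 1 3 8 1] *[of 4 1 2 3] *[of 2 3 4 1] *[of 8 1 1 3]
         *[of 4 3 2 1] *[of 8 3 1 1]
      by (simp add: lessThan_nat_numeral lessThan_Suc torsion_poch_def mult_ac numeral_2_eq_2[symmetric] gcd_non_0_nat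
           del: power_Suc)
  qed
qed

text \<open>By inclusion and exclusion over subgroups, the product over all points of a given exact order is a
  quotient of subgroup products, for instance \<open>e 24 * e 4 / (e 12 * e 8)\<close> for order 24.\<close>

lemma torsion_product_monomials:
  fixes F :: "nat \<Rightarrow> complex" and s \<mu> :: "nat \<Rightarrow> complex"
  assumes F: "\<And>k. F k \<noteq> 0" and \<mu>: "\<And>k. k \<in> {1..12} \<Longrightarrow> \<mu> k \<noteq> 0"
    and s: "\<And>k. k \<in> {1..12} \<Longrightarrow> s k = \<mu> k * (F k * F (24 - k))"
  defines "e \<equiv> subgroup_prod F"
  shows "e 1 ^ 4 * (s 4 ^ 4 * s 8 * s 12 ^ 4 / (s 1 * s 5 * s 7 * s 11 * (s 2 * s 10) ^ 2 * s 6 ^ 3)) =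
     \<mu> 4 ^ 4 * \<mu> 8 * \<mu> 12 ^ 4 / (\<mu> 1 * \<mu> 5 * \<mu> 7 * \<mu> 11 * (\<mu> 2 * \<mu> 10) ^ 2 * \<mu> 6 ^ 3) *
     (e 6 ^ 6 * e 2 ^ 5 * e 8 / (e 24 * e 12 * e 4 ^ 2 * e 3 ^ 3 * e 1))" (is ?th1)
   and "e 1 ^ 4 * ((s 2 * s 10) ^ 3 * s 4 ^ 2 * s 6 ^ 7 * s 8 * s 12 ^ 2 
       / ((s 1 * s 5 * s 7 * s 11) ^ 3 * (s 3 * s 9) ^ 4)) =
     (\<mu> 2 * \<mu> 10) ^ 3 * \<mu> 4 ^ 2 * \<mu> 6 ^ 7 * \<mu> 8 * \<mu> 12 ^ 2 
       / ((\<mu> 1 * \<mu> 5 * \<mu> 7 * \<mu> 11) ^ 3 * (\<mu> 3 * \<mu> 9) ^ 4) *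
     (e 12 ^ 6 * e 4 ^ 5 * e 1 / (e 24 ^ 3 * e 8 * e 6 * e 3 * e 2 ^ 2))" (is ?th2)
proof -
  note simps = e_def lessThan_nat_numeral lessThan_Suc
  have nz: "e n \<noteq> 0" for n by (simp add: e_def F)
  have nz1: "e (Suc 0) \<noteq> 0" using nz[of 1] by simp
  have a: "s 1 * s 5 * s 7 * s 11 = \<mu> 1 * \<mu> 5 * \<mu> 7 * \<mu> 11 * (e 24 * e 4 / (e 12 * e 8))"
  proof -
    have "F 1 * F 23 * F 5 * F 19 * F 7 * F 17 * F 11 * F 13 * (e 12 * e 8) = e 24 * e 4"
      by (simp add: simps mult_ac)
    thus ?thesis using nz by (simp add: s field_simps)
  qed
  have b: "s 2 * s 10 = \<mu> 2 * \<mu> 10 * (e 12 * e 2 / (e 6 * e 4))"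
  proof -
    have "F 2 * F 22 * F 10 * F 14 * (e 6 * e 4) = e 12 * e 2" by (simp add: simps mult_ac)
    thus ?thesis using nz by (simp add: s field_simps)
  qed
  have c: "s 3 * s 9 = \<mu> 3 * \<mu> 9 * (e 8 / e 4)"
  proof -
    have "F 3 * F 21 * F 9 * F 15 * e 4 = e 8" by (simp add: simps mult_ac)
    thus ?thesis using nz by (simp add: s field_simps)
  qed
  have s4: "s 4 = \<mu> 4 * (e 6 * e 1 / (e 3 * e 2))"
  proof -
    have "F 4 * F 20 * (e 3 * e 2) = e 6 * e 1" by (simp add: simps mult_ac)
    thus ?thesis using nz nz1 by (simp add: s field_simps)
  qed
  have s6: "s 6 = \<mu> 6 * (e 4 / e 2)"
  proof -
    have "F 6 * F 18 * e 2 = e 4" by (simp add: simps mult_ac)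
    thus ?thesis using nz by (simp add: s field_simps)
  qed
  have s8: "s 8 = \<mu> 8 * (e 3 / e 1)"
  proof -
    have "F 8 * F 16 * e 1 = e 3" by (simp add: simps mult_ac)
    thus ?thesis using nz nz1 by (simp add: s field_simps)
  qed
  have s12: "s 12 = \<mu> 12 * (e 2 / e 1) ^ 2"
  proof -
    have "F 12 * e 1 = e 2" by (simp add: simps mult_ac)
    hence "F 12 = e 2 / e 1" using nz by (simp add: eq_divide_eq)
    thus ?thesis by (simp add: s power2_eq_square)
  qed
  have mono1: "e1 ^ 4 * ((m4 * (e6 * e1 / (e3 * e2))) ^ 4 * (m8 * (e3 / e1)) * (m12 * (e2 / e1) ^ 2) ^ 4
      / (ma * (e24 * e4 / (e12 * e8)) * (mb * (e12 * e2 / (e6 * e4))) ^ 2 * (m6 * (e4 / e2)) ^ 3)) =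
     m4 ^ 4 * m8 * m12 ^ 4 / (ma * mb ^ 2 * m6 ^ 3) * (e6 ^ 6 * e2 ^ 5 * e8 / (e24 * e12 * e4 ^ 2 * e3 ^ 3 * e1))"
    if "e1 \<noteq> 0" "e2 \<noteq> 0" "e3 \<noteq> 0" "e4 \<noteq> 0" "e6 \<noteq> 0" "e8 \<noteq> 0" "e12 \<noteq> 0" "e24 \<noteq> 0"
       "ma \<noteq> 0" "mb \<noteq> 0" "m6 \<noteq> 0"
    for e1 e2 e3 e4 e6 e8 e12 e24 ma mb m4 m6 m8 m12 :: complex
    using that by (simp add: field_simps eval_nat_numeral)
  have mono2: "e1 ^ 4 * ((mb * (e12 * e2 / (e6 * e4))) ^ 3 * (m4 * (e6 * e1 / (e3 * e2))) ^ 2 * 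
       (m6 * (e4 / e2)) ^ 7 * (m8 * (e3 / e1)) * (m12 * (e2 / e1) ^ 2) ^ 2
      / ((ma * (e24 * e4 / (e12 * e8))) ^ 3 * (mc * (e8 / e4)) ^ 4)) =
     mb ^ 3 * m4 ^ 2 * m6 ^ 7 * m8 * m12 ^ 2 / (ma ^ 3 * mc ^ 4) *
     (e12 ^ 6 * e4 ^ 5 * e1 / (e24 ^ 3 * e8 * e6 * e3 * e2 ^ 2))"
    if "e1 \<noteq> 0" "e2 \<noteq> 0" "e3 \<noteq> 0" "e4 \<noteq> 0" "e6 \<noteq> 0" "e8 \<noteq> 0" "e12 \<noteq> 0" "e24 \<noteq> 0"
       "ma \<noteq> 0" "mc \<noteq> 0"
    for e1 e2 e3 e4 e6 e8 e12 e24 ma mb mc m4 m6 m8 m12 :: complex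
    using that by (simp add: field_simps eval_nat_numeral)
  show ?th1 unfolding a b s4 s6 s8 s12 using \<mu> by (intro mono1 nz) auto
  show ?th2 unfolding a b c s4 s6 s8 s12 using \<mu> by (intro mono2 nz) auto
qed

section \<open>Klein forms at torsion points\<close>

text \<open>The monomials \<open>q\<^sup>b\<^sup>/\<^sup>2\<close> with a phase \<open>exp (\<pi> \<i> a)\<close> in front; recording the two exponents avoids choosing
  branches of fractional powers of \<open>q\<close>.\<close>

definition cexp :: "complex \<Rightarrow> real \<Rightarrow> real \<Rightarrow> complex" where
  "cexp z a b = exp (pi * \<i> * (a + b * z))"

lemma cexp_mult: "cexp z a b * cexp z c d = cexp z (a + c) (b + d)"
  by (simp add: cexp_def exp_add[symmetric] algebra_simps)

lemma cexp_divide: "cexp z a b / cexp z c d = cexp z (a - c) (b - d)"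
  by (simp add: cexp_def exp_diff[symmetric] algebra_simps)

lemma cexp_power: "cexp z a b ^ n = cexp z (real n * a) (real n * b)"
  by (simp add: cexp_def exp_of_nat_mult[symmetric] algebra_simps)

lemma cexp_split: "cexp z a b = cis (pi * a) * cexp z 0 b"
  by (simp add: cexp_def cis_conv_exp exp_add[symmetric] algebra_simps)

text \<open>The constants \<open>torsion_const\<close>, \<open>torsion_arg\<close> and \<open>torsion_exponent\<close> describe the factor by which
  the Klein form at a torsion point differs from a product of two \<^term>\<open>torsion_poch\<close> values: a real
  constant, a phase, and twice the exponent of \<open>q\<close>.\<close>

definition torsion_const :: "nat \<Rightarrow> nat \<Rightarrow> nat \<Rightarrow> real" where
  "torsion_const M L k = (if k mod M = 0 then 2 * sin (pi * (real k / real L)) else 1)"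

definition torsion_arg :: "nat \<Rightarrow> nat \<Rightarrow> nat \<Rightarrow> real" where
  "torsion_arg M L k = (let c = real (k div M); j = real (k mod M) in
     if k mod M = 0 then c - c * (real k / real L) - 1 / 2
     else c + (j / real M - 1 - c) * (real k / real L))"

definition torsion_exponent :: "nat \<Rightarrow> nat \<Rightarrow> real" where
  "torsion_exponent M k = (let j = real (k mod M) in if k mod M = 0 then 0 else (j / real M - 1) * j)"

definition torsion_factor :: "complex \<Rightarrow> nat \<Rightarrow> nat \<Rightarrow> nat \<Rightarrow> complex" where
  "torsion_factor z M L k = cexp z (torsion_arg M L k) (torsion_exponent M k) * of_real (torsion_const M L k)"

lemma cis_torsion: "L > 0 \<Longrightarrow> cis (2 * pi * real (k mod L) / real L) = cis (2 * pi * (real k / real L))"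
proof -
  assume L: "L > 0"
  have "real k = real (k div L) * real L + real (k mod L)"
    by (metis div_mult_mod_eq of_nat_add of_nat_mult)
  hence "2 * pi * (real k / real L) = 2 * pi * real (k div L) + 2 * pi * real (k mod L) / real L"
    using L by (simp add: field_simps)
  thus ?thesis by (simp add: cis_mult[symmetric] cis_multiple_2pi)
qed

lemma one_minus_cis: "1 - cis (2 * pi * v) = - (2 * \<i>) * sin (pi * v) * cis (pi * v)"
proof -
  have "cis (2 * pi * v) = cis (pi * v) * cis (pi * v)" by (simp add: cis_mult mult.assoc)
  moreover have "1 = cis (pi * v) * cnj (cis (pi * v))" by (simp add: cis_cnj cis_mult)
  moreover have "cnj (cis (pi * v)) - cis (pi * v) = - (2 * \<i>) * sin (pi * v)"
    by (simp add: complex_eq_iff)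
  ultimately have "1 - cis (2 * pi * v) = cis (pi * v) * (cnj (cis (pi * v)) - cis (pi * v))"
    by (metis right_diff_distrib)
  thus ?thesis
    unfolding \<open>cnj (cis (pi * v)) - cis (pi * v) = - (2 * \<i>) * sin (pi * v)\<close> by (simp add: mult_ac)
qed

text \<open>Writing \<open>k = c M + j\<close> with \<open>j < M\<close>, translation by \<open>c\<close> periods reduces the first coordinate to
  \<open>j / M\<close>.  If \<open>j = 0\<close>, the theta function has the extra factor \<open>1 - exp (2 \<pi> \<i> v)\<close>, twice a sine
  up to a phase.\<close>

lemma klein_torsion_value:
  fixes M L k :: nat
  assumes z: "Im z > 0" and LM: "M * L = 24" and k: "0 < k" "k < 24"
  defines "q \<equiv> exp (2 * pi * \<i> * z)"
  shows "klein (of_nat M * z) (real k / real M) (real k / real L) =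
    torsion_factor z M L k * (torsion_poch q M L k * torsion_poch q M L (24 - k))"
proof -
  have pos: "M > 0" "L > 0" using LM by (auto intro: Nat.gr0I)
  have tau: "Im (of_nat M * z) > 0" using z pos by simp
  define c j v where "c = k div M" and "j = k mod M" and "v = real k / real L"
  have jM: "j < M" using pos by (simp add: j_def)
  have kM: "real k / real M = real j / real M + real c"
  proof -
    have "real k = real c * real M + real j" unfolding c_def j_def
      by (metis div_mult_mod_eq of_nat_add of_nat_mult)
    thus ?thesis using pos by (simp add: field_simps)
  qed
  have qM: "exp (2 * pi * \<i> * (of_nat M * z)) = q ^ M"
    by (simp add: q_def exp_of_nat_mult[symmetric] algebra_simps)
  have red: "klein (of_nat M * z) (real k / real M) v = cexp z (c - c * v) 0 * klein (of_nat M * z) (real j / real M) v"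
  proof -
    have "klein (of_nat M * z) (real j / real M + real c) (v + real 0) = 
       (-1) ^ c * exp (pi * \<i> * of_real (- real c * v)) * klein (of_nat M * z) (real j / real M) v"
      unfolding klein_add_lattice[OF tau] by simp
    moreover have "(-1) ^ c * exp (pi * \<i> * of_real (- real c * v)) = cexp z (c - c * v) 0"
    proof -
      have "(-1 :: complex) ^ c = exp (of_nat c * (pi * \<i>))"
        unfolding exp_of_nat_mult by (simp add: mult.commute)
      thus ?thesis by (simp add: cexp_def exp_add[symmetric] algebra_simps)
    qed
    ultimately show ?thesis using kM by simp
  qed
  have e1: "exp (2 * pi * \<i> * (of_real (real j / real M) * (of_nat M * z) + of_real v)) = cis (2 * pi * v) * q ^ j"
    using pos by (simp add: q_def exp_of_nat_mult[symmetric] cis_conv_exp exp_add[symmetric] algebra_simps)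
  have e2: "q ^ M / (cis (2 * pi * v) * q ^ j) = cis (- (2 * pi * v)) * q ^ (M - j)"
    using jM by (simp add: power_diff q_def cis_inverse[symmetric] field_simps)
  have theta: "klein (of_nat M * z) (real j / real M) v = cexp z ((j / M - 1) * v) ((j / M - 1) * j) *
     (qpoch (cis (2 * pi * v) * q ^ j) (q ^ M) * qpoch (cis (- (2 * pi * v)) * q ^ (M - j)) (q ^ M))"
  proof -
    have "exp (pi * \<i> * (of_real (real j / real M) - 1) * (of_real (real j / real M) * (of_nat M * z) + of_real v)) 
        = cexp z ((j / M - 1) * v) ((j / M - 1) * j)"
      using pos by (simp add: cexp_def algebra_simps add_divide_distrib)
    thus ?thesis unfolding klein_def qM e1 theta_def e2 by simp
  qed
  have neg: "cis (2 * pi * real ((24 - k) mod L) / real L) = cis (- (2 * pi * v))"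
  proof -
    have "real (24 - k) / real L = real M - v"
      using k LM pos by (simp add: v_def of_nat_diff field_simps flip: of_nat_mult)
    moreover have "cis (2 * pi * (real M - v)) = cis (- (2 * pi * v))"
    proof -
      have "2 * pi * (real M - v) = 2 * pi * real M + - (2 * pi * v)" by (simp add: algebra_simps)
      thus ?thesis by (simp only: cis_mult[symmetric]) (simp add: cis_multiple_2pi)
    qed
    ultimately show ?thesis by (simp only: cis_torsion[OF pos(2)])
  qed
  show ?thesis
  proof (cases "j = 0")
    case False
    have "(24 - k) mod M = M - j"
    proof -
      have eq: "24 - k = (M - j) + M * (L - 1 - c)"
      proof -
        have kk: "k = c * M + j" by (simp add: c_def j_def)
        have "c < L" unfolding c_def using k LM pos by (simp add: div_less_iff_less_mult mult.commute)
        then obtain d where d: "L = c + 1 + d" by (metis Suc_eq_plus1 add_Suc_right add.assoc less_iff_Suc_add add.commute)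
        have "24 = M * (c + 1 + d)" using LM d by simp
        thus ?thesis using kk jM d by (simp add: algebra_simps)
      qed
      show ?thesis unfolding eq mod_mult_self2 using jM False by (intro mod_less) simp
    qed
    hence "torsion_poch q M L (24 - k) = qpoch (cis (- (2 * pi * v)) * q ^ (M - j)) (q ^ M)"
      using jM neg by (simp add: torsion_poch_def)
    moreover have "torsion_poch q M L k = qpoch (cis (2 * pi * v) * q ^ j) (q ^ M)"
      using False pos cis_torsion[of L k] by (simp add: torsion_poch_def j_def v_def)
    ultimately show ?thesis
      using False red theta
      by (simp add: torsion_factor_def torsion_arg_def torsion_exponent_def torsion_const_def
        cexp_mult[symmetric] j_def[symmetric] c_def[symmetric] v_def[symmetric] Let_def)
        (simp add: cexp_mult algebra_simps)
  next
    case True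
    have qM1: "norm (q ^ M) < 1" using z pos by (simp add: q_def norm_power power_less_one_iff)
    have "M dvd 24" using LM by (metis dvd_triv_left)
    hence dvd: "M dvd 24 - k" "M dvd k" using True by (auto simp: j_def intro!: dvd_diff_nat)
    hence p1: "torsion_poch q M L (24 - k) = qpoch (cis (- (2 * pi * v)) * q ^ M) (q ^ M)"
      using neg by (simp add: torsion_poch_def)
    have p2: "torsion_poch q M L k = qpoch (cis (2 * pi * v) * q ^ M) (q ^ M)"
      using dvd pos cis_torsion[of L k] by (simp add: torsion_poch_def v_def)
    have p3: "qpoch (cis (2 * pi * v)) (q ^ M) = - (2 * \<i>) * sin (pi * v) * cis (pi * v) * qpoch (cis (2 * pi * v) * q ^ M) (q ^ M)"
      unfolding qpoch_unfold[OF qM1, of "cis (2 * pi * v)"] one_minus_cis ..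
    have p4: "cexp z (c - c * v) 0 * cexp z (- v) 0 * (- (2 * \<i>) * sin (pi * v) * cis (pi * v)) =
       cexp z (c - c * v - 1 / 2) 0 * of_real (2 * sin (pi * v))"
    proof -
      have cx: "cexp z a 0 = cis (pi * a)" for a by (simp add: cexp_def cis_conv_exp mult_ac)
      have v: "cis (pi * v) = cexp z v 0" and i: "- (2 * \<i>) = 2 * cexp z (- 1 / 2) 0" by (simp_all add: cx)
      have "cexp z (c - c * v) 0 * cexp z (- v) 0 * (- (2 * \<i>) * sin (pi * v) * cis (pi * v)) =
        cexp z (c - c * v) 0 * cexp z (- v) 0 * cexp z v 0 * cexp z (- 1 / 2) 0 * of_real (2 * sin (pi * v))"
        unfolding v i by (simp add: mult_ac)
      thus ?thesis by (simp add: cexp_mult)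
    qed
    have "klein (of_nat M * z) (real k / real M) v = cexp z (c - c * v) 0 * (cexp z (- v) 0 *
        (qpoch (cis (2 * pi * v)) (q ^ M) * qpoch (cis (- (2 * pi * v)) * q ^ M) (q ^ M)))"
      unfolding red theta using True by simp
    also have "\<dots> = cexp z (c - c * v) 0 * cexp z (- v) 0 * (- (2 * \<i>) * sin (pi * v) * cis (pi * v)) *
        (qpoch (cis (2 * pi * v) * q ^ M) (q ^ M) * qpoch (cis (- (2 * pi * v)) * q ^ M) (q ^ M))"
      unfolding p3 by (simp only: mult_ac)
    also have "\<dots> = torsion_factor z M L k * (torsion_poch q M L k * torsion_poch q M L (24 - k))"
      unfolding p4 p1 p2 using dvd
      by (simp add: torsion_factor_def torsion_arg_def torsion_exponent_def torsion_const_def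
        c_def[symmetric] v_def[symmetric] Let_def)
    finally show ?thesis unfolding v_def .
  qed
qed

section \<open>Sums of Weierstrass values as sums of two eta quotients\<close>

lemma torsion_poch_nonzero:
  assumes "norm q < 1" "M > 0"
  shows "torsion_poch q M L k \<noteq> 0"
proof
  have lt: "norm (q ^ M) < 1" using assms by (simp add: norm_power power_less_one_iff)
  define j where "j = (if k mod M = 0 then M else k mod M)"
  have j: "j > 0" using assms(2) by (auto simp: j_def)
  define c where "c = cis (2 * pi * real (k mod L) / real L)"
  assume "torsion_poch q M L k = 0"
  then obtain n where "c * q ^ j * (q ^ M) ^ n = 1"
    using qpoch_eq_0_iff[OF lt] by (auto simp: torsion_poch_def j_def c_def)
  hence "norm (c * q ^ j * (q ^ M) ^ n) = 1" by simp
  hence "norm q ^ (j + M * n) = 1"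
    by (simp add: norm_mult norm_power c_def power_add power_mult)
  moreover have "norm q ^ (j + M * n) < 1" using j assms(1) by (simp add: power_less_one_iff)
  ultimately show False by simp
qed

text \<open>The two monomials of \<open>elliptic_sequence_24_identity\<close>, named after the rows of the table whose eta
  quotients they produce for \<open>(M, L) = (24, 1)\<close>.\<close>

definition monomial2 :: "(nat \<Rightarrow> 'a :: field) \<Rightarrow> 'a" where
  "monomial2 s = s 4 ^ 4 * s 8 * s 12 ^ 4 / (s 1 * s 5 * s 7 * s 11 * (s 2 * s 10) ^ 2 * s 6 ^ 3)"

definition monomial5 :: "(nat \<Rightarrow> 'a :: field) \<Rightarrow> 'a" where
  "monomial5 s = (s 2 * s 10) ^ 3 * s 4 ^ 2 * s 6 ^ 7 * s 8 * s 12 ^ 2 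
       / ((s 1 * s 5 * s 7 * s 11) ^ 3 * (s 3 * s 9) ^ 4)"

text \<open>How the two monomials act on the exponents when their arguments are exponentials.\<close>

definition exponent_sum2 :: "(nat \<Rightarrow> real) \<Rightarrow> real" where
  "exponent_sum2 a = 4 * a 4 + a 8 + 4 * a 12 - a 1 - a 5 - a 7 - a 11 - 2 * a 2 - 2 * a 10 - 3 * a 6"

definition exponent_sum5 :: "(nat \<Rightarrow> real) \<Rightarrow> real" where
  "exponent_sum5 a = 3 * a 2 + 3 * a 10 + 2 * a 4 + 7 * a 6 + a 8 + 2 * a 12
     - 3 * a 1 - 3 * a 5 - 3 * a 7 - 3 * a 11 - 4 * a 3 - 4 * a 9"

lemma monomial_torsion_factor:
  "monomial2 (torsion_factor z M L) = cis (pi * exponent_sum2 (torsion_arg M L)) *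
     of_real (monomial2 (torsion_const M L)) * cexp z 0 (exponent_sum2 (torsion_exponent M))" (is ?th1)
  "monomial5 (torsion_factor z M L) = cis (pi * exponent_sum5 (torsion_arg M L)) *
     of_real (monomial5 (torsion_const M L)) * cexp z 0 (exponent_sum5 (torsion_exponent M))" (is ?th2)
proof -
  have mult: "(\<And>k. h k = f k * g k) \<Longrightarrow> monomial2 h = monomial2 f * monomial2 g"
             "(\<And>k. h k = f k * g k) \<Longrightarrow> monomial5 h = monomial5 f * monomial5 g"
    for f g h :: "nat \<Rightarrow> complex"
    by (simp_all add: monomial2_def monomial5_def power_mult_distrib mult_ac)
  have cx: "monomial2 (\<lambda>k. cexp z (a k) (b k)) = cexp z (exponent_sum2 a) (exponent_sum2 b)"
     "monomial5 (\<lambda>k. cexp z (a k) (b k)) = cexp z (exponent_sum5 a) (exponent_sum5 b)"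
     for a b :: "nat \<Rightarrow> real"
    unfolding monomial2_def monomial5_def exponent_sum2_def exponent_sum5_def
      cexp_mult cexp_power cexp_divide
    by (rule arg_cong2[of _ _ _ _ "cexp z"]; simp add: algebra_simps)+
  have rl: "monomial2 (\<lambda>k. of_real (c k) :: complex) = of_real (monomial2 c)"
           "monomial5 (\<lambda>k. of_real (c k) :: complex) = of_real (monomial5 c)" for c
    by (simp_all add: monomial2_def monomial5_def)
  show ?th1
    unfolding mult(1)[of "torsion_factor z M L", OF torsion_factor_def] cx rl
    by (subst cexp_split) (simp only: mult_ac)
  show ?th2
    unfolding mult(2)[of "torsion_factor z M L", OF torsion_factor_def] cx rl
    by (subst cexp_split) (simp only: mult_ac)
qed

lemma wp_torsion_sum:
  fixes M L :: nat
  assumes z: "Im z > 0" and LM: "M * L = 24" "coprime M L"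
  defines "q \<equiv> exp (2 * pi * \<i> * z)"
  defines "X \<equiv> \<lambda>k. wp (cis (2 * pi * (real k / real L)) * q ^ k) (q ^ M)"
  defines "e \<equiv> subgroup_prod (torsion_poch q M L)"
  assumes e1: "e 1 = epoch q M"
  shows "2 * (X 1 + X 5 - X 7 - X 11) =
     monomial2 (torsion_factor z M L) * (e 6 ^ 6 * e 2 ^ 5 * e 8 / (e 24 * e 12 * e 4 ^ 2 * e 3 ^ 3 * e 1)) +
     monomial5 (torsion_factor z M L) * (e 12 ^ 6 * e 4 ^ 5 * e 1 / (e 24 ^ 3 * e 8 * e 6 * e 3 * e 2 ^ 2))"
proof -
  have pos: "M > 0" "L > 0" using LM by (auto intro: Nat.gr0I)
  have tau: "Im (of_nat M * z) > 0" using z pos by simp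
  have q: "norm q < 1" using z by (simp add: q_def)
  define s where "s = (\<lambda>k :: nat. klein (of_nat M * z) (real k / real M) (real k / real L))"
  have s: "s k = torsion_factor z M L k * (torsion_poch q M L k * torsion_poch q M L (24 - k))"
    if "k \<in> {1..12}" for k
    using klein_torsion_value[OF z LM(1), of k] that unfolding s_def q_def by simp
  have tf: "torsion_factor z M L k \<noteq> 0" if "k \<in> {1..12}" for k
  proof -
    have "\<not> (real k / real M \<in> \<int> \<and> real k / real L \<in> \<int>)"
      using torsion_not_integral[OF LM, of "int k"] that by simp
    hence "s k \<noteq> 0" unfolding s_def by (rule klein_nonzero[OF tau])
    thus ?thesis using s[OF that] by auto
  qed
  have qM: "exp (2 * pi * \<i> * (of_nat M * z)) = q ^ M"
    by (simp add: q_def exp_of_nat_mult[symmetric] algebra_simps)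
  have Xk: "wp (exp (2 * pi * \<i> * (real k / real M * (of_nat M * z) + real k / real L))) (q ^ M) = X k" for k
    unfolding X_def using pos
    by (simp add: q_def cis_conv_exp exp_of_nat_mult[symmetric] exp_add[symmetric] algebra_simps)
  have "2 * (X 1 + X 5 - X 7 - X 11) = epoch q M ^ 4 * (monomial2 s + monomial5 s)"
    using wp_24_torsion_identity[OF tau LM]
    unfolding qM Xk by (simp add: s_def monomial2_def monomial5_def epoch_def)
  also have "\<dots> = e 1 ^ 4 * monomial2 s + e 1 ^ 4 * monomial5 s"
    unfolding e1 by (rule distrib_left)
  also have "e 1 ^ 4 * monomial2 s = monomial2 (torsion_factor z M L) * (e 6 ^ 6 * e 2 ^ 5 * e 8 / (e 24 * e 12 * e 4 ^ 2 * e 3 ^ 3 * e 1))"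
    unfolding monomial2_def e_def
    by (rule torsion_product_monomials(1)[where F = "torsion_poch q M L" and s = s and \<mu> = "torsion_factor z M L",
          OF torsion_poch_nonzero[OF q pos(1)] tf s])
  also have "e 1 ^ 4 * monomial5 s = monomial5 (torsion_factor z M L) * (e 12 ^ 6 * e 4 ^ 5 * e 1 / (e 24 ^ 3 * e 8 * e 6 * e 3 * e 2 ^ 2))"
    unfolding monomial5_def e_def
    by (rule torsion_product_monomials(2)[where F = "torsion_poch q M L" and s = s and \<mu> = "torsion_factor z M L",
          OF torsion_poch_nonzero[OF q pos(1)] tf s])
  finally show ?thesis .
qed

section \<open>The four torsion points\<close>

text \<open>The eta quotients of rows 2, 5, 7 and 8 of the table.\<close>

definition row2_quotient :: "complex \<Rightarrow> complex" where
  "row2_quotient z = (let e = epoch (exp (2 * pi * \<i> * z)) in cexp z 0 2 *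
     (e 4 ^ 6 * e 12 ^ 5 * e 3 / (e 1 * e 2 * e 6 ^ 2 * e 8 ^ 3 * e 24)))"

definition row5_quotient :: "complex \<Rightarrow> complex" where
  "row5_quotient z = (let e = epoch (exp (2 * pi * \<i> * z)) in cexp z 0 2 *
     (e 2 ^ 6 * e 6 ^ 5 * e 24 / (e 1 ^ 3 * e 3 * e 4 * e 8 * e 12 ^ 2)))"

definition row7_quotient :: "complex \<Rightarrow> complex" where
  "row7_quotient z = (let e = epoch (exp (2 * pi * \<i> * z)) in 
     (e 12 ^ 6 * e 4 ^ 5 * e 1 / (e 24 ^ 3 * e 8 * e 6 * e 3 * e 2 ^ 2)))"

definition row8_quotient :: "complex \<Rightarrow> complex" where
  "row8_quotient z = (let e = epoch (exp (2 * pi * \<i> * z)) in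
     (e 6 ^ 6 * e 2 ^ 5 * e 8 / (e 24 * e 12 * e 4 ^ 2 * e 3 ^ 3 * e 1)))"

lemma half_sin_double: "sin a * cos a = sin (2 * a) / (2 :: real)"
  by (simp add: sin_double)

lemma sin_products:
  "sin (pi / 24) * sin (11 * pi / 24) = sin (pi / 12) / 2"
  "sin (5 * pi / 24) * sin (7 * pi / 24) = sin (5 * pi / 12) / 2"
  "sin (pi / 12) * sin (5 * pi / 12) = 1 / 4"
  "sin (pi / 8) * sin (3 * pi / 8) = sqrt 2 / 4"
proof -
  have co: "sin (11 * pi / 24) = cos (pi / 24)" "sin (7 * pi / 24) = cos (5 * pi / 24)"
    "sin (5 * pi / 12) = cos (pi / 12)" "sin (3 * pi / 8) = cos (pi / 8)"
    unfolding sin_cos_eq by (rule arg_cong[of _ _ cos]; simp)+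
  have d: "2 * (pi / 24) = pi / 12" "2 * (5 * pi / 24) = 5 * pi / 12" "2 * (pi / 12) = pi / 6"
    "2 * (pi / 8) = pi / 4" by simp_all
  show "sin (pi / 24) * sin (11 * pi / 24) = sin (pi / 12) / 2"
    unfolding co half_sin_double d ..
  show "sin (5 * pi / 24) * sin (7 * pi / 24) = sin (5 * pi / 12) / 2"
    unfolding co(2) half_sin_double d ..
  show "sin (pi / 12) * sin (5 * pi / 12) = 1 / 4"
    unfolding co half_sin_double d by (simp add: sin_30)
  show "sin (pi / 8) * sin (3 * pi / 8) = sqrt 2 / 4"
    unfolding co half_sin_double d by (simp add: sin_45)
qed

lemma torsion_const_1_24:
  defines "c \<equiv> torsion_const 1 24"
  shows "c 1 * c 5 * c 7 * c 11 = 1" "c 2 * c 10 = 1" "c 3 * c 9 = sqrt 2" "c 4 = 1" "c 6 = sqrt 2"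
    "c 8 = sqrt 3" "c 12 = 2"
proof -
  have c: "c k = 2 * sin (real k * pi / 24)" for k by (simp add: c_def torsion_const_def mult.commute)
  have "c 1 * c 5 * c 7 * c 11 = 16 * ((sin (pi / 24) * sin (11 * pi / 24)) * (sin (5 * pi / 24) * sin (7 * pi / 24)))"
    by (simp add: c)
  also have "\<dots> = 4 * (sin (pi / 12) * sin (5 * pi / 12))"
    unfolding sin_products(1,2) by simp
  finally show "c 1 * c 5 * c 7 * c 11 = 1" unfolding sin_products(3) by simp
  have r: "2 * pi / 24 = pi / 12" "10 * pi / 24 = 5 * pi / 12" "3 * pi / 24 = pi / 8" "9 * pi / 24 = 3 * pi / 8"
    "4 * pi / 24 = pi / 6" "6 * pi / 24 = pi / 4" "8 * pi / 24 = pi / 3" "12 * pi / 24 = pi / 2" by simp_all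
  show "c 2 * c 10 = 1" "c 3 * c 9 = sqrt 2" "c 4 = 1" "c 6 = sqrt 2" "c 8 = sqrt 3" "c 12 = 2"
    using sin_products(3,4) unfolding c of_nat_numeral r by (simp_all add: sin_30 sin_45 sin_60)
qed

lemma torsion_const_3_8:
  defines "c \<equiv> torsion_const 3 8"
  shows "c 3 * c 9 = - sqrt 2" "c 6 = sqrt 2" "c 12 = -2"
    "c 1 = 1" "c 2 = 1" "c 4 = 1" "c 5 = 1" "c 7 = 1" "c 8 = 1" "c 10 = 1" "c 11 = 1"
proof -
  have r: "pi * (6 / 8) = pi / 2 + pi / 4" "pi * (9 / 8) = pi + pi / 8" "pi * (12 / 8) = pi + pi / 2" "pi * (3 / 8) = 3 * pi / 8"
    by simp_all
  have s: "sin (pi * (6 / 8)) = sqrt 2 / 2" "sin (pi * (9 / 8)) = - sin (pi / 8)" "sin (pi * (12 / 8)) = -1"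
    "sin (pi * (3 / 8)) = sin (3 * pi / 8)"
    unfolding r by (simp_all only: sin_add) (simp_all add: cos_45)
  have "c 3 = 2 * sin (pi * (3 / 8))" "c 9 = 2 * sin (pi * (9 / 8))"
    "c 6 = 2 * sin (pi * (6 / 8))" "c 12 = 2 * sin (pi * (12 / 8))"
    unfolding c_def torsion_const_def by (simp_all only: of_nat_numeral, simp_all)
  thus "c 3 * c 9 = - sqrt 2" "c 6 = sqrt 2" "c 12 = -2"
    unfolding s using sin_products(4) by (simp_all add: mult.commute)
qed (simp_all add: c_def torsion_const_def)

lemma torsion_const_8_3: "torsion_const 8 3 8 = sqrt 3"
proof -
  have "pi * (8 / 3) = 2 * pi / 3 + 2 * pi" by simp
  hence "sin (pi * (8 / 3)) = sin (2 * pi / 3)" by (simp only: sin_periodic)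
  also have "\<dots> = sin (pi - pi / 3)" by (rule arg_cong[of _ _ sin]) simp
  also have "\<dots> = sqrt 3 / 2" unfolding sin_pi_minus by (rule sin_60)
  finally show ?thesis by (simp add: torsion_const_def del: times_divide_eq_right)
qed

lemma sqrt_power_values: "sqrt 2 ^ 3 = 2 * sqrt 2" "sqrt 2 ^ 4 = 4" "sqrt 2 ^ 7 = 8 * sqrt 2"
proof -
  have "sqrt 2 ^ 2 = (2 :: real)" by simp
  thus "sqrt 2 ^ 3 = 2 * sqrt 2" "sqrt 2 ^ 4 = 4" "sqrt 2 ^ 7 = 8 * sqrt 2"
    by (simp_all add: eval_nat_numeral)
qed

lemma cis_values: "cis (pi * 2) = 1" "cis (- pi) = -1" "cis (pi * -1) = -1"
  "cis (pi * (- 9 / 2)) = - \<i>" "cis (pi * (- 3 / 2)) = \<i>" "cis (pi * (- 13 / 2)) = - \<i>" "cis (pi * (13 / 2)) = \<i>"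
proof -
  have *: "cis (2 * pi * of_int n + x) = cis x" for n x by (simp add: cis_mult[symmetric] cis_multiple_2pi)
  show "cis (pi * 2) = 1" using cis_2pi by (simp only: mult.commute)
  show "cis (- pi) = -1" "cis (pi * -1) = -1" by (simp_all add: complex_eq_iff)
  have r: "pi * (- 9 / 2) = 2 * pi * of_int (-2) + - (pi / 2)" "pi * (- 3 / 2) = 2 * pi * of_int (-1) + pi / 2"
    "pi * (- 13 / 2) = 2 * pi * of_int (-3) + - (pi / 2)" "pi * (13 / 2) = 2 * pi * of_int 3 + pi / 2"
    by simp_all
  show "cis (pi * (- 9 / 2)) = - \<i>" "cis (pi * (- 3 / 2)) = \<i>" "cis (pi * (- 13 / 2)) = - \<i>" "cis (pi * (13 / 2)) = \<i>"
    unfolding r * by simp_all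
qed

lemma monomial_torsion_factor_values:
  "monomial2 (torsion_factor z 24 1) = cexp z 0 2"
  "monomial5 (torsion_factor z 24 1) = cexp z 0 2"
  "monomial2 (torsion_factor z 1 24) = - (4 * of_real (sqrt 6))"
  "monomial5 (torsion_factor z 1 24) = - (8 * of_real (sqrt 6))"
  "monomial2 (torsion_factor z 3 8) = - (4 * \<i> * of_real (sqrt 2)) * cexp z 0 2"
  "monomial5 (torsion_factor z 3 8) = 8 * \<i> * of_real (sqrt 2) * cexp z 0 2"
  "monomial2 (torsion_factor z 8 3) = - (\<i> * of_real (sqrt 3))"
  "monomial5 (torsion_factor z 8 3) = \<i> * of_real (sqrt 3)"
proof -
  have k1: "monomial2 (torsion_const 24 1) = 1" "monomial5 (torsion_const 24 1) = 1"
    by (simp_all add: monomial2_def monomial5_def torsion_const_def)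
  have s6: "sqrt 6 = sqrt 2 * sqrt 3" by (simp flip: real_sqrt_mult)
  have k2: "monomial2 (torsion_const 1 24) = 4 * sqrt 6" "monomial5 (torsion_const 1 24) = 8 * sqrt 6"
    unfolding monomial2_def monomial5_def torsion_const_1_24 sqrt_power_values s6 by (simp_all add: field_simps)
  have k3: "monomial2 (torsion_const 3 8) = 4 * sqrt 2" "monomial5 (torsion_const 3 8) = 8 * sqrt 2"
    unfolding monomial2_def monomial5_def torsion_const_3_8 sqrt_power_values
    by (simp_all add: sqrt_power_values field_simps)
  have c4: "torsion_const 8 3 k = 1" if "k \<in> {1..7} \<union> {9..12}" for k
  proof -
    have "k \<in> {1, 2, 3, 4, 5, 6, 7, 9, 10, 11, 12}" using that by auto
    thus ?thesis by (auto simp: torsion_const_def)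
  qed
  have k4: "monomial2 (torsion_const 8 3) = sqrt 3" "monomial5 (torsion_const 8 3) = sqrt 3"
    by (simp_all add: monomial2_def monomial5_def c4[simplified] torsion_const_8_3)
  note simps = torsion_arg_def torsion_exponent_def exponent_sum2_def exponent_sum5_def Let_def
  have args: "exponent_sum2 (torsion_arg 24 1) = 2" "exponent_sum5 (torsion_arg 24 1) = 2"
    "exponent_sum2 (torsion_arg 1 24) = -1" "exponent_sum5 (torsion_arg 1 24) = -1"
    "exponent_sum2 (torsion_arg 3 8) = - 9 / 2" "exponent_sum5 (torsion_arg 3 8) = - 3 / 2"
    "exponent_sum2 (torsion_arg 8 3) = - 13 / 2" "exponent_sum5 (torsion_arg 8 3) = 13 / 2"
    by (simp_all add: simps)
  have exps: "exponent_sum2 (torsion_exponent 24) = 2" "exponent_sum5 (torsion_exponent 24) = 2"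
    "exponent_sum2 (torsion_exponent 1) = 0" "exponent_sum5 (torsion_exponent 1) = 0"
    "exponent_sum2 (torsion_exponent 3) = 2" "exponent_sum5 (torsion_exponent 3) = 2"
    "exponent_sum2 (torsion_exponent 8) = 0" "exponent_sum5 (torsion_exponent 8) = 0"
    by (simp_all add: simps)
  have cx0: "cexp z 0 0 = 1" by (simp add: cexp_def)
  note vals = monomial_torsion_factor args exps k1 k2 k3 k4 cis_values cx0
  show "monomial2 (torsion_factor z 24 1) = cexp z 0 2" "monomial5 (torsion_factor z 24 1) = cexp z 0 2"
    "monomial2 (torsion_factor z 1 24) = - (4 * of_real (sqrt 6))"
    "monomial5 (torsion_factor z 1 24) = - (8 * of_real (sqrt 6))"
    "monomial2 (torsion_factor z 3 8) = - (4 * \<i> * of_real (sqrt 2)) * cexp z 0 2"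
    "monomial5 (torsion_factor z 3 8) = 8 * \<i> * of_real (sqrt 2) * cexp z 0 2"
    "monomial2 (torsion_factor z 8 3) = - (\<i> * of_real (sqrt 3))"
    "monomial5 (torsion_factor z 8 3) = \<i> * of_real (sqrt 3)"
    unfolding vals by simp_all
qed

text \<open>Passing from one of the four torsion points to another permutes the orders of the Euler products, so the
  two monomials always come out as two of the four eta quotients.\<close>

lemma torsion_sums:
  assumes z: "Im z > 0"
  defines "q \<equiv> exp (2 * pi * \<i> * z)"
  defines "X \<equiv> \<lambda>M L k. wp (cis (2 * pi * (real k / real L)) * q ^ k) (q ^ M)"
  shows "2 * (X 24 1 1 + X 24 1 5 - X 24 1 7 - X 24 1 11) = row2_quotient z + row5_quotient z"
    and "2 * (X 1 24 1 + X 1 24 5 - X 1 24 7 - X 1 24 11) = - (4 * of_real (sqrt 6)) * (row8_quotient z + 2 * row7_quotient z)"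
    and "2 * (X 3 8 1 + X 3 8 5 - X 3 8 7 - X 3 8 11) = 4 * \<i> * of_real (sqrt 2) * (2 * row2_quotient z - row5_quotient z)"
    and "2 * (X 8 3 1 + X 8 3 5 - X 8 3 7 - X 8 3 11) = \<i> * of_real (sqrt 3) * (row8_quotient z - row7_quotient z)"
proof -
  have q: "norm q < 1" using z by (simp add: q_def)
  note gcds = gcd_non_0_nat
  have sub1: "\<forall>n\<in>{1, 2, 3, 4, 6, 8, 12, 24}. subgroup_prod (torsion_poch q 24 1) n = epoch q (24 div n)"
    using torsion_poch_subgroup[OF q, of "(24, 1)"] by (simp add: gcds)
  have sub2: "\<forall>n\<in>{1, 2, 3, 4, 6, 8, 12, 24}. subgroup_prod (torsion_poch q 1 24) n = epoch q n"
    using torsion_poch_subgroup[OF q, of "(1, 24)"] by (simp add: gcds)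
  have sub3: "\<forall>n\<in>{1, 2, 3, 4, 6, 8, 12, 24}. subgroup_prod (torsion_poch q 3 8) n = 
                epoch q (gcd n 8 * (3 div gcd n 3))"
    using torsion_poch_subgroup[OF q, of "(3, 8)"] by simp
  have sub4: "\<forall>n\<in>{1, 2, 3, 4, 6, 8, 12, 24}. subgroup_prod (torsion_poch q 8 3) n = 
                epoch q (gcd n 3 * (8 div gcd n 8))"
    using torsion_poch_subgroup[OF q, of "(8, 3)"] by simp
  note wts = wp_torsion_sum[OF z, folded q_def]
  note quot = row2_quotient_def row5_quotient_def row7_quotient_def row8_quotient_def q_def[symmetric] Let_def
  have s1: "subgroup_prod (torsion_poch q 24 1) n = epoch q (24 div n)" 
       and s2: "subgroup_prod (torsion_poch q 1 24) n = epoch q n"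
       and s3: "subgroup_prod (torsion_poch q 3 8) n = epoch q (gcd n 8 * (3 div gcd n 3))"
       and s4: "subgroup_prod (torsion_poch q 8 3) n = epoch q (gcd n 3 * (8 div gcd n 8))"
       if "n \<in> {1, 2, 3, 4, 6, 8, 12, 24}" for n
    using that sub1 sub2 sub3 sub4 by blast+
  have co: "coprime (24 :: nat) 1" "coprime (1 :: nat) 24" "coprime (3 :: nat) 8" "coprime (8 :: nat) 3"
    by (simp_all add: coprime_iff_gcd_eq_1 gcds)
  have e1: "subgroup_prod (torsion_poch q 24 1) 1 = epoch q 24" "subgroup_prod (torsion_poch q 1 24) 1 = epoch q 1"
    "subgroup_prod (torsion_poch q 3 8) 1 = epoch q 3" "subgroup_prod (torsion_poch q 8 3) 1 = epoch q 8"
    by (subst s1 s2 s3 s4; simp)+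
  have g3: "gcd (1 :: nat) 8 * (3 div gcd 1 3) = 3"
    "gcd (2 :: nat) 8 * (3 div gcd 2 3) = 6"
    "gcd (3 :: nat) 8 * (3 div gcd 3 3) = 1"
    "gcd (4 :: nat) 8 * (3 div gcd 4 3) = 12"
    "gcd (6 :: nat) 8 * (3 div gcd 6 3) = 2"
    "gcd (8 :: nat) 8 * (3 div gcd 8 3) = 24"
    "gcd (12 :: nat) 8 * (3 div gcd 12 3) = 4"
    "gcd (24 :: nat) 8 * (3 div gcd 24 3) = 8"
    by (simp_all add: gcds)
  have g4: "gcd (1 :: nat) 3 * (8 div gcd 1 8) = 8"
    "gcd (2 :: nat) 3 * (8 div gcd 2 8) = 4"
    "gcd (3 :: nat) 3 * (8 div gcd 3 8) = 24"
    "gcd (4 :: nat) 3 * (8 div gcd 4 8) = 2"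
    "gcd (6 :: nat) 3 * (8 div gcd 6 8) = 12"
    "gcd (8 :: nat) 3 * (8 div gcd 8 8) = 1"
    "gcd (12 :: nat) 3 * (8 div gcd 12 8) = 6"
    "gcd (24 :: nat) 3 * (8 div gcd 24 8) = 3"
    by (simp_all add: gcds)
  let ?e2 = "\<lambda>e :: nat \<Rightarrow> complex. e 6 ^ 6 * e 2 ^ 5 * e 8 / (e 24 * e 12 * e 4 ^ 2 * e 3 ^ 3 * e 1)"
  let ?e5 = "\<lambda>e :: nat \<Rightarrow> complex. e 12 ^ 6 * e 4 ^ 5 * e 1 / (e 24 ^ 3 * e 8 * e 6 * e 3 * e 2 ^ 2)"
  have r1: "?e2 (subgroup_prod (torsion_poch q 24 1)) = ?e2 (\<lambda>n. epoch q (24 div n))"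
           "?e5 (subgroup_prod (torsion_poch q 24 1)) = ?e5 (\<lambda>n. epoch q (24 div n))"
    by (simp_all only: s1 insert_iff refl simp_thms)
  have r2: "?e2 (subgroup_prod (torsion_poch q 1 24)) = ?e2 (epoch q)"
           "?e5 (subgroup_prod (torsion_poch q 1 24)) = ?e5 (epoch q)"
    by (simp_all only: s2 insert_iff refl simp_thms)
  have r3: "?e2 (subgroup_prod (torsion_poch q 3 8)) = ?e2 (\<lambda>n. epoch q (gcd n 8 * (3 div gcd n 3)))"
           "?e5 (subgroup_prod (torsion_poch q 3 8)) = ?e5 (\<lambda>n. epoch q (gcd n 8 * (3 div gcd n 3)))"
    by (simp_all only: s3 insert_iff refl simp_thms)
  have r4: "?e2 (subgroup_prod (torsion_poch q 8 3)) = ?e2 (\<lambda>n. epoch q (gcd n 3 * (8 div gcd n 8)))"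
           "?e5 (subgroup_prod (torsion_poch q 8 3)) = ?e5 (\<lambda>n. epoch q (gcd n 3 * (8 div gcd n 8)))"
    by (simp_all only: s4 insert_iff refl simp_thms)
  have "2 * (X 24 1 1 + X 24 1 5 - X 24 1 7 - X 24 1 11) = 
      cexp z 0 2 * ?e2 (\<lambda>n. epoch q (24 div n)) + cexp z 0 2 * ?e5 (\<lambda>n. epoch q (24 div n))"
    using wts[of 24 1, OF _ co(1) e1(1)] unfolding monomial_torsion_factor_values r1 X_def by simp
  thus "2 * (X 24 1 1 + X 24 1 5 - X 24 1 7 - X 24 1 11) = row2_quotient z + row5_quotient z"
    unfolding quot by (simp add: mult_ac)
  have "2 * (X 1 24 1 + X 1 24 5 - X 1 24 7 - X 1 24 11) = 
      - (4 * of_real (sqrt 6)) * ?e2 (epoch q) + - (8 * of_real (sqrt 6)) * ?e5 (epoch q)"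
    using wts[of 1 24, OF _ co(2) e1(2)] unfolding monomial_torsion_factor_values r2 X_def by simp
  thus "2 * (X 1 24 1 + X 1 24 5 - X 1 24 7 - X 1 24 11) = - (4 * of_real (sqrt 6)) * (row8_quotient z + 2 * row7_quotient z)"
    unfolding quot by (simp add: algebra_simps)
  have "2 * (X 3 8 1 + X 3 8 5 - X 3 8 7 - X 3 8 11) = 
      - (4 * \<i> * of_real (sqrt 2)) * cexp z 0 2 * ?e2 (\<lambda>n. epoch q (gcd n 8 * (3 div gcd n 3))) + 
      8 * \<i> * of_real (sqrt 2) * cexp z 0 2 * ?e5 (\<lambda>n. epoch q (gcd n 8 * (3 div gcd n 3)))"
    using wts[of 3 8, OF _ co(3) e1(3)] unfolding monomial_torsion_factor_values r3 X_def by simp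
  thus "2 * (X 3 8 1 + X 3 8 5 - X 3 8 7 - X 3 8 11) = 4 * \<i> * of_real (sqrt 2) * (2 * row2_quotient z - row5_quotient z)"
    unfolding quot g3 by (simp add: algebra_simps)
  have "2 * (X 8 3 1 + X 8 3 5 - X 8 3 7 - X 8 3 11) = 
      - (\<i> * of_real (sqrt 3)) * ?e2 (\<lambda>n. epoch q (gcd n 3 * (8 div gcd n 8))) + 
      \<i> * of_real (sqrt 3) * ?e5 (\<lambda>n. epoch q (gcd n 3 * (8 div gcd n 8)))"
    using wts[of 8 3, OF _ co(4) e1(4)] unfolding monomial_torsion_factor_values r4 X_def by simp
  thus "2 * (X 8 3 1 + X 8 3 5 - X 8 3 7 - X 8 3 11) = \<i> * of_real (sqrt 3) * (row8_quotient z - row7_quotient z)"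
    unfolding quot g4 by (simp add: algebra_simps)
qed

section \<open>Values of the Kronecker symbols\<close>

lemma kronecker_mult:
  assumes "m > 0" "n > 0"
  shows "kronecker a (m * n) = kronecker a m * kronecker a n"
proof -
  let ?f = "\<lambda>p n. kronecker_prime a p ^ multiplicity p n"
  let ?P = "prime_factors m \<union> prime_factors n"
  have ext: "(\<Prod>p\<in>prime_factors k. ?f p k) = (\<Prod>p\<in>?P. ?f p k)" if "k \<in> {m, n}" for k
    by (rule prod.mono_neutral_left)
       (use that assms in \<open>auto simp: in_prime_factors_iff not_dvd_imp_multiplicity_0\<close>)
  have "(\<Prod>p\<in>prime_factors (m * n). ?f p (m * n)) = (\<Prod>p\<in>?P. ?f p m * ?f p n)"
    using assms
    by (intro prod.cong) (auto simp: prime_factors_product prime_elem_multiplicity_mult_distrib power_add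
         in_prime_factors_iff)
  thus ?thesis
    using assms ext[of m] ext[of n] by (simp add: kronecker_def prod.distrib)
qed

lemma kronecker_prime_eq: "prime p \<Longrightarrow> kronecker a p = kronecker_prime a p"
  by (auto simp: kronecker_def prime_factorization_prime)

lemma kronecker_1: "kronecker a (Suc 0) = 1"
  by (simp add: kronecker_def)

text \<open>Complete multiplicativity on both sides reduces the comparison to primes.\<close>

lemma kronecker_eqI:
  assumes "n > 0" and f1: "f 1 = 1" and mult: "\<And>m n. m > 0 \<Longrightarrow> n > 0 \<Longrightarrow> f (m * n) = f m * f n"
    and prime: "\<And>p. prime p \<Longrightarrow> kronecker_prime a p = f p"
  shows "kronecker a n = f n"
  using assms(1)
proof (induction n rule: less_induct)
  case (less n)
  show ?case
  proof (cases "n = 1")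
    case False
    then obtain p where p: "prime p" "p dvd n" using prime_factor_nat by blast
    then obtain m where m: "n = p * m" by auto
    have "m > 0" using less.prems m by auto
    moreover have "m < n" using m \<open>m > 0\<close> prime_gt_1_nat[OF p(1)] by simp
    ultimately show ?thesis
      using less.IH[of m] p prime_gt_0_nat[OF p(1)]
      by (simp add: m kronecker_mult kronecker_prime_eq mult prime)
  qed (use f1 in \<open>simp add: kronecker_1\<close>)
qed

text \<open>A congruence between numbers of absolute value at most 1 is an equality, since \<open>p > 2\<close>.\<close>

lemma Legendre_eqI:
  assumes "2 < p" "[Legendre a (int p) = c] (mod int p)" "c \<in> {-1, 0, 1}"
  shows "Legendre a (int p) = c"
proof -
  have dvd: "int p dvd Legendre a p - c" using assms(2) by (simp add: cong_iff_dvd_diff)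
  have le: "\<bar>Legendre a p - c\<bar> \<le> 2" using assms(3) by (auto simp: Legendre_def)
  show ?thesis
  proof (rule ccontr)
    assume "Legendre a (int p) \<noteq> c"
    hence "int p \<le> \<bar>Legendre a p - c\<bar>" using dvd by (intro zdvd_imp_le) auto
    thus False using le assms(1) by linarith
  qed
qed

lemma Legendre_mult:
  assumes "prime p" "2 < p"
  shows "Legendre (a * b) (int p) = Legendre a p * Legendre b p"
proof (rule Legendre_eqI[OF assms(2)])
  have "[Legendre (a * b) p = (a * b) ^ ((p - 1) div 2)] (mod p)" using assms by (rule euler_criterion)
  moreover have "[Legendre a p * Legendre b p = a ^ ((p - 1) div 2) * b ^ ((p - 1) div 2)] (mod p)"
    by (intro cong_mult euler_criterion assms)
  ultimately show "[Legendre (a * b) p = Legendre a p * Legendre b p] (mod p)"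
    by (metis cong_sym cong_trans power_mult_distrib)
qed (auto simp: Legendre_def)

lemma Legendre_cong: "a mod p = b mod p \<Longrightarrow> Legendre a p = Legendre b p"
  unfolding Legendre_def QuadRes_def cong_def by simp

lemma Legendre_minus_one:
  assumes "prime p" "2 < p"
  shows "Legendre (-1) (int p) = (if p mod 4 = 1 then 1 else -1)"
proof (rule Legendre_eqI[OF assms(2)])
  have "odd p" using assms primes_dvd_imp_eq[of 2 p] by auto
  hence "even ((p - 1) div 2) \<longleftrightarrow> p mod 4 = 1" by presburger
  hence "(-1 :: int) ^ ((p - 1) div 2) = (if p mod 4 = 1 then 1 else -1)" by simp
  thus "[Legendre (-1) (int p) = (if p mod 4 = 1 then 1 else -1)] (mod int p)"
    using euler_criterion[OF assms, of "-1"] by simp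
qed auto

text \<open>Gauss's lemma: the doubles of \<open>1, \<dots>, (p - 1) / 2\<close> are already reduced, so it only
  remains to count those exceeding \<open>(p - 1) / 2\<close>.\<close>

lemma Legendre_2:
  assumes "prime p" "2 < p"
  shows "Legendre 2 (int p) = (if p mod 8 \<in> {1, 7} then 1 else -1)"
proof -
  have odd: "odd p" using assms primes_dvd_imp_eq[of 2 p] by auto
  interpret GAUSS p 2
    using assms by unfold_locales (auto simp: cong_def)
  define h where "h = (int p - 1) div 2"
  have h: "int p = 2 * h + 1" "h \<ge> 1" using odd assms unfolding h_def by presburger+
  have "C = (\<lambda>x. x * 2) ` A"
    unfolding C_def B_def image_image using h by (intro image_cong) (auto simp: A_def h_def[symmetric])
  hence "E = (\<lambda>x. x * 2) ` {h div 2<..h}"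
    using h unfolding E_def A_def h_def[symmetric] by (auto simp: image_iff)
  hence "card E = nat (h - h div 2)" by (simp add: card_image inj_on_def)
  moreover have "even (nat (h - h div 2)) \<longleftrightarrow> p mod 8 \<in> {1, 7}"
  proof -
    have "h mod 4 = 0 \<or> h mod 4 = 1 \<or> h mod 4 = 2 \<or> h mod 4 = 3" by presburger
    then obtain k where "h = 4 * k \<or> h = 4 * k + 1 \<or> h = 4 * k + 2 \<or> h = 4 * k + 3"
      by (metis mult_div_mod_eq add.right_neutral)
    hence "even (h - h div 2) \<longleftrightarrow> (2 * h + 1) mod 8 = 1 \<or> (2 * h + 1) mod 8 = 7"
      by (elim disjE) (simp_all, presburger+)
    moreover have "int p mod 8 = int (p mod 8)" by (simp add: zmod_int)
    hence "int p mod 8 = 1 \<longleftrightarrow> p mod 8 = 1" "int p mod 8 = 7 \<longleftrightarrow> p mod 8 = 7" by linarith+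
    moreover have "h - h div 2 \<ge> 0" using h by simp
    ultimately show ?thesis using h(1) by (simp add: even_nat_iff)
  qed
  ultimately show ?thesis by (simp add: gauss_lemma)
qed

text \<open>Quadratic reciprocity; the residue of \<open>p\<close> modulo 12 combines those modulo 3 and 4.\<close>

lemma Legendre_3:
  assumes "prime p" "3 < p"
  shows "Legendre 3 (int p) = (if p mod 12 \<in> {1, 11} then 1 else -1)"
proof -
  have odd: "odd p" using assms primes_dvd_imp_eq[of 2 p] by auto
  have "\<not> 3 dvd p" using assms primes_dvd_imp_eq[of 3 p] by auto
  hence cases: "p mod 3 = 1 \<or> p mod 3 = 2" by presburger
  have nqr: "\<not> QuadRes 3 2"
  proof
    assume "QuadRes 3 2"
    then obtain y :: int where "y ^ 2 mod 3 = 2" by (auto simp: QuadRes_def cong_def)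
    moreover have "y ^ 2 mod 3 = (y mod 3) ^ 2 mod 3" by (simp add: power_mod)
    moreover have "y mod 3 = 0 \<or> y mod 3 = 1 \<or> y mod 3 = 2" by presburger
    ultimately show False by auto
  qed
  have "Legendre (int p) 3 = (if p mod 3 = 1 then 1 else -1)"
  proof -
    have "int p mod 3 = (if p mod 3 = 1 then 1 else 2)" using cases by presburger
    hence "Legendre (int p) 3 = Legendre (if p mod 3 = 1 then 1 else 2) 3"
      by (intro Legendre_cong) auto
    moreover have "QuadRes 3 1" unfolding QuadRes_def by (intro exI[of _ 1]) simp
    ultimately show ?thesis using nqr by (auto simp: Legendre_def cong_def)
  qed
  moreover have "Legendre p 3 * Legendre 3 p = (-1 :: int) ^ ((p - 1) div 2)"
    using Quadratic_Reciprocity[of p 3] assms by simp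
  moreover have "even ((p - 1) div 2) \<longleftrightarrow> p mod 4 = 1" using odd by presburger
  ultimately have "Legendre 3 (int p) = (if p mod 3 = 1 then 1 else -1) * (if p mod 4 = 1 then 1 else -1)"
    by (auto split: if_splits)
  moreover have "p mod 12 \<in> {1, 11} \<longleftrightarrow> (p mod 3 = 1 \<longleftrightarrow> p mod 4 = 1)"
  proof -
    have "\<forall>a\<in>{..<12}. a mod 3 \<noteq> 0 \<and> a mod 2 \<noteq> 0 \<longrightarrow> 
            (a \<in> {1, 11} \<longleftrightarrow> (a mod 3 = 1 \<longleftrightarrow> a mod 4 = (1 :: nat)))"
      by (simp add: lessThan_nat_numeral lessThan_Suc)
    from this[THEN bspec, of "p mod 12"] show ?thesis
      using cases odd by (auto simp: mod_mod_cancel odd_iff_mod_2_eq_one)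
  qed
  ultimately show ?thesis by auto
qed

definition chi24 :: "nat \<Rightarrow> int" where
  "chi24 n = (if n mod 24 \<in> {1, 5, 19, 23} then 1 else if n mod 24 \<in> {7, 11, 13, 17} then -1 else 0)"

definition chi8 :: "nat \<Rightarrow> int" where
  "chi8 n = (if n mod 8 \<in> {1, 3} then 1 else if n mod 8 \<in> {5, 7} then -1 else 0)"

definition chi3 :: "nat \<Rightarrow> int" where
  "chi3 n = (if n mod 3 = 1 then 1 else if n mod 3 = 2 then -1 else 0)"

lemma chi8_mult: "chi8 (m * n) = chi8 m * chi8 n"
proof -
  have *: "\<forall>a\<in>{..<8}. \<forall>b\<in>{..<8}. chi8 (a * b) = chi8 a * chi8 b"
    by (simp add: chi8_def lessThan_nat_numeral lessThan_Suc)
  have per: "chi8 (k mod 8) = chi8 k" for k by (simp only: chi8_def mod_mod_trivial)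
  have "chi8 (m * n) = chi8 ((m mod 8) * (n mod 8))" by (simp only: chi8_def mod_mult_eq)
  also have "\<dots> = chi8 (m mod 8) * chi8 (n mod 8)" by (rule *[rule_format]) simp_all
  finally show ?thesis unfolding per .
qed

lemma chi3_mult: "chi3 (m * n) = chi3 m * chi3 n"
proof -
  have *: "\<forall>a\<in>{..<3}. \<forall>b\<in>{..<3}. chi3 (a * b) = chi3 a * chi3 b"
    by (simp add: chi3_def lessThan_nat_numeral lessThan_Suc)
  have per: "chi3 (k mod 3) = chi3 k" for k by (simp only: chi3_def mod_mod_trivial)
  have "chi3 (m * n) = chi3 ((m mod 3) * (n mod 3))" by (simp only: chi3_def mod_mult_eq)
  also have "\<dots> = chi3 (m mod 3) * chi3 (n mod 3)" by (rule *[rule_format]) simp_all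
  finally show ?thesis unfolding per .
qed

lemma chi24_eq_chi8_chi3: "chi24 n = chi8 n * chi3 n"
proof -
  have *: "\<forall>a\<in>{..<24}. chi24 a = chi8 a * chi3 a"
    by (simp add: chi24_def chi8_def chi3_def lessThan_nat_numeral lessThan_Suc)
  have "chi24 n = chi24 (n mod 24)" by (simp only: chi24_def mod_mod_trivial)
  also have "\<dots> = chi8 (n mod 24) * chi3 (n mod 24)" by (rule *[rule_format]) simp
  also have "\<dots> = chi8 n * chi3 n" by (simp add: chi8_def chi3_def mod_mod_cancel)
  finally show ?thesis .
qed

lemma prime_cases_mod:
  assumes "prime (p :: nat)" "p \<noteq> 2" shows "p > 2" "odd p"
  using assms prime_ge_2_nat[of p] primes_dvd_imp_eq[of 2 p] by auto

lemma Legendre_minus_8: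
  assumes "prime p" "2 < p"
  shows "Legendre (-8) (int p) = chi8 p"
proof -
  have "Legendre (-8) (int p) = Legendre (-1) p * (Legendre 2 p * (Legendre 2 p * Legendre 2 p))"
    using Legendre_mult[OF assms, of "-1" 8] Legendre_mult[OF assms, of 2 4] Legendre_mult[OF assms, of 2 2]
    by simp
  moreover have "odd p" using assms primes_dvd_imp_eq[of 2 p] by auto
  hence "p mod 8 = 1 \<or> p mod 8 = 3 \<or> p mod 8 = 5 \<or> p mod 8 = 7" by presburger
  moreover have "p mod 4 = (p mod 8) mod 4" by (simp add: mod_mod_cancel)
  ultimately show ?thesis
    unfolding Legendre_minus_one[OF assms] Legendre_2[OF assms] chi8_def by auto
qed

lemma Legendre_minus_3:
  assumes "prime p" "3 < p"
  shows "Legendre (-3) (int p) = chi3 p"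
proof -
  have "2 < p" using assms by simp
  note m1 = Legendre_minus_one[OF assms(1) this] and mult = Legendre_mult[OF assms(1) this]
  have "Legendre (-3) (int p) = Legendre (-1) p * Legendre 3 p"
    using mult[of "-1" 3] by simp
  moreover have "odd p" using assms primes_dvd_imp_eq[of 2 p] by auto
  moreover have "\<not> 3 dvd p" using assms primes_dvd_imp_eq[of 3 p] by auto
  ultimately show ?thesis
  proof -
    assume 1: "Legendre (-3) (int p) = Legendre (-1) p * Legendre 3 p" "odd p" "\<not> 3 dvd p"
    have *: "\<forall>a\<in>{..<12}. a mod 3 \<noteq> 0 \<and> a mod 2 \<noteq> 0 \<longrightarrow> 
        (if a mod 4 = 1 then 1 else -1) * (if a \<in> {1, 11} then 1 else -1) = chi3 a"
      by (simp add: lessThan_nat_numeral lessThan_Suc chi3_def)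
    have "(if p mod 12 mod 4 = 1 then 1 else -1) * (if p mod 12 \<in> {1, 11} then 1 else -1) 
             = chi3 (p mod 12)"
    proof (rule *[rule_format])
      have "p mod 12 mod 3 = p mod 3" "p mod 12 mod 2 = p mod 2" by (simp_all add: mod_mod_cancel)
      thus "p mod 12 mod 3 \<noteq> 0 \<and> p mod 12 mod 2 \<noteq> 0" using 1(2,3) by presburger
    qed simp
    moreover have "p mod 12 mod 4 = p mod 4" "p mod 12 mod 3 = p mod 3" by (simp_all add: mod_mod_cancel)
    ultimately show ?thesis
      unfolding 1(1) m1 Legendre_3[OF assms] chi3_def by (simp only:)
  qed
qed

lemma kronecker_minus_8: "n > 0 \<Longrightarrow> kronecker (-8) n = chi8 n"
proof (rule kronecker_eqI)
  fix p :: nat assume "prime p"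
  thus "kronecker_prime (-8) p = chi8 p"
    using Legendre_minus_8[of p] prime_cases_mod[of p] by (auto simp: kronecker_prime_def chi8_def)
qed (simp_all add: chi8_mult, simp add: chi8_def)

lemma kronecker_minus_3: "n > 0 \<Longrightarrow> kronecker (-3) n = chi3 n"
proof (rule kronecker_eqI)
  fix p :: nat assume p: "prime p"
  consider "p = 2" | "p = 3" | "p > 3" using prime_ge_2_nat[OF p] by linarith
  thus "kronecker_prime (-3) p = chi3 p"
    using Legendre_minus_3[OF p] by cases (auto simp: kronecker_prime_def chi3_def Legendre_def cong_def)
qed (simp_all add: chi3_mult, simp add: chi3_def)

text \<open>The factorisation \<open>24 = (-8) (-3)\<close> reduces this symbol to the two previous ones.\<close>

lemma kronecker_24: "n > 0 \<Longrightarrow> kronecker 24 n = chi24 n"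
proof (rule kronecker_eqI)
  fix p :: nat assume p: "prime p"
  show "kronecker_prime 24 p = chi24 p"
  proof (cases "p = 2")
    case False
    hence "p > 2" using prime_ge_2_nat[OF p] by linarith
    moreover have "Legendre (-3) (int p) = chi3 p"
      using Legendre_minus_3[OF p] \<open>p > 2\<close> 
      by (cases "p = 3") (auto simp: Legendre_def chi3_def cong_def)
    ultimately show ?thesis
      using False Legendre_mult[OF p, of "-8" "-3"] Legendre_minus_8[OF p]
      by (simp add: kronecker_prime_def chi24_eq_chi8_chi3)
  qed (simp add: kronecker_prime_def chi24_def)
qed (simp_all add: chi24_eq_chi8_chi3 chi8_mult chi3_mult, simp add: chi8_def chi3_def)

lemma kronecker_one: "n > 0 \<Longrightarrow> kronecker 1 n = 1"
proof (rule kronecker_eqI[of _ "\<lambda>_. 1"])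
  fix p :: nat assume p: "prime p"
  have "QuadRes p 1" unfolding QuadRes_def by (intro exI[of _ 1]) simp
  thus "kronecker_prime 1 p = 1"
    using prime_gt_1_nat[OF p] by (auto simp: kronecker_prime_def Legendre_def cong_def)
qed auto

section \<open>Lambert series\<close>

lemma summable_Suc_mult_power:
  assumes "0 \<le> r" "r < (1 :: real)"
  shows "summable (\<lambda>m. real (Suc m) * r ^ m)"
  using geometric_deriv_sums[of r] assms by (auto simp: sums_iff)

lemma sums_koebe:
  fixes y :: complex
  assumes "norm y < 1"
  shows "(\<lambda>m. of_nat (Suc m) * y ^ Suc m) sums koebe y"
  using sums_mult[OF geometric_deriv_sums[OF assms], of y]
  by (simp add: koebe_def mult_ac)

text \<open>The double series over a divisor \<open>m\<close> and its cofactor \<open>d\<close> converges absolutely, because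
  \<open>r\<^sup>m\<^sup>d \<le> r\<^sup>m\<^sup>+\<^sup>d\<^sup>-\<^sup>1\<close>; summing it over \<open>m\<close> first gives the left-hand side, sorting it by
  \<open>n = m d\<close> the right-hand side.\<close>

lemma lambert_rearrangement:
  fixes \<phi> \<psi> :: "nat \<Rightarrow> complex"
  assumes q: "norm q < 1" and \<phi>: "\<And>n. norm (\<phi> n) \<le> 1" and \<psi>: "\<And>n. norm (\<psi> n) \<le> 1"
  shows "(\<lambda>d. \<psi> (Suc d) * (\<Sum>m. \<phi> (Suc m) * of_nat (Suc m) * (q ^ Suc d) ^ Suc m)) sums
           (\<Sum>n. sigma_chars \<phi> \<psi> (Suc n) * q ^ Suc n)"
proof -
  define r where "r = norm q"
  have r: "0 \<le> r" "r < 1" using q by (auto simp: r_def)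
  define F where "F = (\<lambda>(d, m). \<psi> (Suc d) * (\<phi> (Suc m) * of_nat (Suc m) * (q ^ Suc d) ^ Suc m))"
  have summ: "F summable_on UNIV \<times> UNIV"
  proof -
    have "(\<lambda>x. norm (case x of (d, m) \<Rightarrow> r ^ d * (real (Suc m) * r ^ m))) summable_on UNIV \<times> UNIV"
    proof (rule summable_on_SigmaI)
      have 1: "((\<lambda>m. real (Suc m) * r ^ m) summable_on UNIV)"
        using summable_Suc_mult_power[OF r] r by (subst summable_on_UNIV_nonneg_real_iff) auto
      show "((\<lambda>y. norm (case (x, y) of (d, m) \<Rightarrow> r ^ d * (real (Suc m) * r ^ m))) has_sum 
              r ^ x * infsum (\<lambda>m. real (Suc m) * r ^ m) UNIV) UNIV" for x
        using has_sum_cmult_right[OF has_sum_infsum[OF 1], of "r ^ x"] r by (simp add: abs_mult)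
      show "(\<lambda>d. r ^ d * infsum (\<lambda>m. real (Suc m) * r ^ m) UNIV) summable_on UNIV"
        using r by (intro summable_on_cmult_left)
          (subst summable_on_UNIV_nonneg_real_iff, auto intro: summable_geometric)
    qed auto
    hence "(\<lambda>x. norm (F x)) summable_on UNIV \<times> UNIV"
    proof (rule Infinite_Sum.abs_summable_on_comparison_test)
      fix x :: "nat \<times> nat"
      obtain d m where x: "x = (d, m)" by (cases x)
      have "norm (F x) \<le> 1 * (1 * real (Suc m) * (r ^ Suc d) ^ Suc m)"
        unfolding x F_def prod.case norm_mult norm_power norm_of_nat r_def
        by (intro mult_mono \<phi> \<psi>) auto
      also have "(r ^ Suc d) ^ Suc m \<le> r ^ (d + m)"
        unfolding power_mult[symmetric] using r by (intro power_decreasing) auto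
      finally have "norm (F x) \<le> real (Suc m) * r ^ (d + m)" by (simp add: mult_left_mono)
      thus "norm (F x) \<le> norm (case x of (d, m) \<Rightarrow> r ^ d * (real (Suc m) * r ^ m))"
        using r by (simp add: x power_add mult_ac abs_mult)
    qed
    thus ?thesis by (rule Infinite_Sum.abs_summable_summable)
  qed
  define S where "S = infsum F (UNIV \<times> UNIV)"
  have has: "(F has_sum S) (UNIV \<times> UNIV)" unfolding S_def by (rule has_sum_infsum[OF summ])
  have inner: "((\<lambda>m. F (d, m)) has_sum 
      \<psi> (Suc d) * (\<Sum>m. \<phi> (Suc m) * of_nat (Suc m) * (q ^ Suc d) ^ Suc m)) UNIV" for d
  proof -
    have 0: "norm (q ^ Suc d) < 1" using power_decreasing[of 1 "Suc d" r] r by (simp add: norm_power norm_mult r_def)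
    define f where "f = (\<lambda>m. \<phi> (Suc m) * of_nat (Suc m) * (q ^ Suc d) ^ Suc m)"
    have f: "summable (\<lambda>m. norm (f m))"
    proof (rule summable_comparison_test')
      show "summable (\<lambda>m. real (Suc m) * norm (q ^ Suc d) ^ m)"
        using 0 by (intro summable_Suc_mult_power) auto
      fix m :: nat
      have "norm (f m) \<le> 1 * real (Suc m) * norm (q ^ Suc d) ^ Suc m"
        unfolding f_def norm_mult norm_power norm_of_nat by (intro mult_mono \<phi>) auto
      also have "\<dots> \<le> 1 * real (Suc m) * norm (q ^ Suc d) ^ m"
        using 0 by (intro mult_left_mono power_decreasing) auto
      finally show "norm (norm (f m)) \<le> real (Suc m) * norm (q ^ Suc d) ^ m" by simp
    qed
    have "(f has_sum suminf f) UNIV"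
      using f summable_sums[OF summable_norm_cancel[OF f]] by (rule norm_summable_imp_has_sum)
    from has_sum_cmult_right[OF this, of "\<psi> (Suc d)"] show ?thesis unfolding F_def prod.case f_def .
  qed
  have "((\<lambda>d. \<psi> (Suc d) * (\<Sum>m. \<phi> (Suc m) * of_nat (Suc m) * (q ^ Suc d) ^ Suc m)) has_sum S) UNIV"
    using has_sum_SigmaD[OF has inner] by simp
  hence sums1: "(\<lambda>d. \<psi> (Suc d) * (\<Sum>m. \<phi> (Suc m) * of_nat (Suc m) * (q ^ Suc d) ^ Suc m)) sums S"
    by (rule has_sum_imp_sums)
  define G where "G = (\<lambda>(n, m). \<phi> m * \<psi> (Suc n div m) * of_nat m * q ^ Suc n)"
  have "(G has_sum S) (SIGMA n:UNIV. {m. m dvd Suc n})"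
  proof (rule has_sum_reindex_bij_witness[THEN iffD1, OF _ _ _ _ _ _ has])
    show "(\<lambda>(n, m). (Suc n div m - 1, m - 1)) x \<in> UNIV \<times> UNIV" for x :: "nat \<times> nat" by auto
    show "(\<lambda>(d, m). (Suc d * Suc m - 1, Suc m)) x \<in> (SIGMA n:UNIV. {m. m dvd Suc n})" for x :: "nat \<times> nat"
      by (cases x) (auto simp del: mult_Suc mult_Suc_right simp: Suc_diff_1)
    show "(\<lambda>(n, m). (Suc n div m - 1, m - 1)) ((\<lambda>(d, m). (Suc d * Suc m - 1, Suc m)) x) = x" for x
      by (cases x) (auto simp del: mult_Suc mult_Suc_right simp: Suc_diff_1)
    show "(\<lambda>(d, m). (Suc d * Suc m - 1, Suc m)) ((\<lambda>(n, m). (Suc n div m - 1, m - 1)) x) = x"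
      if "x \<in> (SIGMA n:UNIV. {m. m dvd Suc n})" for x
    proof (cases x)
      case (Pair n m)
      with that obtain k where k: "Suc n = m * k" by auto
      hence "m > 0" "k > 0" by (auto intro: Nat.gr0I)
      thus ?thesis using k by (simp add: Pair mult.commute del: mult_Suc mult_Suc_right)
    qed
    show "G ((\<lambda>(d, m). (Suc d * Suc m - 1, Suc m)) x) = F x" for x
    proof (cases x)
      case (Pair d m)
      have "Suc (Suc d * Suc m - 1) = Suc d * Suc m" by simp
      thus ?thesis unfolding Pair F_def G_def prod.case
        by (simp add: power_mult[symmetric] mult_ac del: mult_Suc mult_Suc_right power_Suc)
    qed
  qed (rule refl)
  moreover have "((\<lambda>m. G (n, m)) has_sum sigma_chars \<phi> \<psi> (Suc n) * q ^ Suc n) {m. m dvd Suc n}" for n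
  proof -
    have "finite {m. m dvd Suc n}" by (rule finite_divisors_nat) simp
    from has_sum_finite[OF this, of "\<lambda>m. G (n, m)"] show ?thesis
      by (simp add: G_def sigma_chars_def sum_distrib_right)
  qed
  ultimately have "((\<lambda>n. sigma_chars \<phi> \<psi> (Suc n) * q ^ Suc n) has_sum S) UNIV"
    by (rule has_sum_SigmaD)
  hence "(\<lambda>n. sigma_chars \<phi> \<psi> (Suc n) * q ^ Suc n) sums S" by (rule has_sum_imp_sums)
  hence "S = (\<Sum>n. sigma_chars \<phi> \<psi> (Suc n) * q ^ Suc n)" by (rule sums_unique)
  with sums1 show ?thesis by simp
qed

section \<open>Gauss sums\<close>

lemma cis_pi_minus_plus: "cis (pi - x) = - cnj (cis x)" "cis (pi + x) = - cis x"
  by (simp_all add: complex_eq_iff)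

lemma gauss_sum_8:
  defines "\<zeta> \<equiv> cis (2 * pi / 8)"
  shows "2 * \<i> * of_real (sqrt 2) * of_int (chi8 m) = \<zeta> ^ m + (\<zeta> ^ 3) ^ m - (\<zeta> ^ 5) ^ m - (\<zeta> ^ 7) ^ m"
proof -
  have r: "2 * pi / 8 = pi / 4" by simp
  have z4: "\<zeta> ^ 4 = -1" unfolding \<zeta>_def Complex.DeMoivre by simp
  have z13: "\<zeta> + \<zeta> ^ 3 = \<i> * of_real (sqrt 2)"
  proof -
    have "3 * (pi / 4) = pi - pi / 4" by simp
    hence "\<zeta> ^ 3 = cis (pi - pi / 4)" unfolding \<zeta>_def r Complex.DeMoivre by simp
    hence "\<zeta> ^ 3 = - cnj (cis (pi / 4))" unfolding cis_pi_minus_plus .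
    thus ?thesis unfolding \<zeta>_def r by (simp add: complex_eq_iff cos_45 sin_45)
  qed
  have "\<zeta> ^ 8 = (\<zeta> ^ 4) ^ 2" by (simp flip: power_mult)
  hence z8: "\<zeta> ^ 8 = 1" by (simp add: z4)
  define n where "n = m mod 8"
  have red: "(\<zeta> ^ a) ^ m = (\<zeta> ^ a) ^ n" for a
  proof -
    have "(\<zeta> ^ a) ^ m = (\<zeta> ^ a) ^ (8 * (m div 8) + n)" by (simp add: n_def)
    also have "\<dots> = ((\<zeta> ^ 8) ^ a) ^ (m div 8) * (\<zeta> ^ a) ^ n"
      by (simp add: power_add power_mult[symmetric] mult_ac)
    finally show ?thesis by (simp add: z8)
  qed
  have "n < 8" by (simp add: n_def)
  hence n: "n \<in> {0, 1, 2, 3, 4, 5, 6, 7}" by auto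
  have "2 * (\<zeta> + \<zeta> ^ 3) * of_int (chi8 n) = (\<zeta> ^ 1) ^ n + (\<zeta> ^ 3) ^ n - (\<zeta> ^ 5) ^ n - (\<zeta> ^ 7) ^ n"
  proof -
    have zred: "\<zeta> ^ k = (-1) ^ (k div 4) * \<zeta> ^ (k mod 4)" for k
      unfolding z4[symmetric] by (simp flip: power_mult power_add)
    show ?thesis using n unfolding insert_iff empty_iff
      by (elim disjE FalseE)
         (simp_all add: chi8_def power_mult[symmetric] zred[of 4] zred[of 5] zred[of 6] zred[of 7] zred[of 9] zred[of 10] zred[of 12] zred[of 14] zred[of 15] zred[of 18]
           zred[of 20] zred[of 21] zred[of 25] zred[of 28] zred[of 30] zred[of 35] zred[of 42] zred[of 49])
  qed
  moreover have "chi8 m = chi8 n" unfolding n_def by (simp only: chi8_def mod_mod_trivial)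
  ultimately show ?thesis using red[of 1] by (simp only: red z13 power_one_right mult.assoc)
qed

lemma gauss_sum_3:
  defines "\<omega> \<equiv> cis (2 * pi / 3)"
  shows "\<i> * of_real (sqrt 3) * of_int (chi3 m) = \<omega> ^ m - (\<omega> ^ 2) ^ m"
proof -
  have w3: "\<omega> ^ 3 = 1" unfolding \<omega>_def Complex.DeMoivre by simp
  have w12: "\<omega> - \<omega> ^ 2 = \<i> * of_real (sqrt 3)"
  proof -
    have r1: "2 * pi / 3 = pi - pi / 3" and r2: "2 * (2 * pi / 3) = pi + pi / 3" by simp_all
    have "\<omega> ^ 2 = cis (2 * (2 * pi / 3))" unfolding \<omega>_def Complex.DeMoivre by simp
    hence w2: "\<omega> ^ 2 = - cis (pi / 3)" unfolding r2 cis_pi_minus_plus .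
    have w1: "\<omega> = - cnj (cis (pi / 3))" unfolding \<omega>_def r1 cis_pi_minus_plus ..
    show ?thesis unfolding w2 unfolding w1 by (simp add: complex_eq_iff sin_60 cos_60)
  qed
  have "\<omega> ^ 4 = \<omega> ^ 3 * \<omega>" by (simp flip: power_Suc2)
  hence "\<omega> ^ 4 = \<omega>" by (simp add: w3)
  define n where "n = m mod 3"
  have red: "(\<omega> ^ a) ^ m = (\<omega> ^ a) ^ n" for a
  proof -
    have "(\<omega> ^ a) ^ m = (\<omega> ^ a) ^ (3 * (m div 3) + n)" by (simp add: n_def)
    also have "\<dots> = ((\<omega> ^ 3) ^ a) ^ (m div 3) * (\<omega> ^ a) ^ n"
      by (simp add: power_add power_mult[symmetric] mult_ac)
    finally show ?thesis by (simp add: w3)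
  qed
  have "n < 3" by (simp add: n_def)
  hence n: "n \<in> {0, 1, 2}" by auto
  have "(\<omega> - \<omega> ^ 2) * of_int (chi3 n) = (\<omega> ^ 1) ^ n - (\<omega> ^ 2) ^ n"
    using n \<open>\<omega> ^ 4 = \<omega>\<close> unfolding insert_iff empty_iff
    by (elim disjE FalseE) (simp_all add: chi3_def power_mult[symmetric])
  moreover have "chi3 m = chi3 n" unfolding n_def by (simp only: chi3_def mod_mod_trivial)
  ultimately show ?thesis using red[of 1] by (simp only: red w12 power_one_right)
qed

text \<open>The product of the Gauss sums modulo 8 and 3; \<open>(a, b) \<mapsto> 3 a + 8 b\<close> runs through the units
  modulo 24.\<close>

lemma gauss_sum_24:
  defines "\<zeta> \<equiv> cis (2 * pi / 24)"
  shows "2 * of_real (sqrt 6) * of_int (chi24 m) = \<zeta> ^ m + (\<zeta> ^ 5) ^ m - (\<zeta> ^ 7) ^ m - (\<zeta> ^ 11) ^ m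
    - (\<zeta> ^ 13) ^ m - (\<zeta> ^ 17) ^ m + (\<zeta> ^ 19) ^ m + (\<zeta> ^ 23) ^ m"
proof -
  have z8: "cis (2 * pi / 8) = \<zeta> ^ 3" and z3: "cis (2 * pi / 3) = \<zeta> ^ 8"
    unfolding \<zeta>_def Complex.DeMoivre by (simp_all add: field_simps)
  have "real 24 * (2 * pi / 24) = 2 * pi" by simp
  hence z24: "\<zeta> ^ 24 = 1" unfolding \<zeta>_def Complex.DeMoivre by (simp only: cis_2pi)
  have s6: "sqrt 6 = sqrt 2 * sqrt 3" by (simp flip: real_sqrt_mult)
  have red: "(\<zeta> ^ (a + 24)) ^ m = (\<zeta> ^ a) ^ m" for a by (simp add: power_add z24)
  have red': "(\<zeta> ^ 25) ^ m = \<zeta> ^ m" "(\<zeta> ^ 29) ^ m = (\<zeta> ^ 5) ^ m" "(\<zeta> ^ 31) ^ m = (\<zeta> ^ 7) ^ m"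
    "(\<zeta> ^ 37) ^ m = (\<zeta> ^ 13) ^ m" using red[of 1] red[of 5] red[of 7] red[of 13] by simp_all
  have "2 * of_real (sqrt 6) * of_int (chi24 m) = 
     - ((2 * \<i> * of_real (sqrt 2) * of_int (chi8 m)) * (\<i> * of_real (sqrt 3) * of_int (chi3 m)))"
    by (simp add: chi24_eq_chi8_chi3 s6)
  also have "\<dots> = - (((\<zeta> ^ 3) ^ m + (\<zeta> ^ 9) ^ m - (\<zeta> ^ 15) ^ m - (\<zeta> ^ 21) ^ m) * ((\<zeta> ^ 8) ^ m - (\<zeta> ^ 16) ^ m))"
    unfolding gauss_sum_8 gauss_sum_3 z8 z3 by (simp flip: power_mult)
  also have "\<dots> = - ((\<zeta> ^ 11) ^ m + (\<zeta> ^ 17) ^ m - (\<zeta> ^ 23) ^ m - (\<zeta> ^ 29) ^ m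
        - (\<zeta> ^ 19) ^ m - (\<zeta> ^ 25) ^ m + (\<zeta> ^ 31) ^ m + (\<zeta> ^ 37) ^ m)"
    by (simp add: algebra_simps flip: power_mult_distrib power_add)
  finally show ?thesis unfolding red' by simp
qed

lemma fourier_koebe:
  fixes \<phi> :: "nat \<Rightarrow> complex" and A :: "nat set"
  assumes "finite A" "norm \<zeta> = 1" "norm x < 1"
    and g: "\<And>m. g * \<phi> (Suc m) = (\<Sum>a\<in>A. c a * (\<zeta> ^ a) ^ Suc m)" and "g \<noteq> 0"
  shows "g * (\<Sum>m. \<phi> (Suc m) * of_nat (Suc m) * x ^ Suc m) = (\<Sum>a\<in>A. c a * koebe (\<zeta> ^ a * x))"
proof -
  have "(\<lambda>m. c a * (of_nat (Suc m) * (\<zeta> ^ a * x) ^ Suc m)) sums (c a * koebe (\<zeta> ^ a * x))" for a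
    using assms by (intro sums_mult sums_koebe) (simp add: norm_mult norm_power)
  hence "(\<lambda>m. \<Sum>a\<in>A. c a * (of_nat (Suc m) * (\<zeta> ^ a * x) ^ Suc m)) sums (\<Sum>a\<in>A. c a * koebe (\<zeta> ^ a * x))"
    by (rule sums_sum)
  also have "(\<lambda>m. \<Sum>a\<in>A. c a * (of_nat (Suc m) * (\<zeta> ^ a * x) ^ Suc m)) = 
     (\<lambda>m. g * (\<phi> (Suc m) * of_nat (Suc m) * x ^ Suc m))"
  proof
    fix m
    have "g * (\<phi> (Suc m) * of_nat (Suc m) * x ^ Suc m) = (g * \<phi> (Suc m)) * (of_nat (Suc m) * x ^ Suc m)"
      by (simp only: mult.assoc)
    also have "\<dots> = (\<Sum>a\<in>A. c a * (of_nat (Suc m) * (\<zeta> ^ a * x) ^ Suc m))"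
      unfolding g sum_distrib_right power_mult_distrib by (simp only: mult_ac)
    finally show "(\<Sum>a\<in>A. c a * (of_nat (Suc m) * (\<zeta> ^ a * x) ^ Suc m)) = 
      g * (\<phi> (Suc m) * of_nat (Suc m) * x ^ Suc m)" ..
  qed
  finally have s: "(\<lambda>m. g * (\<phi> (Suc m) * of_nat (Suc m) * x ^ Suc m)) sums (\<Sum>a\<in>A. c a * koebe (\<zeta> ^ a * x))" .
  hence "(\<lambda>m. \<phi> (Suc m) * of_nat (Suc m) * x ^ Suc m) sums ((\<Sum>a\<in>A. c a * koebe (\<zeta> ^ a * x)) / g)"
    using sums_divide[OF s, of g] \<open>g \<noteq> 0\<close> by simp
  thus ?thesis using \<open>g \<noteq> 0\<close> by (simp add: sums_unique[symmetric])
qed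

text \<open>The character \<open>\<phi>\<close> on the weighted divisor is expanded into roots of unity, which produces values of
  \<^term>\<open>koebe\<close>; then the outer sum is grouped by residue classes modulo the period of \<open>\<psi>\<close>.\<close>

lemma eis_series_sums:
  fixes \<phi> \<psi> :: "nat \<Rightarrow> complex" and A :: "nat set"
  assumes "finite A" "norm \<zeta> = 1" "norm q < 1" "M > 0"
    and g: "\<And>m. g * \<phi> (Suc m) = (\<Sum>a\<in>A. c a * (\<zeta> ^ a) ^ Suc m)" and "g \<noteq> 0"
    and \<phi>: "\<And>n. norm (\<phi> n) \<le> 1" and \<psi>: "\<And>n. norm (\<psi> n) \<le> 1"
    and per: "\<And>n j. j < M \<Longrightarrow> \<psi> (Suc (n * M + j)) = \<psi> (Suc j)"
  shows "(\<lambda>n. \<Sum>j<M. \<psi> (Suc j) * (\<Sum>a\<in>A. c a * koebe (\<zeta> ^ a * q ^ (n * M + Suc j)))) sums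
           (g * (\<Sum>n. sigma_chars \<phi> \<psi> (Suc n) * q ^ Suc n))"
proof -
  have nq: "norm (q ^ Suc d) < 1" for d
    using power_decreasing[of 1 "Suc d" "norm q"] assms(3) by (simp add: norm_power norm_mult)
  have eq: "g * (\<psi> (Suc d) * (\<Sum>m. \<phi> (Suc m) * of_nat (Suc m) * (q ^ Suc d) ^ Suc m)) = 
         \<psi> (Suc d) * (\<Sum>a\<in>A. c a * koebe (\<zeta> ^ a * q ^ Suc d))" for d
    unfolding fourier_koebe[OF assms(1,2) nq g \<open>g \<noteq> 0\<close>, of d, symmetric] by (rule mult.left_commute)
  have "(\<lambda>d. g * (\<psi> (Suc d) * (\<Sum>m. \<phi> (Suc m) * of_nat (Suc m) * (q ^ Suc d) ^ Suc m))) sums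
           (g * (\<Sum>n. sigma_chars \<phi> \<psi> (Suc n) * q ^ Suc n))"
    by (intro sums_mult lambert_rearrangement assms)
  hence "(\<lambda>d. \<psi> (Suc d) * (\<Sum>a\<in>A. c a * koebe (\<zeta> ^ a * q ^ Suc d))) sums
           (g * (\<Sum>n. sigma_chars \<phi> \<psi> (Suc n) * q ^ Suc n))" unfolding eq .
  from sums_group[OF this \<open>M > 0\<close>]
  have "(\<lambda>n. \<Sum>d\<in>{n * M..<n * M + M}. \<psi> (Suc d) * (\<Sum>a\<in>A. c a * koebe (\<zeta> ^ a * q ^ Suc d))) sums
           (g * (\<Sum>n. sigma_chars \<phi> \<psi> (Suc n) * q ^ Suc n))" .
  also have "(\<lambda>n. \<Sum>d\<in>{n * M..<n * M + M}. \<psi> (Suc d) * (\<Sum>a\<in>A. c a * koebe (\<zeta> ^ a * q ^ Suc d))) =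
    (\<lambda>n. \<Sum>j<M. \<psi> (Suc j) * (\<Sum>a\<in>A. c a * koebe (\<zeta> ^ a * q ^ (n * M + Suc j))))"
  proof
    fix n
    have "(\<Sum>d\<in>{n * M..<n * M + M}. \<psi> (Suc d) * (\<Sum>a\<in>A. c a * koebe (\<zeta> ^ a * q ^ Suc d))) =
       (\<Sum>j\<in>{0..<M}. \<psi> (Suc (n * M + j)) * (\<Sum>a\<in>A. c a * koebe (\<zeta> ^ a * q ^ Suc (n * M + j))))"
      using sum.shift_bounds_nat_ivl[of "\<lambda>d. \<psi> (Suc d) * (\<Sum>a\<in>A. c a * koebe (\<zeta> ^ a * q ^ Suc d))" 0 "n * M" M]
      by (simp add: add.commute)
    also have "\<dots> = (\<Sum>j<M. \<psi> (Suc j) * (\<Sum>a\<in>A. c a * koebe (\<zeta> ^ a * q ^ (n * M + Suc j))))"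
      unfolding lessThan_atLeast0 by (intro sum.cong refl) (simp only: per atLeastLessThan_iff add_Suc_right)
    finally show "(\<Sum>d\<in>{n * M..<n * M + M}. \<psi> (Suc d) * (\<Sum>a\<in>A. c a * koebe (\<zeta> ^ a * q ^ Suc d))) = \<dots>" .
  qed
  finally show ?thesis .
qed

text \<open>The two halves of \<^term>\<open>wp\<close> at \<open>c q\<^sup>j\<close> run through the exponents congruent to \<open>j\<close> and to \<open>- j\<close>
  modulo \<open>M\<close>; the multiple \<open>i\<close> of \<open>M\<close> is removed by periodicity.\<close>

lemma wp_sums:
  assumes "norm q < 1" "q \<noteq> 0" "M > 0" "0 < j" "j < M" "c \<noteq> 0"
  shows "(\<lambda>n. koebe (c * q ^ (n * M + j)) + koebe ((1 / c) * q ^ (n * M + (M - j)))) sums wp (c * q ^ (i * M + j)) (q ^ M)"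
proof -
  have qM: "norm (q ^ M) < 1" "q ^ M \<noteq> 0" using assms by (auto simp: norm_power power_less_one_iff)
  have "wp (c * q ^ (i * M + j)) (q ^ M) = wp (c * q ^ j) (q ^ M)"
  proof (induction i)
    case (Suc i)
    have "c * q ^ (Suc i * M + j) = q ^ M * (c * q ^ (i * M + j))" by (simp add: power_add mult_ac)
    hence "wp (c * q ^ (Suc i * M + j)) (q ^ M) = wp (c * q ^ (i * M + j)) (q ^ M)"
      using wp_mult_nome[OF qM, of "c * q ^ (i * M + j)"] assms by (simp only:) simp
    thus ?case unfolding Suc .
  qed simp
  moreover have "(\<lambda>n. koebe (c * q ^ j * (q ^ M) ^ n) + koebe ((q ^ M) ^ Suc n / (c * q ^ j))) sums wp (c * q ^ j) (q ^ M)"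
    unfolding wp_def
    by (intro sums_add summable_sums summable_koebe_powers summable_koebe_powers_Suc qM)
  moreover have "c * q ^ j * (q ^ M) ^ n = c * q ^ (n * M + j)" for n
    by (simp add: power_add power_mult[symmetric] mult_ac)
  moreover have "(q ^ M) ^ Suc n / (c * q ^ j) = (1 / c) * q ^ (n * M + (M - j))" for n
  proof -
    have "(q ^ M) ^ Suc n = q ^ (n * M + (M - j)) * q ^ j"
      using assms by (simp add: power_add[symmetric] power_mult[symmetric] algebra_simps)
    thus ?thesis using assms by simp
  qed
  ultimately show ?thesis by simp
qed

section \<open>Eisenstein series as sums of Weierstrass values\<close>

lemma norm_chi_le_1: 
  "norm (of_int (chi24 n) :: complex) \<le> 1" "norm (of_int (chi8 n) :: complex) \<le> 1"
  "norm (of_int (chi3 n) :: complex) \<le> 1"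
  "\<bar>real_of_int (chi24 n)\<bar> \<le> 1" "\<bar>real_of_int (chi8 n)\<bar> \<le> 1" "\<bar>real_of_int (chi3 n)\<bar> \<le> 1"
  by (simp_all add: chi24_def chi8_def chi3_def)

lemma sigma_chars_cong:
  assumes "n > 0" "\<And>m. m > 0 \<Longrightarrow> \<phi> m = \<phi>' m" "\<And>m. m > 0 \<Longrightarrow> \<psi> m = \<psi>' m"
  shows "sigma_chars \<phi> \<psi> n = sigma_chars \<phi>' \<psi>' n"
  unfolding sigma_chars_def
proof (rule sum.cong[OF refl])
  fix m assume "m \<in> {m. m dvd n}"
  hence "m > 0" "n div m > 0" using assms(1) by (auto simp: dvd_div_eq_0_iff intro: Nat.gr0I)
  thus "\<phi> m * \<psi> (n div m) * of_nat m = \<phi>' m * \<psi>' (n div m) * of_nat m" using assms by simp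
qed

lemma sigma_chars_tables:
  assumes "n > 0"
  shows "sigma_chars (chi 1) (chi 24) n = sigma_chars (\<lambda>_. 1) (\<lambda>m. of_int (chi24 m)) n"
    "sigma_chars (chi 24) (chi 1) n = sigma_chars (\<lambda>m. of_int (chi24 m)) (\<lambda>_. 1) n"
    "sigma_chars (chi (-8)) (chi (-3)) n = sigma_chars (\<lambda>m. of_int (chi8 m)) (\<lambda>m. of_int (chi3 m)) n"
    "sigma_chars (chi (-3)) (chi (-8)) n = sigma_chars (\<lambda>m. of_int (chi3 m)) (\<lambda>m. of_int (chi8 m)) n"
  using assms
  by (intro sigma_chars_cong; simp add: chi_def kronecker_24 kronecker_one kronecker_minus_8 kronecker_minus_3)+

lemma chi_periodic:
  "chi24 (Suc (n * 24 + j)) = chi24 (Suc j)" "chi8 (Suc (n * 8 + j)) = chi8 (Suc j)"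
  "chi3 (Suc (n * 3 + j)) = chi3 (Suc j)"
proof -
  have "Suc (n * M + j) mod M = Suc j mod M" for M
    using mod_mult_self2[of "Suc j" M n] by (simp add: add.commute mult.commute)
  thus "chi24 (Suc (n * 24 + j)) = chi24 (Suc j)" "chi8 (Suc (n * 8 + j)) = chi8 (Suc j)"
    "chi3 (Suc (n * 3 + j)) = chi3 (Suc j)"
    by (simp_all only: chi24_def chi8_def chi3_def)
qed

lemma koebe_cis: "cos t \<noteq> 1 \<Longrightarrow> koebe (cis t) = of_real (1 / (2 * cos t - 2))"
proof -
  assume "cos t \<noteq> 1"
  have "(1 - cis t) ^ 2 = cis t * of_real (2 * cos t - 2)"
  proof -
    have "cis t * cis (- t) = 1" by (simp add: cis_mult)
    moreover have "cis t + cis (- t) = of_real (2 * cos t)" by (simp add: complex_eq_iff)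
    ultimately have "cis t * of_real (2 * cos t - 2) = cis t * (cis t + cis (- t) - 2)" by simp
    also have "\<dots> = (1 - cis t) ^ 2"
      using \<open>cis t * cis (- t) = 1\<close> by (simp add: power2_eq_square algebra_simps)
    finally show ?thesis ..
  qed
  thus ?thesis by (simp add: koebe_def)
qed

text \<open>This term yields the constant \<open>-3\<close> of \<open>E\<^sub>2\<^sub>4\<^sub>,\<^sub>1\<close>, after division by the Gauss sum \<open>2 \<surd>6\<close>.  With
  \<open>c = cos (\<pi> / 12)\<close> and \<open>s = sin (\<pi> / 12)\<close> it only involves \<open>c s = 1 / 4\<close> and \<open>c + s = \<surd>6 / 2\<close>.\<close>

lemma eisenstein_constant_term:
  defines "\<zeta> \<equiv> cis (2 * pi / 24)"
  shows "koebe (\<zeta> ^ 1) + koebe (\<zeta> ^ 5) - koebe (\<zeta> ^ 7) - koebe (\<zeta> ^ 11) = - (6 * of_real (sqrt 6))"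
proof -
  define c s where "c = cos (pi / 12)" and "s = sin (pi / 12)"
  have k: "\<zeta> ^ 1 = cis (pi / 12)" "\<zeta> ^ 5 = cis (pi / 2 - pi / 12)" "\<zeta> ^ 7 = cis (pi / 2 + pi / 12)"
    "\<zeta> ^ 11 = cis (pi - pi / 12)"
    unfolding \<zeta>_def Complex.DeMoivre by (rule arg_cong[of _ _ cis]; simp)+
  have co: "cos (pi / 2 - pi / 12) = s" "cos (pi / 2 + pi / 12) = - s" "cos (pi - pi / 12) = - c"
    unfolding c_def s_def cos_diff cos_add by simp_all
  have cs: "c * s = 1 / 4"
    using sin_double[of "pi / 12"] by (simp add: c_def s_def sin_30 mult.commute)
  have pos: "c > 0" "s > 0" unfolding c_def s_def by (auto intro!: cos_gt_zero sin_gt_zero)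
  have sq: "c ^ 2 + s ^ 2 = 1" by (simp add: c_def s_def)
  have "(c + s) ^ 2 = (sqrt 6 / 2) ^ 2" using cs sq by (simp add: power2_sum power_divide)
  hence sum: "c + s = sqrt 6 / 2" using pos by (subst (asm) power2_eq_iff_nonneg) auto
  have ne: "c \<noteq> 1" "s \<noteq> 1" "- s \<noteq> 1" "- c \<noteq> 1"
  proof -
    have "c ^ 2 < 1" "s ^ 2 < 1" using sq pos by (smt (verit) zero_less_power2)+
    thus "c \<noteq> 1" "s \<noteq> 1" "- s \<noteq> 1" "- c \<noteq> 1" using pos by auto
  qed
  have fr: "1 / (2 * x - 2) - 1 / (2 * (- x) - 2) = - (x / y ^ 2)"
    if "x ^ 2 + y ^ 2 = 1" "x \<noteq> 1" "- x \<noteq> 1" "y \<noteq> 0" for x y :: real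
  proof -
    have "y ^ 2 = (1 - x) * (1 + x)" using that(1) by (simp add: power2_eq_square algebra_simps)
    moreover have "1 - x \<noteq> 0" "1 + x \<noteq> 0" "2 * x - 2 \<noteq> 0" "- 2 * x - 2 \<noteq> 0" using that by auto
    ultimately show ?thesis by (simp add: divide_simps) (simp add: algebra_simps)
  qed
  have "koebe (\<zeta> ^ 1) + koebe (\<zeta> ^ 5) - koebe (\<zeta> ^ 7) - koebe (\<zeta> ^ 11) = 
     of_real ((1 / (2 * c - 2) - 1 / (2 * (- c) - 2)) + (1 / (2 * s - 2) - 1 / (2 * (- s) - 2)))"
    unfolding k using koebe_cis[of "pi / 12", folded c_def] koebe_cis[of "pi / 2 - pi / 12", unfolded co]
      koebe_cis[of "pi / 2 + pi / 12", unfolded co] koebe_cis[of "pi - pi / 12", unfolded co] ne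
    by (simp only: of_real_add of_real_diff not_False_eq_True) (simp only: algebra_simps)
  also have "(1 / (2 * c - 2) - 1 / (2 * (- c) - 2)) + (1 / (2 * s - 2) - 1 / (2 * (- s) - 2)) = - (c / s ^ 2) - s / c ^ 2"
    using fr[of c s] fr[of s c] sq ne pos by (simp add: add.commute)
  also have "\<dots> = - ((c + s) * (c ^ 2 + s ^ 2 - c * s)) / (c * s) ^ 2"
    using pos by (simp add: divide_simps power2_eq_square) (simp add: algebra_simps)
  also have "\<dots> = - (6 * sqrt 6)" unfolding sum sq cs by (simp add: power2_eq_square)
  finally show ?thesis by simp
qed

text \<open>For nome \<open>q\<close> itself all arguments can be moved onto the unit circle, and the term \<open>koebe c\<close> stays
  apart from the Lambert series.\<close>

lemma wp_sums_regular:
  assumes "norm q < 1" "q \<noteq> 0" "c \<noteq> 0"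
  shows "(\<lambda>n. koebe (c * q ^ Suc n) + koebe ((1 / c) * q ^ Suc n)) sums (wp (c * q ^ i) q - koebe c)"
proof -
  have "wp (c * q ^ i) q = wp c q"
  proof (induction i)
    case (Suc i)
    have "wp (c * q ^ Suc i) q = wp (q * (c * q ^ i)) q" by (simp add: mult_ac)
    thus ?case using wp_mult_nome[OF assms(1,2), of "c * q ^ i"] Suc assms by simp
  qed simp
  moreover have "(\<lambda>n. koebe (c * q ^ Suc n) + koebe (q ^ Suc n / c)) sums wp_reg c q"
    unfolding wp_reg_def by (intro sums_add summable_sums summable_koebe_powers_Suc assms)
  ultimately show ?thesis by (simp add: wp_eq_koebe_plus_reg[OF assms(1)])
qed

text \<open>The characters are matched termwise: \<open>wp\<close> at \<open>T\<^sup>k\<close> contributes the arguments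
  \<open>\<zeta>\<^sup>\<plusminus>\<^sup>k q\<^sup>d\<close> with \<open>d\<close> congruent to \<open>\<plusminus> k\<close> modulo \<open>M\<close>, and the signs of \<open>k = 1, 5, 7, 11\<close> are the values
  of \<^term>\<open>chi24\<close>, the product of the two characters involved.\<close>

lemma Eis_as_wp:
  assumes z: "Im z > 0"
  defines "q \<equiv> exp (2 * pi * \<i> * z)"
  defines "X \<equiv> \<lambda>M L k. wp (cis (2 * pi * (real k / real L)) * q ^ k) (q ^ M)"
  shows "X 24 1 1 + X 24 1 5 - X 24 1 7 - X 24 1 11 = Eis 1 24 z"
    and "X 1 24 1 + X 1 24 5 - X 1 24 7 - X 1 24 11 = 2 * of_real (sqrt 6) * Eis 24 1 z"
    and "X 3 8 1 + X 3 8 5 - X 3 8 7 - X 3 8 11 = 2 * \<i> * of_real (sqrt 2) * Eis (-8) (-3) z"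
    and "X 8 3 1 + X 8 3 5 - X 8 3 7 - X 8 3 11 = \<i> * of_real (sqrt 3) * Eis (-3) (-8) z"
proof -
  have q: "norm q < 1" "q \<noteq> 0" using z by (simp_all add: q_def)
  have qz: "exp (2 * of_real pi * \<i> * z) = q" by (simp add: q_def)
  have Eis: "Eis 1 24 z = (\<Sum>n. sigma_chars (\<lambda>_. 1) (\<lambda>m. of_int (chi24 m)) (Suc n) * q ^ Suc n)"
     "Eis 24 1 z = - 3 + (\<Sum>n. sigma_chars (\<lambda>m. of_int (chi24 m)) (\<lambda>_. 1) (Suc n) * q ^ Suc n)"
     "Eis (-8) (-3) z = (\<Sum>n. sigma_chars (\<lambda>m. of_int (chi8 m)) (\<lambda>m. of_int (chi3 m)) (Suc n) * q ^ Suc n)"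
     "Eis (-3) (-8) z = (\<Sum>n. sigma_chars (\<lambda>m. of_int (chi3 m)) (\<lambda>m. of_int (chi8 m)) (Suc n) * q ^ Suc n)"
    unfolding Eis_def qz by (simp_all only: sigma_chars_tables zero_less_Suc) (simp_all add: eis_const_def)
  have cisL: "cis (2 * pi * (real k / real L)) = cis (2 * pi / real L) ^ k" for k L
    unfolding Complex.DeMoivre by (simp add: mult_ac)
  have cis1: "cis (2 * pi * (real k / real 1)) = 1" for k by (simp add: cis_multiple_2pi)
  note simps = lessThan_nat_numeral lessThan_Suc
  have "(\<lambda>n. \<Sum>j<24. of_int (chi24 (Suc j)) * (\<Sum>a\<in>{0}. 1 * koebe (1 ^ a * q ^ (n * 24 + Suc j)))) sums
           (1 * (\<Sum>n. sigma_chars (\<lambda>_. 1) (\<lambda>m. of_int (chi24 m)) (Suc n) * q ^ Suc n))"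
    by (rule eis_series_sums) (use q in \<open>auto simp: norm_chi_le_1 chi_periodic\<close>)
  moreover have "(\<lambda>n. \<Sum>j<24. of_int (chi24 (Suc j)) * (\<Sum>a\<in>{0}. 1 * koebe (1 ^ a * q ^ (n * 24 + Suc j)))) sums
     (X 24 1 1 + X 24 1 5 - X 24 1 7 - X 24 1 11)"
    unfolding X_def cis1
    using sums_diff[OF sums_diff[OF sums_add[OF wp_sums[OF q, of 24 1 1 0] wp_sums[OF q, of 24 5 1 0]] 
         wp_sums[OF q, of 24 7 1 0]] wp_sums[OF q, of 24 11 1 0]]
    by (simp add: simps chi24_def algebra_simps numeral_2_eq_2[symmetric] del: power_Suc)
  ultimately show "X 24 1 1 + X 24 1 5 - X 24 1 7 - X 24 1 11 = Eis 1 24 z"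
    unfolding Eis using sums_unique2 by fastforce
  define \<zeta> where "\<zeta> = cis (2 * pi / real 8)"
  have \<zeta>8: "\<zeta> ^ 8 = 1" unfolding \<zeta>_def Complex.DeMoivre by simp
  define c8 :: "nat \<Rightarrow> complex" where "c8 = (\<lambda>a. of_int (chi8 a))"
  have inv8: "1 / \<zeta> ^ a = \<zeta> ^ (8 - a)" if "a \<le> 8" for a
  proof -
    have "\<zeta> ^ (8 - a) * \<zeta> ^ a = 1" using that by (simp add: \<zeta>8 flip: power_add)
    thus ?thesis by (metis nonzero_divide_eq_eq mult_zero_right zero_neq_one)
  qed
  have "(\<lambda>n. \<Sum>j<3. of_int (chi3 (Suc j)) * (\<Sum>a\<in>{1, 3, 5, 7}. c8 a * koebe (\<zeta> ^ a * q ^ (n * 3 + Suc j)))) sums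
           (2 * \<i> * of_real (sqrt 2) * (\<Sum>n. sigma_chars (\<lambda>m. of_int (chi8 m)) (\<lambda>m. of_int (chi3 m)) (Suc n) * q ^ Suc n))"
  proof (rule eis_series_sums)
    show "2 * \<i> * of_real (sqrt 2) * of_int (chi8 (Suc m)) = (\<Sum>a\<in>{1, 3, 5, 7}. c8 a * (\<zeta> ^ a) ^ Suc m)" for m
      unfolding gauss_sum_8 by (simp add: c8_def chi8_def \<zeta>_def)
  qed (use q in \<open>auto simp: norm_chi_le_1 chi_periodic \<zeta>_def\<close>)
  moreover have "(\<lambda>n. \<Sum>j<3. of_int (chi3 (Suc j)) * (\<Sum>a\<in>{1, 3, 5, 7}. c8 a * koebe (\<zeta> ^ a * q ^ (n * 3 + Suc j)))) sums
     (X 3 8 1 + X 3 8 5 - X 3 8 7 - X 3 8 11)"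
  proof -
    have z11: "\<zeta> ^ 11 = \<zeta> ^ 3" using power_add[of \<zeta> 8 3] by (simp add: \<zeta>8)
    have nz: "\<zeta> \<noteq> 0" "\<zeta> ^ a \<noteq> 0" for a by (simp_all add: \<zeta>_def)
    have div: "x / \<zeta> = \<zeta> ^ 7 * x" for x using inv8[of 1] by (simp add: divide_inverse mult.commute)
    show ?thesis
      unfolding X_def cisL \<zeta>_def[symmetric] z11
      using sums_diff[OF sums_diff[OF sums_add[OF wp_sums[OF q, of 3 1 "\<zeta> ^ 1" 0] wp_sums[OF q, of 3 2 "\<zeta> ^ 5" 1]] 
         wp_sums[OF q, of 3 1 "\<zeta> ^ 7" 2]] wp_sums[OF q, of 3 2 "\<zeta> ^ 3" 3]] 
      by (simp add: nz inv8 div simps chi3_def chi8_def c8_def algebra_simps numeral_2_eq_2[symmetric] del: power_Suc)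
  qed
  ultimately show "X 3 8 1 + X 3 8 5 - X 3 8 7 - X 3 8 11 = 2 * \<i> * of_real (sqrt 2) * Eis (-8) (-3) z"
    unfolding Eis using sums_unique2 by fastforce
  define \<epsilon> where "\<epsilon> = cis (2 * pi / real 24)"
  have "real 24 * (2 * pi / real 24) = 2 * pi" by simp
  hence \<epsilon>24: "\<epsilon> ^ 24 = 1" unfolding \<epsilon>_def Complex.DeMoivre by (simp only: cis_2pi)
  define c24 :: "nat \<Rightarrow> complex" where "c24 = (\<lambda>a. of_int (chi24 a))"
  have inv24: "1 / \<epsilon> ^ a = \<epsilon> ^ (24 - a)" if "a \<le> 24" for a
  proof -
    have "\<epsilon> ^ (24 - a) * \<epsilon> ^ a = 1" using that by (simp add: \<epsilon>24 flip: power_add)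
    thus ?thesis by (metis nonzero_divide_eq_eq mult_zero_right zero_neq_one)
  qed
  let ?A = "{1, 5, 7, 11, 13, 17, 19, 23} :: nat set"
  have "(\<lambda>n. \<Sum>j<1. 1 * (\<Sum>a\<in>?A. c24 a * koebe (\<epsilon> ^ a * q ^ (n * 1 + Suc j)))) sums
           (2 * of_real (sqrt 6) * (\<Sum>n. sigma_chars (\<lambda>m. of_int (chi24 m)) (\<lambda>_. 1) (Suc n) * q ^ Suc n))"
  proof (rule eis_series_sums)
    show "2 * of_real (sqrt 6) * of_int (chi24 (Suc m)) = (\<Sum>a\<in>?A. c24 a * (\<epsilon> ^ a) ^ Suc m)" for m
      unfolding gauss_sum_24 by (simp add: c24_def chi24_def \<epsilon>_def)
  qed (use q in \<open>auto simp: norm_chi_le_1 \<epsilon>_def\<close>)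
  moreover have "(\<lambda>n. \<Sum>j<1. 1 * (\<Sum>a\<in>?A. c24 a * koebe (\<epsilon> ^ a * q ^ (n * 1 + Suc j)))) sums
     (X 1 24 1 + X 1 24 5 - X 1 24 7 - X 1 24 11 
        - (koebe (\<epsilon> ^ 1) + koebe (\<epsilon> ^ 5) - koebe (\<epsilon> ^ 7) - koebe (\<epsilon> ^ 11)))"
  proof -
    have nz: "\<epsilon> ^ a \<noteq> 0" for a by (simp add: \<epsilon>_def)
    have div: "x / \<epsilon> = \<epsilon> ^ 23 * x" for x using inv24[of 1] by (simp add: divide_inverse mult.commute)
    show ?thesis
      unfolding X_def cisL \<epsilon>_def[symmetric]
      using sums_diff[OF sums_diff[OF sums_add[OF wp_sums_regular[OF q nz, of 1 1] wp_sums_regular[OF q nz, of 5 5]] 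
         wp_sums_regular[OF q nz, of 7 7]] wp_sums_regular[OF q nz, of 11 11]]
      by (simp add: inv24 div chi24_def c24_def algebra_simps)
  qed
  moreover define S where "S = (\<Sum>n. sigma_chars (\<lambda>m. of_int (chi24 m)) (\<lambda>_. 1) (Suc n) * q ^ Suc n)"
  ultimately have "X 1 24 1 + X 1 24 5 - X 1 24 7 - X 1 24 11 
        - (koebe (\<epsilon> ^ 1) + koebe (\<epsilon> ^ 5) - koebe (\<epsilon> ^ 7) - koebe (\<epsilon> ^ 11)) = 2 * of_real (sqrt 6) * S"
    using sums_unique2 by fastforce
  moreover have "koebe (\<epsilon> ^ 1) + koebe (\<epsilon> ^ 5) - koebe (\<epsilon> ^ 7) - koebe (\<epsilon> ^ 11) = - (6 * of_real (sqrt 6))"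
    using eisenstein_constant_term by (simp add: \<epsilon>_def)
  ultimately have "X 1 24 1 + X 1 24 5 - X 1 24 7 - X 1 24 11 = 2 * of_real (sqrt 6) * S + - (6 * of_real (sqrt 6))"
    by (simp only: diff_eq_eq)
  hence "X 1 24 1 + X 1 24 5 - X 1 24 7 - X 1 24 11 = 2 * of_real (sqrt 6) * (- 3 + S)"
    by (simp add: algebra_simps)
  thus "X 1 24 1 + X 1 24 5 - X 1 24 7 - X 1 24 11 = 2 * of_real (sqrt 6) * Eis 24 1 z"
    unfolding Eis S_def .
  define \<omega> where "\<omega> = cis (2 * pi / real 3)"
  have "real 3 * (2 * pi / real 3) = 2 * pi" by simp
  hence \<omega>3: "\<omega> ^ 3 = 1" unfolding \<omega>_def Complex.DeMoivre by (simp only: cis_2pi)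
  have "(\<lambda>n. \<Sum>j<8. of_int (chi8 (Suc j)) * (\<Sum>a\<in>{1, 2}. of_int (chi3 a) * koebe (\<omega> ^ a * q ^ (n * 8 + Suc j)))) sums
           (\<i> * of_real (sqrt 3) * (\<Sum>n. sigma_chars (\<lambda>m. of_int (chi3 m)) (\<lambda>m. of_int (chi8 m)) (Suc n) * q ^ Suc n))"
  proof (rule eis_series_sums)
    show "\<i> * of_real (sqrt 3) * of_int (chi3 (Suc m)) = (\<Sum>a\<in>{1, 2}. of_int (chi3 a) * (\<omega> ^ a) ^ Suc m)" for m
      unfolding gauss_sum_3 by (simp add: chi3_def \<omega>_def)
  qed (use q in \<open>auto simp: norm_chi_le_1 chi_periodic \<omega>_def\<close>)
  moreover have "(\<lambda>n. \<Sum>j<8. of_int (chi8 (Suc j)) * (\<Sum>a\<in>{1, 2}. of_int (chi3 a) * koebe (\<omega> ^ a * q ^ (n * 8 + Suc j)))) sums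
     (X 8 3 1 + X 8 3 5 - X 8 3 7 - X 8 3 11)"
  proof -
    have "\<omega> ^ (3 * n + j) = \<omega> ^ j" for n j by (simp add: power_add power_mult \<omega>3)
    from this[of 1 2] this[of 2 1] this[of 3 2]
    have w: "\<omega> ^ 5 = \<omega> ^ 2" "\<omega> ^ 7 = \<omega> ^ 1" "\<omega> ^ 11 = \<omega> ^ 2" by simp_all
    have nz: "\<omega> \<noteq> 0" "\<omega> ^ a \<noteq> 0" for a by (simp_all add: \<omega>_def)
    have "\<omega> * \<omega> ^ 2 = 1" using \<omega>3 by (simp add: eval_nat_numeral mult.assoc)
    hence inv3: "x / \<omega> = \<omega> ^ 2 * x" "x / \<omega> ^ 2 = \<omega> * x" for x
      using nz by (simp_all add: divide_eq_eq mult.assoc) (simp_all add: mult_ac)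
    show ?thesis
      unfolding X_def cisL \<omega>_def[symmetric] w
      using sums_diff[OF sums_diff[OF sums_add[OF wp_sums[OF q, of 8 1 "\<omega> ^ 1" 0] wp_sums[OF q, of 8 5 "\<omega> ^ 2" 0]] 
         wp_sums[OF q, of 8 7 "\<omega> ^ 1" 0]] wp_sums[OF q, of 8 3 "\<omega> ^ 2" 1]] 
      by (simp add: nz inv3 simps Suc3_eq_add_3 chi3_def chi8_def algebra_simps numeral_2_eq_2[symmetric] del: power_Suc)
  qed
  ultimately show "X 8 3 1 + X 8 3 5 - X 8 3 7 - X 8 3 11 = \<i> * of_real (sqrt 3) * Eis (-3) (-8) z"
    unfolding Eis using sums_unique2 by fastforce
qed

section \<open>Three-term theta relations\<close>

text \<open>The identity \<open>(\<alpha> - \<beta>) (\<gamma> - \<delta>) + (\<alpha> - \<gamma>) (\<delta> - \<beta>) + (\<alpha> - \<delta>) (\<beta> - \<gamma>) = 0\<close> between four values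
  of \<^term>\<open>wp\<close>, with every difference replaced by its product.\<close>

lemma theta_weierstrass:
  assumes p: "norm p < 1" "p \<noteq> 0"
    and nz: "a \<noteq> 0" "b \<noteq> 0" "c \<noteq> 0" "d \<noteq> 0" "theta a p \<noteq> 0" "theta b p \<noteq> 0" "theta c p \<noteq> 0" "theta d p \<noteq> 0"
  shows "b * d * theta (a * b) p * theta (a / b) p * theta (c * d) p * theta (c / d) p +
         c * b * theta (a * c) p * theta (a / c) p * theta (d * b) p * theta (d / b) p +
         d * c * theta (a * d) p * theta (a / d) p * theta (b * c) p * theta (b / c) p = 0"
proof -
  define e where "e = qpoch p p ^ 4"
  have e: "e \<noteq> 0" using qpoch_nome_nonzero[OF p(1)] by (simp add: e_def)
  define D where "D = (theta a p * theta b p * theta c p * theta d p) ^ 2"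
  have diff: "(wp x p - wp y p) * (theta x p ^ 2 * theta y p ^ 2) = - y * e * theta (x * y) p * theta (x / y) p"
    if "x \<noteq> 0" "theta x p \<noteq> 0" "y \<noteq> 0" "theta y p \<noteq> 0" for x y
    using wp_diff_theta[OF p that] that by (simp add: e_def)
  have "((wp a p - wp b p) * (wp c p - wp d p) + (wp a p - wp c p) * (wp d p - wp b p)
        + (wp a p - wp d p) * (wp b p - wp c p)) * D = 0"
    by (simp add: algebra_simps)
  hence "((wp a p - wp b p) * (theta a p ^ 2 * theta b p ^ 2)) * ((wp c p - wp d p) * (theta c p ^ 2 * theta d p ^ 2)) +
         ((wp a p - wp c p) * (theta a p ^ 2 * theta c p ^ 2)) * ((wp d p - wp b p) * (theta d p ^ 2 * theta b p ^ 2)) +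
         ((wp a p - wp d p) * (theta a p ^ 2 * theta d p ^ 2)) * ((wp b p - wp c p) * (theta b p ^ 2 * theta c p ^ 2)) = 0"
    unfolding D_def power_mult_distrib by (simp only: distrib_left distrib_right mult_ac)
  hence "e ^ 2 * (b * d * theta (a * b) p * theta (a / b) p * theta (c * d) p * theta (c / d) p +
         c * b * theta (a * c) p * theta (a / c) p * theta (d * b) p * theta (d / b) p +
         d * c * theta (a * d) p * theta (a / d) p * theta (b * c) p * theta (b / c) p) = 0"
    unfolding diff[OF nz(1,5,2,6)] diff[OF nz(3,7,4,8)] diff[OF nz(1,5,3,7)] diff[OF nz(4,8,2,6)]
      diff[OF nz(1,5,4,8)] diff[OF nz(2,6,3,7)]
    by (simp add: power2_eq_square algebra_simps)
  thus ?thesis using e by simp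
qed

lemma theta_nonzero:
  assumes "norm p < norm x" "norm x \<le> 1" "norm p < 1" "x \<noteq> 1"
  shows "theta x p \<noteq> 0"
proof
  assume "theta x p = 0"
  then consider n where "x * p ^ n = 1" | n where "p / x * p ^ n = 1"
    using qpoch_eq_0_iff[OF assms(3)] by (auto simp: theta_def)
  thus False
  proof cases
    case (1 n)
    hence *: "norm x * norm p ^ n = 1" by (metis norm_mult norm_one norm_power)
    show False
    proof (cases n)
      case 0
      thus ?thesis using 1 assms by simp
    next
      case (Suc m)
      have "norm p ^ n \<le> norm p" using power_decreasing[of 1 n "norm p"] assms Suc by simp
      hence "norm x * norm p ^ n \<le> 1 * norm p" using assms by (intro mult_mono) auto
      thus ?thesis using * assms by simp
    qed
  next
    case (2 n)
    hence *: "norm (p / x) * norm p ^ n = 1" by (metis norm_mult norm_one norm_power)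
    have "norm (p / x) < 1" using assms by (simp add: norm_divide divide_less_eq)
    moreover have "norm (p / x) * norm p ^ n \<le> norm (p / x)" using assms by (intro mult_left_le) (auto simp: power_le_one)
    ultimately show False using * by simp
  qed
qed

lemma epoch_power: "epoch (q ^ k) d = epoch q (k * d)"
  by (simp add: epoch_def power_mult[symmetric])

lemma epoch_dissect:
  assumes "norm x < 1" "d > 0" "k > 0"
  shows "epoch x d = (\<Prod>j<k. qpoch (x ^ (d * (j + 1))) (x ^ (d * k)))"
proof -
  have "norm (x ^ d) < 1" using assms by (simp add: norm_power power_less_one_iff)
  from qpoch_dissect[OF this assms(3), of "x ^ d"] show ?thesis
    by (simp add: epoch_def power_mult[symmetric] power_add[symmetric] algebra_simps)
qed

text \<open>Each product over the residues prime to 2, 3, 4, 6 or 12 is obtained by inclusion and exclusion.\<close>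

lemma theta_at_divisions:
  assumes x: "norm x < 1" "x \<noteq> 0"
  shows "theta x (x ^ 2) = (epoch x 1 / epoch x 2) ^ 2"
    and "theta x (x ^ 4) = epoch x 1 / epoch x 2"
    and "theta x (x ^ 3) = epoch x 1 / epoch x 3"
    and "theta x (x ^ 6) = epoch x 1 * epoch x 6 / (epoch x 2 * epoch x 3)"
    and "theta x (x ^ 12) * theta (x ^ 5) (x ^ 12) = epoch x 1 * epoch x 6 / (epoch x 2 * epoch x 3)"
proof -
  note nz = epoch_nonzero[OF x(1)]
  have div: "x ^ a / x ^ b = x ^ (a - b)" if "b \<le> a" for a b
    using that x(2) power_diff[of x b a] by simp
  have div1: "x ^ a / x = x ^ (a - 1)" if "a \<ge> 1" for a
    using that x(2) power_diff[of x 1 a] by simp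
  note simps = lessThan_nat_numeral lessThan_Suc numeral_2_eq_2[symmetric]
  have "epoch x 1 = qpoch x (x ^ 2) * qpoch (x ^ 2) (x ^ 2)"
    using epoch_dissect[OF x(1), of 1 2] by (simp add: simps del: power_Suc)
  thus "theta x (x ^ 2) = (epoch x 1 / epoch x 2) ^ 2"
    using nz[of 2] by (simp add: theta_def div1 epoch_def power2_eq_square[of "_ / _"]) (simp add: power2_eq_square)?
  have "epoch x 1 = theta x (x ^ 4) * epoch x 2"
    using epoch_dissect[OF x(1), of 1 4] epoch_dissect[OF x(1), of 2 2]
    by (simp add: simps theta_def div div1 mult_ac del: power_Suc)
  thus "theta x (x ^ 4) = epoch x 1 / epoch x 2" using nz[of 2] by simp
  have "epoch x 1 = theta x (x ^ 3) * epoch x 3"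
    using epoch_dissect[OF x(1), of 1 3] epoch_dissect[OF x(1), of 3 1]
    by (simp add: simps theta_def div div1 mult_ac del: power_Suc)
  thus "theta x (x ^ 3) = epoch x 1 / epoch x 3" using nz[of 3] by simp
  have "epoch x 1 * epoch x 6 = theta x (x ^ 6) * (epoch x 2 * epoch x 3)"
    using epoch_dissect[OF x(1), of 1 6] epoch_dissect[OF x(1), of 2 3] epoch_dissect[OF x(1), of 3 2]
      epoch_dissect[OF x(1), of 6 1]
    by (simp add: simps theta_def div div1 mult_ac del: power_Suc)
  thus "theta x (x ^ 6) = epoch x 1 * epoch x 6 / (epoch x 2 * epoch x 3)"
    using nz[of 2] nz[of 3] by (simp add: eq_divide_eq)
  have "epoch x 1 * epoch x 6 = theta x (x ^ 12) * theta (x ^ 5) (x ^ 12) * (epoch x 2 * epoch x 3)"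
    using epoch_dissect[OF x(1), of 1 12] epoch_dissect[OF x(1), of 2 6] epoch_dissect[OF x(1), of 3 4]
      epoch_dissect[OF x(1), of 6 2]
    by (simp add: simps theta_def div div1 mult_ac del: power_Suc)
  thus "theta x (x ^ 12) * theta (x ^ 5) (x ^ 12) = epoch x 1 * epoch x 6 / (epoch x 2 * epoch x 3)"
    using nz[of 2] nz[of 3] by (simp add: eq_divide_eq)
qed

lemma qpoch_minus: "norm p < 1 \<Longrightarrow> qpoch x p * qpoch (- x) p = qpoch (x ^ 2) (p ^ 2)"
  using qpoch_root_unity[of p 2 x] by (simp add: lessThan_nat_numeral lessThan_Suc mult.commute)

lemma theta_minus: "norm p < 1 \<Longrightarrow> theta x p * theta (- x) p = theta (x ^ 2) (p ^ 2)"
  using qpoch_minus[of p x] qpoch_minus[of p "p / x"] by (simp add: theta_def power_divide mult_ac)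

lemma qpoch_cube:
  assumes "norm p < 1" "\<omega> = cis (2 * pi / 3)"
  shows "qpoch x p * (qpoch (\<omega> * x) p * qpoch (\<omega> ^ 2 * x) p) = qpoch (x ^ 3) (p ^ 3)"
proof -
  have "\<omega> ^ 2 = cis (2 * pi * 2 / 3)" unfolding assms(2) Complex.DeMoivre by simp
  thus ?thesis using qpoch_root_unity[of p 3 x] assms
    by (simp add: lessThan_nat_numeral lessThan_Suc mult_ac)
qed

lemma theta_cube:
  assumes "norm p < 1" "\<omega> = cis (2 * pi / 3)"
  shows "theta x p * (theta (\<omega> * x) p * theta (\<omega> ^ 2 * x) p) = theta (x ^ 3) (p ^ 3)"
proof -
  have "real 3 * (2 * pi / 3) = 2 * pi" by simp
  hence w3: "\<omega> ^ 3 = 1" unfolding assms(2) Complex.DeMoivre by (simp only: cis_2pi)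
  have w: "\<omega> \<noteq> 0" by (simp add: assms(2))
  have d: "p / (\<omega> * x) = \<omega> ^ 2 * (p / x)" "p / (\<omega> ^ 2 * x) = \<omega> * (p / x)"
    using w w3 by (simp_all add: divide_simps) (simp_all add: eval_nat_numeral mult_ac)
  have "theta x p * (theta (\<omega> * x) p * theta (\<omega> ^ 2 * x) p) = 
      (qpoch x p * (qpoch (\<omega> * x) p * qpoch (\<omega> ^ 2 * x) p)) *
      (qpoch (p / x) p * (qpoch (\<omega> * (p / x)) p * qpoch (\<omega> ^ 2 * (p / x)) p))"
    unfolding theta_def d by (simp only: mult_ac)
  also have "\<dots> = theta (x ^ 3) (p ^ 3)"
    unfolding qpoch_cube[OF assms] theta_def power_divide ..
  finally show ?thesis .
qed

lemma mult_power_neq_one: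
  fixes q s :: complex
  assumes "norm q < 1" "k > 0" "norm s = 1"
  shows "s * q ^ k \<noteq> 1"
proof
  assume "s * q ^ k = 1"
  hence "norm q ^ k = 1" using assms by (metis mult_1 norm_mult norm_one norm_power)
  moreover have "norm q ^ k < 1" using assms by (simp add: power_less_one_iff)
  ultimately show False by simp
qed

text \<open>The three-term relation at the points \<open>-1, q\<^sup>2, q\<^sup>3, - q\<^sup>4\<close> for the nome \<open>q\<^sup>1\<^sup>2\<close>.  The values of \<^term>\<open>wp\<close> there
  have the cross-ratio \<open>- t\<close>.\<close>

lemma theta_relation_nome_12:
  assumes q: "norm q < 1" "q \<noteq> 0"
  defines "T \<equiv> \<lambda>x. theta x (q ^ 12)"
  shows "T (q ^ 4) ^ 2 * (T q * T (q ^ 5)) + q * T (- (q ^ 2)) ^ 2 * (T (- q) * T (- (q ^ 5))) =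
          T (- (q ^ 3)) ^ 2 * T (- (q ^ 6)) * T (- (q ^ 2))"
proof -
  define p where "p = q ^ 12"
  have p: "norm p < 1" "p \<noteq> 0" using q by (simp_all add: p_def norm_power power_less_one_iff)
  have lt: "norm q ^ a < norm q ^ b" if "b < a" for a b using that q by (intro power_strict_decreasing) auto
  have nz: "T (-1) \<noteq> 0" "T (q ^ 2) \<noteq> 0" "T (q ^ 3) \<noteq> 0" "T (- (q ^ 4)) \<noteq> 0"
  proof -
    note ne1 = mult_power_neq_one[OF q(1)]
    show "T (-1) \<noteq> 0" "T (q ^ 2) \<noteq> 0" "T (q ^ 3) \<noteq> 0" "T (- (q ^ 4)) \<noteq> 0"
      unfolding T_def p_def[symmetric]
      using p q lt[of 2 12] lt[of 3 12] lt[of 4 12] ne1[of 2 1] ne1[of 3 1] ne1[of 4 "-1"]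
      by (intro theta_nonzero; simp add: norm_power p_def power_le_one)+
  qed
  have Tfold: "theta x p = T x" for x by (simp add: T_def p_def)
  have inv: "T (1 / x) = - T x / x" if "x \<noteq> 0" for x
    unfolding T_def p_def[symmetric] by (rule theta_inverse[OF p(1) that])
  have refl: "T (p / x) = T x" for x
    unfolding T_def p_def[symmetric] by (rule theta_reflect[OF p(2)])
  have r: "T (- (q ^ 7)) = T (- (q ^ 5))" using refl[of "- (q ^ 5)"] power_diff[of q 5 12] q by (simp add: p_def)
  have i: "T (-1 / q ^ 2) = T (- (q ^ 2)) / q ^ 2" "T (-1 / q) = T (- q) / q" "T (- 1 / q ^ 3) = T (- (q ^ 3)) / q ^ 3"
    "T (1 / q ^ 4) = - T (q ^ 4) / q ^ 4" "T (1 / q) = - T q / q"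
    using inv[of "- (q ^ 2)"] inv[of "- q"] inv[of "- (q ^ 3)"] inv[of "q ^ 4"] inv[of q] q by simp_all
  have quot: "q ^ 3 / - (q ^ 4) = - 1 / q" "- (q ^ 4) / q ^ 2 = - (q ^ 2)" "-1 / - (q ^ 4) = 1 / q ^ 4"
     "q ^ 2 / q ^ 3 = 1 / q"
    using q by (simp_all add: field_simps eval_nat_numeral)
  have mul: "-1 * q ^ 2 = - (q ^ 2)" "q ^ 3 * - (q ^ 4) = - (q ^ 7)" "-1 * q ^ 3 = - (q ^ 3)" 
     "- (q ^ 4) * q ^ 2 = - (q ^ 6)" "-1 * - (q ^ 4) = q ^ 4" "q ^ 2 * q ^ 3 = q ^ 5"
    by (simp_all flip: power_add)
  have nz0: "(-1 :: complex) \<noteq> 0" "q ^ 2 \<noteq> 0" "q ^ 3 \<noteq> 0" "- (q ^ 4) \<noteq> 0" using q by auto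
  have "q ^ 2 * - (q ^ 4) * T (- (q ^ 2)) * (T (- (q ^ 2)) / q ^ 2) * T (- (q ^ 5)) * (T (- q) / q) +
     q ^ 3 * q ^ 2 * T (- (q ^ 3)) * (T (- (q ^ 3)) / q ^ 3) * T (- (q ^ 6)) * T (- (q ^ 2)) +
     - (q ^ 4) * q ^ 3 * T (q ^ 4) * (- T (q ^ 4) / q ^ 4) * T (q ^ 5) * (- T q / q) = 0"
    using theta_weierstrass[OF p nz0 nz[unfolded T_def p_def[symmetric]]]
    unfolding quot mul by (simp only: Tfold i r)
  hence "q ^ 2 * (T (q ^ 4) ^ 2 * (T q * T (q ^ 5)) + q * T (- (q ^ 2)) ^ 2 * (T (- q) * T (- (q ^ 5)))
     - T (- (q ^ 3)) ^ 2 * T (- (q ^ 6)) * T (- (q ^ 2))) = 0"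
    using q by (simp add: field_simps eval_nat_numeral)
  thus ?thesis using q by simp
qed

text \<open>The three-term relation at the points \<open>\<omega>, q, - \<omega>\<^sup>2 q\<^sup>2, - q\<^sup>2\<close> for the nome \<open>q\<^sup>4\<close>, where the
  cross-ratio is \<open>- 3 t\<close>.  The coefficient 3 comes from \<open>- \<omega> (1 - \<omega>\<^sup>2)\<^sup>2 = 3\<close>, where \<open>1 - \<omega>\<^sup>2\<close> is the constant factor
  of the theta function at the root of unity \<open>\<omega>\<^sup>2\<close>.\<close>

lemma theta_relation_nome_4:
  fixes \<omega> :: complex
  assumes q: "norm q < 1" "q \<noteq> 0" and w: "\<omega> = cis (2 * pi / 3)"
  defines "T \<equiv> \<lambda>x. theta x (q ^ 4)"
  shows "3 * q * (T (\<omega> * q) * T (\<omega> ^ 2 * q)) * (epoch q 12 / epoch q 4) ^ 2 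
            + T (- (\<omega> * q ^ 2)) ^ 2 * (T (- (\<omega> * q)) * T (- (\<omega> ^ 2 * q))) =
          T (- (q ^ 2)) * T (- (\<omega> * q ^ 2)) * T (- q) ^ 2"
proof -
  define p where "p = q ^ 4"
  have p: "norm p < 1" "p \<noteq> 0" using q by (simp_all add: p_def norm_power power_less_one_iff)
  have "real 3 * (2 * pi / 3) = 2 * pi" by simp
  hence w3: "\<omega> ^ 3 = 1" unfolding w Complex.DeMoivre by (simp only: cis_2pi)
  have wn: "norm \<omega> = 1" "\<omega> \<noteq> 0" by (simp_all add: w)
  have w1: "\<omega> \<noteq> 1"
  proof -
    have "sin (2 * pi / 3) > 0" by (intro sin_gt_zero) auto
    hence "Im \<omega> \<noteq> 0" by (simp add: w)
    thus ?thesis by auto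
  qed
  have wsum: "1 + \<omega> + \<omega> ^ 2 = 0"
  proof -
    have "(1 - \<omega>) * (1 + \<omega> + \<omega> ^ 2) = 1 - \<omega> ^ 3" by (simp add: eval_nat_numeral algebra_simps)
    thus ?thesis using w1 w3 by simp
  qed
  have winv: "1 / \<omega> = \<omega> ^ 2" "1 / \<omega> ^ 2 = \<omega>"
    using wn w3 by (simp_all add: divide_simps) (simp_all add: eval_nat_numeral mult_ac)
  have lt: "norm q ^ a < norm q ^ b" if "b < a" for a b using that q by (intro power_strict_decreasing) auto
  have nz: "T \<omega> \<noteq> 0" "T q \<noteq> 0" "T (- (\<omega> ^ 2 * q ^ 2)) \<noteq> 0" "T (- (q ^ 2)) \<noteq> 0"
    unfolding T_def p_def[symmetric]
    using p q lt[of 2 4] lt[of 1 4] mult_power_neq_one[OF q(1), of 2 "- (\<omega> ^ 2)"] 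
      mult_power_neq_one[OF q(1), of 2 "-1"] mult_power_neq_one[OF q(1), of 1 "1"] wn w1
    by (intro theta_nonzero; simp add: norm_power norm_mult p_def power_le_one)+
  have Tfold: "theta x p = T x" for x by (simp add: T_def p_def)
  have inv: "T (1 / x) = - T x / x" if "x \<noteq> 0" for x
    unfolding T_def p_def[symmetric] by (rule theta_inverse[OF p(1) that])
  have refl: "T (p / x) = T x" for x
    unfolding T_def p_def[symmetric] by (rule theta_reflect[OF p(2)])
  have nome: "T (p * x) = - T x / x" if "x \<noteq> 0" for x
    unfolding T_def p_def[symmetric] by (rule theta_mult_nome[OF p(1) that p(2)])
  have i: "T (\<omega> / q) = - (\<omega> * T (\<omega> ^ 2 * q) / q)" "T (p * \<omega> ^ 2) = - (\<omega> * T (\<omega> ^ 2))"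
    "T (- (\<omega> ^ 2 / q ^ 2)) = \<omega> ^ 2 * T (- (\<omega> * q ^ 2)) / q ^ 2" "T (- (q ^ 3)) = T (- q)" 
    "T (- (\<omega> / q ^ 2)) = \<omega> * T (- (\<omega> * q ^ 2)) / q ^ 2"
    "T (- (\<omega> ^ 2 * q ^ 3)) = T (- (\<omega> * q))" "T (- (\<omega> / q)) = \<omega> * T (- (\<omega> ^ 2 * q)) / q"
  proof -
    have w4: "\<omega> ^ 2 * \<omega> ^ 2 = \<omega>" "\<omega> * \<omega> ^ 2 = 1" "\<omega> ^ 2 * \<omega> = 1"
      using w3 by (simp_all add: eval_nat_numeral mult.assoc)
    have e: "\<omega> / q = 1 / (\<omega> ^ 2 * q)" "- (\<omega> ^ 2 / q ^ 2) = 1 / (- (\<omega> * q ^ 2))" "- (q ^ 3) = p / (- q)"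
      "- (\<omega> / q ^ 2) = 1 / (- (\<omega> ^ 2 * q ^ 2))" "- (\<omega> ^ 2 * q ^ 2) = p / (- (\<omega> * q ^ 2))"
      "- (\<omega> ^ 2 * q ^ 3) = p / (- (\<omega> * q))" "- (\<omega> / q) = 1 / (- (\<omega> ^ 2 * q))"
      using q wn w4 by (simp_all add: field_simps p_def) (simp_all add: eval_nat_numeral mult_ac)?
    have x: "x / \<omega> = \<omega> ^ 2 * x" "x / \<omega> ^ 2 = \<omega> * x" for x
      using winv by (simp_all add: divide_inverse mult.commute)
    show "T (\<omega> / q) = - (\<omega> * T (\<omega> ^ 2 * q) / q)"
      unfolding e(1) using inv[of "\<omega> ^ 2 * q"] q wn by (simp add: x divide_divide_eq_left[symmetric])
    show "T (p * \<omega> ^ 2) = - (\<omega> * T (\<omega> ^ 2))"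
      using nome[of "\<omega> ^ 2"] wn by (simp add: x)
    show "T (- (\<omega> ^ 2 / q ^ 2)) = \<omega> ^ 2 * T (- (\<omega> * q ^ 2)) / q ^ 2"
      unfolding e(2) using inv[of "- (\<omega> * q ^ 2)"] q wn by (simp add: x divide_divide_eq_left[symmetric])
    show "T (- (q ^ 3)) = T (- q)" unfolding e(3) by (rule refl)
    show "T (- (\<omega> / q ^ 2)) = \<omega> * T (- (\<omega> * q ^ 2)) / q ^ 2"
    proof -
      have "T (- (\<omega> ^ 2 * q ^ 2)) = T (- (\<omega> * q ^ 2))" unfolding e(5) by (rule refl)
      thus ?thesis unfolding e(4) using inv[of "- (\<omega> ^ 2 * q ^ 2)"] q wn
        by (simp add: x divide_divide_eq_left[symmetric])
    qed
    show "T (- (\<omega> ^ 2 * q ^ 3)) = T (- (\<omega> * q))" unfolding e(6) by (rule refl)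
    show "T (- (\<omega> / q)) = \<omega> * T (- (\<omega> ^ 2 * q)) / q"
      unfolding e(7) using inv[of "- (\<omega> ^ 2 * q)"] q wn by (simp add: x divide_divide_eq_left[symmetric])
  qed
  define G where "G = epoch q 12 / epoch q 4"
  have Tw: "T (\<omega> ^ 2) = (1 - \<omega> ^ 2) * G"
  proof -
    have "p / \<omega> ^ 2 = \<omega> * p" using winv by (simp add: divide_inverse mult.commute)
    hence "T (\<omega> ^ 2) = (1 - \<omega> ^ 2) * (qpoch (\<omega> ^ 2 * p) p * qpoch (\<omega> * p) p)"
      unfolding T_def theta_def p_def[symmetric] qpoch_unfold[OF p(1), of "\<omega> ^ 2"] by simp
    moreover have "qpoch (\<omega> ^ 2 * p) p * qpoch (\<omega> * p) p = G"
    proof -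
      have "qpoch p p * (qpoch (\<omega> * p) p * qpoch (\<omega> ^ 2 * p) p) = epoch q 12"
        unfolding qpoch_cube[OF p(1) w] by (simp add: p_def epoch_def flip: power_mult)
      moreover have "qpoch p p = epoch q 4" by (simp add: p_def epoch_def)
      ultimately show ?thesis using qpoch_nome_nonzero[OF p(1)]
        by (simp add: G_def eq_divide_eq mult_ac)
    qed
    ultimately show ?thesis by simp
  qed
  have quot: "\<omega> / (- (\<omega> ^ 2 * q ^ 2)) = - (\<omega> ^ 2 / q ^ 2)" "- (\<omega> ^ 2 * q ^ 2) / - (q ^ 2) = \<omega> ^ 2"
    "- (q ^ 2) / q = - q" "\<omega> / - (q ^ 2) = - (\<omega> / q ^ 2)" "q / - (\<omega> ^ 2 * q ^ 2) = - (\<omega> / q)"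
    using q winv by (simp_all add: power2_eq_square divide_simps) (simp_all add: mult_ac)?
  have mul: "- (\<omega> ^ 2 * q ^ 2) * - (q ^ 2) = p * \<omega> ^ 2" "\<omega> * - (\<omega> ^ 2 * q ^ 2) = - (q ^ 2)"
    "- (q ^ 2) * q = - (q ^ 3)" "\<omega> * - (q ^ 2) = - (\<omega> * q ^ 2)" "q * - (\<omega> ^ 2 * q ^ 2) = - (\<omega> ^ 2 * q ^ 3)"
    using w3 by (simp_all add: p_def eval_nat_numeral mult_ac)
  have nz0: "\<omega> \<noteq> 0" "q \<noteq> 0" "- (\<omega> ^ 2 * q ^ 2) \<noteq> 0" "- (q ^ 2) \<noteq> 0" using q wn by auto
  define T1 T2 T3 T4 T5 T6 T7 where "T1 = T (\<omega> * q)" and "T2 = T (\<omega> ^ 2 * q)" and "T3 = T (- (q ^ 2))"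
    and "T4 = T (- (\<omega> * q ^ 2))" and "T5 = T (- q)" and "T6 = T (- (\<omega> * q))" and "T7 = T (- (\<omega> ^ 2 * q))"
  have "q * - (q ^ 2) * T1 * (- (\<omega> * T2 / q)) * (- (\<omega> * ((1 - \<omega> ^ 2) * G))) * ((1 - \<omega> ^ 2) * G) +
     - (\<omega> ^ 2 * q ^ 2) * q * T3 * (\<omega> ^ 2 * T4 / q ^ 2) * T5 * T5 +
     - (q ^ 2) * - (\<omega> ^ 2 * q ^ 2) * T4 * (\<omega> * T4 / q ^ 2) * T6 * (\<omega> * T7 / q) = 0"
    using theta_weierstrass[OF p nz0 nz[unfolded T_def p_def[symmetric]]]
    unfolding quot mul(1-5) T1_def T2_def T3_def T4_def T5_def T6_def T7_def
    by (simp only: Tfold i Tw) 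
  hence "q * (\<omega> * (T4 ^ 2 * (T6 * T7)) * \<omega> ^ 3 - \<omega> * \<omega> ^ 3 * (T3 * T4 * T5 ^ 2)
       - q * (\<omega> ^ 2 * (1 - \<omega> ^ 2) ^ 2) * (T1 * T2) * G ^ 2) = 0"
    using q by (simp add: field_simps eval_nat_numeral)
  moreover have "\<omega> ^ 2 * (1 - \<omega> ^ 2) ^ 2 = - (3 * \<omega>)"
  proof -
    have "\<omega> ^ 2 * (1 - \<omega> ^ 2) ^ 2 = \<omega> ^ 2 - 2 * (\<omega> ^ 3 * \<omega>) + (\<omega> ^ 3) ^ 2"
      by (simp add: eval_nat_numeral algebra_simps)
    also have "\<dots> = (1 + \<omega> + \<omega> ^ 2) - 3 * \<omega>" unfolding w3 by simp
    finally show ?thesis unfolding wsum by simp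
  qed
  ultimately have "q * \<omega> * (T4 ^ 2 * (T6 * T7) - T3 * T4 * T5 ^ 2 + 3 * q * (T1 * T2) * G ^ 2) = 0"
    by (simp add: w3 algebra_simps)
  hence "T4 ^ 2 * (T6 * T7) - T3 * T4 * T5 ^ 2 + 3 * q * (T1 * T2) * G ^ 2 = 0"
    using q wn by simp
  hence "3 * q * (T1 * T2) * G ^ 2 + T4 ^ 2 * (T6 * T7) = T3 * T4 * T5 ^ 2"
    by (simp add: algebra_simps)
  thus ?thesis unfolding T1_def T2_def T3_def T4_def T5_def T6_def T7_def G_def .
qed

section \<open>Two additive relations between eta quotients\<close>

text \<open>Changing the sign of the argument doubles all exponents, by \<open>theta_minus\<close>.\<close>

lemma theta_minus_at_divisions:
  assumes x: "norm x < 1" "x \<noteq> 0"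
  defines "e \<equiv> epoch x"
  shows "theta (- x) (x ^ 2) = (e 2 ^ 2 / (e 1 * e 4)) ^ 2"
    and "theta (- x) (x ^ 4) = e 2 ^ 2 / (e 1 * e 4)"
    and "theta (- x) (x ^ 6) = e 2 ^ 2 * e 3 * e 12 / (e 1 * e 4 * e 6 ^ 2)"
    and "theta (- x) (x ^ 12) * theta (- (x ^ 5)) (x ^ 12) = e 2 ^ 2 * e 3 * e 12 / (e 1 * e 4 * e 6 ^ 2)"
    and "qpoch (- x) (x ^ 2) = e 2 ^ 2 / (e 1 * e 4)"
proof -
  have nx: "norm (x ^ k) < 1" "x ^ k \<noteq> 0" if "k > 0" for k
    using that x by (simp_all add: norm_power power_less_one_iff)
  have e: "e d \<noteq> 0" if "d > 0" for d unfolding e_def using epoch_nonzero[OF x(1) that] .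
  have e1: "e (Suc 0) \<noteq> 0" using e[of 1] by simp
  note pw = power_mult[symmetric] epoch_power
  note th = theta_at_divisions[OF x, folded e_def]
  note th2 = theta_at_divisions[OF nx[of 2], simplified pw, simplified, folded e_def]
  have nz: "theta x (x ^ 2) \<noteq> 0" "theta x (x ^ 4) \<noteq> 0" "theta x (x ^ 6) \<noteq> 0"
     "theta x (x ^ 12) * theta (x ^ 5) (x ^ 12) \<noteq> 0"
    unfolding th using e by simp_all
  have tm: "theta (- y) (x ^ k) = theta (y ^ 2) (x ^ (k * 2)) / theta y (x ^ k)" if "theta y (x ^ k) \<noteq> 0" "k > 0" for y k
    using theta_minus[OF nx(1)[OF that(2)], of y] that by (simp add: pw eq_divide_eq mult.commute)
  show "theta (- x) (x ^ 2) = (e 2 ^ 2 / (e 1 * e 4)) ^ 2"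
    unfolding tm[OF nz(1), simplified] th th2 using e e1 by (simp add: field_simps eval_nat_numeral)
  show "theta (- x) (x ^ 4) = e 2 ^ 2 / (e 1 * e 4)"
    unfolding tm[OF nz(2), simplified] th th2 using e e1 by (simp add: field_simps eval_nat_numeral)
  show "theta (- x) (x ^ 6) = e 2 ^ 2 * e 3 * e 12 / (e 1 * e 4 * e 6 ^ 2)"
    unfolding tm[OF nz(3), simplified] th th2 using e e1 by (simp add: field_simps eval_nat_numeral)
  show "theta (- x) (x ^ 12) * theta (- (x ^ 5)) (x ^ 12) = e 2 ^ 2 * e 3 * e 12 / (e 1 * e 4 * e 6 ^ 2)"
  proof -
    have nz': "theta x (x ^ 12) \<noteq> 0" "theta (x ^ 5) (x ^ 12) \<noteq> 0" using nz(4) by auto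
    have "theta (- x) (x ^ 12) * theta (- (x ^ 5)) (x ^ 12) = 
       (theta (x ^ 2) (x ^ 24) * theta (x ^ 10) (x ^ 24)) / (theta x (x ^ 12) * theta (x ^ 5) (x ^ 12))"
      unfolding tm[OF nz'(1), simplified] tm[OF nz'(2), simplified pw, simplified] by (simp add: pw)
    thus ?thesis unfolding th th2 using e e1 by (simp add: field_simps eval_nat_numeral)
  qed
  have h: "qpoch y (y ^ 2) = epoch y 1 / epoch y 2" if "norm y < 1" for y
    using epoch_dissect[OF that, of 1 2] epoch_nonzero[OF that, of 2]
    by (simp add: lessThan_nat_numeral lessThan_Suc numeral_2_eq_2[symmetric] epoch_def eq_divide_eq del: power_Suc)
  have "qpoch x (x ^ 2) * qpoch (- x) (x ^ 2) = qpoch (x ^ 2) ((x ^ 2) ^ 2)"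
    by (rule qpoch_minus) (rule nx, simp)
  moreover have "qpoch (x ^ 2) ((x ^ 2) ^ 2) = e 2 / e 4"
    using h[OF nx(1)[of 2]] by (simp add: epoch_power e_def)
  ultimately have "e 1 / e 2 * qpoch (- x) (x ^ 2) = e 2 / e 4"
    unfolding h[OF x(1)] e_def[symmetric] by simp
  thus "qpoch (- x) (x ^ 2) = e 2 ^ 2 / (e 1 * e 4)"
    using e e1 by (simp add: field_simps power2_eq_square)
qed

text \<open>The fractions on the left are \<open>t / q\<close> for \<open>t = f\<^sub>2 / f\<^sub>7\<close> in the notation of the introduction.  Dividing each
  of the two theta relations by the term without a factor \<open>q\<close> on its left leaves products that are all eta quotients.\<close>

lemma eta_relations:
  assumes q: "norm q < 1" "q \<noteq> 0"
  defines "e \<equiv> epoch q"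
  shows "1 + q * (e 2 * e 3 ^ 2 * e 4 * e 24 ^ 2 / (e 1 ^ 2 * e 6 * e 8 ^ 2 * e 12)) = 
           e 6 ^ 2 * e 12 ^ 2 / (e 1 * e 3 * e 8 * e 24)" (is ?th1)
    and "1 + 3 * q * (e 2 * e 3 ^ 2 * e 4 * e 24 ^ 2 / (e 1 ^ 2 * e 6 * e 8 ^ 2 * e 12)) = 
           e 2 ^ 3 * e 3 * e 4 ^ 3 * e 24 / (e 1 ^ 3 * e 6 * e 8 ^ 3 * e 12)" (is ?th2)
proof -
  have nq: "norm (q ^ k) < 1" "q ^ k \<noteq> 0" if "k > 0" for k
    using that q by (simp_all add: norm_power power_less_one_iff)
  have e: "e d \<noteq> 0" if "d > 0" for d unfolding e_def using epoch_nonzero[OF q(1) that] .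
  have e1: "e (Suc 0) \<noteq> 0" using e[of 1] by simp
  note pw = power_mult[symmetric] epoch_power
  note th = theta_at_divisions[OF q, folded e_def] theta_minus_at_divisions[OF q, folded e_def]
  have th': "theta (q ^ 4) (q ^ 12) = e 4 / e 12" "theta (- (q ^ 2)) (q ^ 12) = e 4 ^ 2 * e 6 * e 24 / (e 2 * e 8 * e 12 ^ 2)"
    "theta (- (q ^ 3)) (q ^ 12) = e 6 ^ 2 / (e 3 * e 12)" "theta (- (q ^ 6)) (q ^ 12) = (e 12 ^ 2 / (e 6 * e 24)) ^ 2"
    "theta (q ^ 3) (q ^ 12) = e 3 / e 6" "theta (- (q ^ 2)) (q ^ 4) = (e 4 ^ 2 / (e 2 * e 8)) ^ 2"
    "qpoch (- (q ^ 2)) (q ^ 4) = e 4 ^ 2 / (e 2 * e 8)" "qpoch (- (q ^ 6)) (q ^ 12) = e 12 ^ 2 / (e 6 * e 24)"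
    using theta_at_divisions(3)[OF nq[of 4], simplified pw] theta_minus_at_divisions(3)[OF nq[of 2], simplified pw]
      theta_minus_at_divisions(2)[OF nq[of 3], simplified pw] theta_minus_at_divisions(1)[OF nq[of 6], simplified pw]
      theta_at_divisions(2)[OF nq[of 3], simplified pw] theta_minus_at_divisions(1,5)[OF nq[of 2], simplified pw]
      theta_minus_at_divisions(5)[OF nq[of 6], simplified pw]
    by (simp_all add: e_def)
  define w where "w = cis (2 * pi / 3)"
  have "real 3 * (2 * pi / 3) = 2 * pi" by simp
  hence w3: "w ^ 3 = 1" unfolding w_def Complex.DeMoivre by (simp only: cis_2pi)
  have wn: "w \<noteq> 0" by (simp add: w_def)
  have c1: "theta (w * q) (q ^ 4) * theta (w ^ 2 * q) (q ^ 4) = e 2 * e 3 / (e 1 * e 6)"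
  proof -
    have "theta q (q ^ 4) * (theta (w * q) (q ^ 4) * theta (w ^ 2 * q) (q ^ 4)) = theta (q ^ 3) (q ^ 12)"
      using theta_cube[OF nq(1)[of 4] w_def, of q] by (simp add: pw)
    thus ?thesis unfolding th th' using e e1 by (simp add: field_simps)
  qed
  have c2: "theta (- (w * q)) (q ^ 4) * theta (- (w ^ 2 * q)) (q ^ 4) = e 6 ^ 2 * e 1 * e 4 / (e 3 * e 12 * e 2 ^ 2)"
  proof -
    have "theta (- q) (q ^ 4) * (theta (- (w * q)) (q ^ 4) * theta (- (w ^ 2 * q)) (q ^ 4)) = theta (- (q ^ 3)) (q ^ 12)"
      using theta_cube[OF nq(1)[of 4] w_def, of "- q"] by (simp add: pw)
    thus ?thesis unfolding th th' using e e1 by (simp add: field_simps)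
  qed
  have c3: "theta (- (w * q ^ 2)) (q ^ 4) = e 12 ^ 2 * e 8 * e 2 / (e 24 * e 6 * e 4 ^ 2)"
  proof -
    have "q ^ 4 / (- (w * q ^ 2)) = w ^ 2 * - (q ^ 2)"
      using q wn w3 by (simp add: field_simps eval_nat_numeral)
    hence "theta (- (w * q ^ 2)) (q ^ 4) = qpoch (w * - (q ^ 2)) (q ^ 4) * qpoch (w ^ 2 * - (q ^ 2)) (q ^ 4)"
      by (simp add: theta_def)
    moreover have "qpoch (- (q ^ 2)) (q ^ 4) * (qpoch (w * - (q ^ 2)) (q ^ 4) * qpoch (w ^ 2 * - (q ^ 2)) (q ^ 4)) = qpoch (- (q ^ 6)) (q ^ 12)"
      using qpoch_cube[OF nq(1)[of 4] w_def, of "- (q ^ 2)"] by (simp add: pw)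
    ultimately show ?thesis unfolding th' using e e1 by (simp add: field_simps)
  qed
  have "(e 4 / e 12) ^ 2 * (e 1 * e 6 / (e 2 * e 3)) + q * (e 4 ^ 2 * e 6 * e 24 / (e 2 * e 8 * e 12 ^ 2)) ^ 2 * 
          (e 2 ^ 2 * e 3 * e 12 / (e 1 * e 4 * e 6 ^ 2)) = 
      (e 6 ^ 2 / (e 3 * e 12)) ^ 2 * (e 12 ^ 2 / (e 6 * e 24)) ^ 2 * (e 4 ^ 2 * e 6 * e 24 / (e 2 * e 8 * e 12 ^ 2))"
    using theta_relation_nome_12[OF q] unfolding th th' .
  moreover have "q * (e 4 ^ 2 * e 6 * e 24 / (e 2 * e 8 * e 12 ^ 2)) ^ 2 * 
          (e 2 ^ 2 * e 3 * e 12 / (e 1 * e 4 * e 6 ^ 2)) = (e 4 / e 12) ^ 2 * (e 1 * e 6 / (e 2 * e 3)) * 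
        (q * (e 2 * e 3 ^ 2 * e 4 * e 24 ^ 2 / (e 1 ^ 2 * e 6 * e 8 ^ 2 * e 12)))"
    using e e1 by (simp add: field_simps eval_nat_numeral)
  moreover have "(e 6 ^ 2 / (e 3 * e 12)) ^ 2 * (e 12 ^ 2 / (e 6 * e 24)) ^ 2 * (e 4 ^ 2 * e 6 * e 24 / (e 2 * e 8 * e 12 ^ 2))
     = (e 4 / e 12) ^ 2 * (e 1 * e 6 / (e 2 * e 3)) * (e 6 ^ 2 * e 12 ^ 2 / (e 1 * e 3 * e 8 * e 24))"
    using e e1 by (simp add: field_simps eval_nat_numeral)
  ultimately have "(e 4 / e 12) ^ 2 * (e 1 * e 6 / (e 2 * e 3)) * 
      (1 + q * (e 2 * e 3 ^ 2 * e 4 * e 24 ^ 2 / (e 1 ^ 2 * e 6 * e 8 ^ 2 * e 12))) = 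
      (e 4 / e 12) ^ 2 * (e 1 * e 6 / (e 2 * e 3)) * (e 6 ^ 2 * e 12 ^ 2 / (e 1 * e 3 * e 8 * e 24))"
    by (simp only: distrib_left mult_1_right)
  moreover have "(e 4 / e 12) ^ 2 * (e 1 * e 6 / (e 2 * e 3)) \<noteq> 0" using e e1 by simp
  ultimately show ?th1 by (simp only: mult_cancel_left simp_thms)
  let ?W = "e 12 ^ 2 * e 8 * e 2 / (e 24 * e 6 * e 4 ^ 2)"
  let ?V = "e 6 ^ 2 * e 1 * e 4 / (e 3 * e 12 * e 2 ^ 2)"
  have "3 * q * (e 2 * e 3 / (e 1 * e 6)) * (e 12 / e 4) ^ 2 + ?W ^ 2 * ?V = 
      (e 4 ^ 2 / (e 2 * e 8)) ^ 2 * ?W * (e 2 ^ 2 / (e 1 * e 4)) ^ 2"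
    using theta_relation_nome_4[OF q w_def] unfolding th th' c1 c2 c3 e_def[symmetric] .
  moreover have "3 * q * (e 2 * e 3 / (e 1 * e 6)) * (e 12 / e 4) ^ 2 = 
      ?W ^ 2 * ?V * (3 * q * (e 2 * e 3 ^ 2 * e 4 * e 24 ^ 2 / (e 1 ^ 2 * e 6 * e 8 ^ 2 * e 12)))"
    using e e1 by (simp add: field_simps eval_nat_numeral)
  moreover have "(e 4 ^ 2 / (e 2 * e 8)) ^ 2 * ?W * (e 2 ^ 2 / (e 1 * e 4)) ^ 2 = 
     ?W ^ 2 * ?V * (e 2 ^ 3 * e 3 * e 4 ^ 3 * e 24 / (e 1 ^ 3 * e 6 * e 8 ^ 3 * e 12))"
    using e e1 by (simp add: field_simps eval_nat_numeral)
  ultimately have "?W ^ 2 * ?V * (1 + 3 * q * (e 2 * e 3 ^ 2 * e 4 * e 24 ^ 2 / (e 1 ^ 2 * e 6 * e 8 ^ 2 * e 12))) = 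
     ?W ^ 2 * ?V * (e 2 ^ 3 * e 3 * e 4 ^ 3 * e 24 / (e 1 ^ 3 * e 6 * e 8 ^ 3 * e 12))"
    by (simp only: distrib_left mult_1_right add.commute)
  moreover have "?W ^ 2 * ?V \<noteq> 0" using e e1 by simp
  ultimately show ?th2 by (simp only: mult_cancel_left simp_thms)
qed

section \<open>The table of eta quotients\<close>

lemma dedekind_eta_epoch:
  assumes "Im z > 0" "d > 0"
  shows "dedekind_eta (of_nat d * z) = cexp z 0 (real d / 12) * epoch (exp (2 * pi * \<i> * z)) d"
proof -
  have "exp (2 * of_real pi * \<i> * of_nat (Suc n) * (of_nat d * z)) = 
      exp (2 * pi * \<i> * z) ^ d * (exp (2 * pi * \<i> * z) ^ d) ^ n" for n
    by (simp add: exp_of_nat_mult[symmetric] exp_add[symmetric] algebra_simps)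
  moreover have "exp (of_real pi * \<i> * (of_nat d * z) / 12) = cexp z 0 (real d / 12)"
    by (simp add: cexp_def algebra_simps)
  ultimately show ?thesis by (simp only: dedekind_eta_def epoch_def qpoch_def)
qed

lemma divisors_24: "{d :: nat. d dvd 24} = {1, 2, 3, 4, 6, 8, 12, 24}"
proof -
  have "d \<in> {1, 2, 3, 4, 6, 8, 12, 24}" if "d dvd 24" for d :: nat
  proof -
    have "d \<le> 24" using that by (rule dvd_imp_le) simp
    hence "d \<in> {..<25}" by simp
    thus ?thesis using that by (auto simp: lessThan_nat_numeral lessThan_Suc)
  qed
  thus ?thesis by auto
qed

lemma cexp_power_int: "cexp z a b powi n = cexp z (of_int n * a) (of_int n * b)"
proof -
  have "inverse (cexp z c d) = cexp z (- c) (- d)" for c d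
    by (simp add: cexp_def exp_minus[symmetric] algebra_simps)
  thus ?thesis
    by (cases n rule: int_cases4) (simp_all add: power_int_minus cexp_power)
qed

lemma eta_quotient_24:
  assumes z: "Im z > 0"
  defines "e \<equiv> epoch (exp (2 * pi * \<i> * z))"
  shows "eta_quotient 24 r z = cexp z 0 (of_int (r 1 + 2 * r 2 + 3 * r 3 + 4 * r 4 + 6 * r 6 + 8 * r 8 
      + 12 * r 12 + 24 * r 24) / 12) *
     (e 1 powi r 1 * e 2 powi r 2 * e 3 powi r 3 * e 4 powi r 4 * e 6 powi r 6 * e 8 powi r 8 
      * e 12 powi r 12 * e 24 powi r 24)"
proof -
  have "eta_quotient 24 r z = (\<Prod>\<delta>\<in>{1, 2, 3, 4, 6, 8, 12, 24}. 
           cexp z 0 (of_int (r \<delta>) * (real \<delta> / 12)) * e \<delta> powi r \<delta>)"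
    unfolding eta_quotient_def divisors_24
  proof (rule prod.cong[OF refl])
    fix \<delta> :: nat assume "\<delta> \<in> {1, 2, 3, 4, 6, 8, 12, 24}"
    hence "\<delta> > 0" by auto
    show "dedekind_eta (of_nat \<delta> * z) powi r \<delta> = cexp z 0 (of_int (r \<delta>) * (real \<delta> / 12)) * e \<delta> powi r \<delta>"
      unfolding dedekind_eta_epoch[OF z \<open>\<delta> > 0\<close>] e_def power_int_mult_distrib cexp_power_int by simp
  qed
  also have "\<dots> = (\<Prod>\<delta>\<in>{1, 2, 3, 4, 6, 8, 12, 24}. cexp z 0 (of_int (r \<delta>) * (real \<delta> / 12))) *
     (\<Prod>\<delta>\<in>{1, 2, 3, 4, 6, 8, 12, 24}. e \<delta> powi r \<delta>)" by (rule prod.distrib)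
  also have "(\<Prod>\<delta>\<in>{1, 2, 3, 4, 6, 8, 12, 24 :: nat}. cexp z 0 (of_int (r \<delta>) * (real \<delta> / 12))) = 
     cexp z 0 (of_int (r 1 + 2 * r 2 + 3 * r 3 + 4 * r 4 + 6 * r 6 + 8 * r 8 + 12 * r 12 + 24 * r 24) / 12)"
    by (simp add: cexp_mult) (simp add: field_simps)?
  also have "(\<Prod>\<delta>\<in>{1, 2, 3, 4, 6, 8, 12, 24}. e \<delta> powi r \<delta>) = e 1 powi r 1 * e 2 powi r 2 * e 3 powi r 3 * e 4 powi r 4 * e 6 powi r 6 * e 8 powi r 8 
      * e 12 powi r 12 * e 24 powi r 24" by (simp add: mult_ac)
  finally show ?thesis .
qed

text \<open>Comparison of the two evaluations of \<open>wp T + wp T\<^sup>5 - wp T\<^sup>7 - wp T\<^sup>1\<^sup>1\<close>.\<close>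

lemma Eis_quotients:
  assumes z: "Im z > 0"
  shows "Eis 1 24 z = (row2_quotient z + row5_quotient z) / 2" "Eis 24 1 z = - (row8_quotient z + 2 * row7_quotient z)"
    "Eis (-8) (-3) z = 2 * row2_quotient z - row5_quotient z" "Eis (-3) (-8) z = (row8_quotient z - row7_quotient z) / 2"
proof -
  have s: "complex_of_real (sqrt k) \<noteq> 0" if "k \<noteq> 0" for k using that by simp
  note t = torsion_sums[OF z, unfolded Eis_as_wp[OF z]]
  show "Eis 1 24 z = (row2_quotient z + row5_quotient z) / 2" using t(1) by (simp add: field_simps)
  have "4 * complex_of_real (sqrt 6) * (Eis 24 1 z + (row8_quotient z + 2 * row7_quotient z)) = 0" using t(2) by (simp add: algebra_simps)
  hence "Eis 24 1 z + (row8_quotient z + 2 * row7_quotient z) = 0" by simp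
  thus "Eis 24 1 z = - (row8_quotient z + 2 * row7_quotient z)" by (rule eq_neg_iff_add_eq_0[THEN iffD2])
  show "Eis (-8) (-3) z = 2 * row2_quotient z - row5_quotient z" using t(3) by simp
  have "\<i> * complex_of_real (sqrt 3) * (2 * Eis (-3) (-8) z - (row8_quotient z - row7_quotient z)) = 0" using t(4) by (simp add: algebra_simps)
  hence "2 * Eis (-3) (-8) z - (row8_quotient z - row7_quotient z) = 0" by simp
  thus "Eis (-3) (-8) z = (row8_quotient z - row7_quotient z) / 2" by (simp add: field_simps)
qed

theorem theorem5p2:
  fixes r :: "nat \<Rightarrow> int" and b1 b2 b3 b4 z :: complex
  assumes "([r 1, r 2, r 3, r 4, r 6, r 8, r 12, r 24], [b1, b2, b3, b4]) \<in> eis_table"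
    and "Im z > 0"
  shows "eta_quotient 24 r z =
    b1 * Eis 24 1 z + b2 * Eis 1 24 z + b3 * Eis (-8) (-3) z + b4 * Eis (-3) (-8) z"
proof -
  define q where "q = exp (2 * pi * \<i> * z)"
  define e where "e = epoch q"
  define t where "t = q * (e 2 * e 3 ^ 2 * e 4 * e 24 ^ 2 / (e 1 ^ 2 * e 6 * e 8 ^ 2 * e 12))"
  have q: "norm q < 1" "q \<noteq> 0" using assms(2) by (simp_all add: q_def)
  have e: "e d \<noteq> 0" if "d > 0" for d unfolding e_def using epoch_nonzero[OF q(1) that] .
  have e1: "e (Suc 0) \<noteq> 0" using e[of 1] by simp
  have c2: "cexp z 0 2 = q" and c0: "cexp z 0 0 = 1" by (simp_all add: cexp_def q_def mult_ac)
  note quot = row2_quotient_def row5_quotient_def row7_quotient_def row8_quotient_def q_def[symmetric] e_def[symmetric] Let_def c2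
  have u1: "1 + t = e 6 ^ 2 * e 12 ^ 2 / (e 1 * e 3 * e 8 * e 24)"
    and u3: "1 + 3 * t = e 2 ^ 3 * e 3 * e 4 ^ 3 * e 24 / (e 1 ^ 3 * e 6 * e 8 ^ 3 * e 12)"
    using eta_relations[OF q] by (simp_all only: t_def e_def mult.assoc)
  have q2: "row2_quotient z = row7_quotient z * t" and q5: "row5_quotient z = row8_quotient z * t"
    unfolding quot t_def using e e1 by (simp_all add: field_simps eval_nat_numeral)
  have eta: "eta_quotient 24 r z = cexp z 0 (of_int (r 1 + 2 * r 2 + 3 * r 3 + 4 * r 4 + 6 * r 6 + 8 * r 8 
      + 12 * r 12 + 24 * r 24) / 12) *
     (e 1 powi r 1 * e 2 powi r 2 * e 3 powi r 3 * e 4 powi r 4 * e 6 powi r 6 * e 8 powi r 8 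
      * e 12 powi r 12 * e 24 powi r 24)"
    using eta_quotient_24[OF assms(2)] unfolding e_def q_def .
  note E = Eis_quotients[OF assms(2)]
  from assms(1) show ?thesis
    unfolding eis_table_def insert_iff empty_iff prod.inject list.inject
  proof (elim disjE conjE FalseE, goal_cases)
    case 1
    have "eta_quotient 24 r z = row7_quotient z * (1 + t)"
      unfolding eta quot u1 1 using e e1 by (simp add: c0 power_int_minus field_simps eval_nat_numeral)
    thus ?case unfolding E q2 q5 1 by (simp add: field_simps)
  next
    case 2
    have "eta_quotient 24 r z = row2_quotient z"
      unfolding eta quot u1 2 using e e1 by (simp add: c0 c2 power_int_minus field_simps eval_nat_numeral)
    thus ?case unfolding E 2 by (simp add: field_simps)
  next
    case 3
    have "eta_quotient 24 r z = row7_quotient z * (1 + 3 * t)"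
      unfolding eta quot u3 3 using e e1 by (simp add: c0 power_int_minus field_simps eval_nat_numeral)
    thus ?case unfolding E q2 q5 3 by (simp add: field_simps)
  next
    case 4
    have "eta_quotient 24 r z = row8_quotient z * (1 + t)"
      unfolding eta quot u1 4 using e e1 by (simp add: c0 power_int_minus field_simps eval_nat_numeral)
    thus ?case unfolding E q2 q5 4 by (simp add: field_simps)
  next
    case 5
    have "eta_quotient 24 r z = row5_quotient z"
      unfolding eta quot 5 using e e1 by (simp add: c0 c2 power_int_minus field_simps eval_nat_numeral)
    thus ?case unfolding E 5 by (simp add: field_simps)
  next
    case 6
    have "eta_quotient 24 r z = row8_quotient z * (1 + 3 * t)"
      unfolding eta quot u3 6 using e e1 by (simp add: c0 power_int_minus field_simps eval_nat_numeral)
    thus ?case unfolding E q2 q5 6 by (simp add: field_simps)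
  next
    case 7
    have "eta_quotient 24 r z = row7_quotient z"
      unfolding eta quot 7 using e e1 by (simp add: c0 power_int_minus field_simps eval_nat_numeral)
    thus ?case unfolding E 7 by (simp add: field_simps)
  next
    case 8
    have "eta_quotient 24 r z = row8_quotient z"
      unfolding eta quot 8 using e e1 by (simp add: c0 power_int_minus field_simps eval_nat_numeral)
    thus ?case unfolding E 8 by (simp add: field_simps)
  qed
qed

end
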